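(* Let $k$ be a field with $\operatorname{char}k\neq2$ and $M\supseteq k$ an infinite field. For $\mathbf a=(a,b),\mathbf a'=(a',b')\in M^2$ with $D_{\mathbf a}D_{\mathbf a'}\neq0$, assume $G_{\mathbf a}\cong\mathcal S_3$ or $\mathcal C_3$ and $\#G_{\mathbf a'}\ge3$. Then for the given pair $(G_{\mathbf a},G_{\mathbf a'})$ the triple (isomorphism type of $G_{\mathbf a,\mathbf a'}$, relation between $L_{\mathbf a},L_{\mathbf a'}$, $\mathrm{DT}(\mathcal R_{\mathbf a,\mathbf a'})$) is one of the rows below for that pair (GAP IDs in brackets; "$n$" abbreviates $[L_{\mathbf a}\cap L_{\mathbf a'}:M]=n$, "$=M$" abbreviates $L_{\mathbf a}\cap L_{\mathbf a'}=M$). $(\mathcal S_3,\mathcal S_4)$: (IV-1) $[144,183]$ $\mathcal S_3\times\mathcal S_4$, $=M$, $24$; (IV-2) $[72,43]$ $(\mathcal C_3\times\mathcal A_4)\rtimes\mathcal C_2$, $2$, $12,12$; (IV-3) $[24,12]$ $\mathcal S_4$, $L_{\mathbf a}\subset L_{\mathbf a'}$, $12,8,4$. $(\mathcal S_3,\mathcal A_4)$: (IV-4) $[72,44]$ $\mathcal S_3\times\mathcal A_4$, $=M$, $24$. $(\mathcal S_3,\mathcal D_4)$: (IV-5) $[48,38]$ $\mathcal S_3\times\mathcal D_4$, $=M$, $24$; (IV-6) $[24,6]$ $\mathcal D_{12}$, $2$, $12,12$; (IV-7) $[24,8]$ $(\mathcal C_3\times\mathcal V_4)\rtimes\mathcal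 C_2$, $2$, $24$; (IV-8) $[24,8]$ same, $2$, $12,12$. $(\mathcal S_3,\mathcal C_4)$: (IV-9) $[24,5]$ $\mathcal S_3\times\mathcal C_4$, $=M$, $24$; (IV-10) $[12,1]$ $\mathcal C_3\rtimes\mathcal C_4$, $2$, $12,12$. $(\mathcal S_3,\mathcal V_4)$: (IV-11) $[24,14]$ $\mathcal S_3\times\mathcal V_4$, $=M$, $24$; (IV-12) $[24,14]$ same, $=M$, $12,12$; (IV-13) $[12,4]$ $\mathcal D_6$, $2$, $12,12$; (IV-14) $[12,4]$ $\mathcal D_6$, $2$, $12,6,6$; (IV-15) $[12,4]$ $\mathcal D_6$, $2$, $6,6,6,6$. $(\mathcal S_3,\mathcal S_3)$: (IV-16) $[36,10]$ $\mathcal S_3\times\mathcal S_3$, $=M$, $18,6$; (IV-17) $[18,4]$ $(\mathcal C_3\times\mathcal C_3)\rtimes\mathcal C_2$, $2$, $9,9,3,3$; (IV-18) $[6,1]$ $\mathcal S_3$, $L_{\mathbf a}=L_{\mathbf a'}$, $6^2,3^3,2,1$. $(\mathcal S_3,\mathcal C_3)$: (IV-19) $[18,3]$ $\mathcal S_3\times\mathcal C_3$, $=M$, $18,6$. $(\mathcal C_3,\mathcal S_4)$: (V-1) $[72,42]$ $\mathcal C_3\times\mathcal S_4$, $=M$, $24$. $(\mathcal C_3,\mathcal A_4)$: (V-2) $[36,11]$ $\mathcal C_3\times\mathcal A_4$, $=M$, $12,12$; (V-3) $[12,3]$ $\mathcal A_4$, $L_{\mathbf a}\subset L_{\mathbf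 a'}$, $12,4,4,4$. $(\mathcal C_3,\mathcal D_4)$: (V-4) $[24,10]$ $\mathcal C_3\times\mathcal D_4$, $=M$, $24$. $(\mathcal C_3,\mathcal C_4)$: (V-5) $[12,2]$ $\mathcal C_{12}$, $=M$, $12,12$. $(\mathcal C_3,\mathcal V_4)$: (V-6) $[12,5]$ $\mathcal C_3\times\mathcal V_4$, $=M$, $12,12$. $(\mathcal C_3,\mathcal S_3)$: (V-7) $[18,3]$ $\mathcal C_3\times\mathcal S_3$, $=M$, $18,6$. $(\mathcal C_3,\mathcal C_3)$: (V-8) $[9,2]$ $\mathcal C_3\times\mathcal C_3$, $=M$, $9,9,3,3$; (V-9) $[3,1]$ $\mathcal C_3$, $L_{\mathbf a}=L_{\mathbf a'}$, $3^7,1^3$.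
   Context: For $\mathbf a=(a,b)\in M^2$, $f_{\mathbf a}(X)=X^4+aX^2+bX+b$, with discriminant $D_{\mathbf a}=b(16a^4-128a^2b-4a^3b+256b^2+144ab^2-27b^3)$. $L_{\mathbf a}$ is the splitting field of $f_{\mathbf a}$ over $M$, $G_{\mathbf a}=\mathrm{Gal}(f_{\mathbf a}/M)$ (up to isomorphism), $G_{\mathbf a,\mathbf a'}=\mathrm{Gal}(L_{\mathbf a}L_{\mathbf a'}/M)$. $\mathcal S_n,\mathcal A_n,\mathcal C_n$ are symmetric, alternating, cyclic groups; $\mathcal D_n$ is dihedral of order $2n$; $\mathcal V_4=\mathcal C_2\times\mathcal C_2$. With roots $\alpha_1,\dots,\alpha_4$ of $f_{\mathbf a}$ and $\beta_1,\dots,\beta_4$ of $f_{\mathbf a'}$, $\mathcal R_{\mathbf a,\mathbf a'}(X)=\prod_{\pi\in\mathcal S_4}(X-\sum_i\alpha_i\beta_{\pi(i)})$. $\mathrm{DT}(\mathcal R_{\mathbf a,\mathbf a'})$ is the partition of $24$ given by orbit sizes of $G_{\mathbf a,\mathbf a'}$ acting on the $24$ bijections $\varphi:\{\alpha_i\}\to\{\beta_j\}$ via $(\sigma\cdot\varphi)(\alpha)=\sigma(\varphi(\sigma^{-1}\alpha))$; it equals the multiset of degrees of irreducible factors of $\mathcal R_{\mathbf a,\mathbf a'}$ over $M$ when there are no repeated factors. Exponents denote repetition. *)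

theory Defs
  imports "HOL-Algebra.Algebra" "HOL-Algebra.Algebraic_Closure_Type"
begin

text \<open>
  The base field \<open>M\<close> is a type \<open>'m\<close> of class \<open>field\<close>. All extensions of \<open>M\<close> are subsets of the
  fixed algebraic closure \<open>'m alg_closure\<close>, in which \<open>M\<close> itself is the image of \<open>to_ac\<close>.
\<close>

abbreviation closure_ring :: "'m::field alg_closure ring" where
  "closure_ring \<equiv> ring_of_type_algebra"

abbreviation base_field :: "'m::field alg_closure set" where
  "base_field \<equiv> range to_ac"

definition closure_roots :: "'m::field poly \<Rightarrow> 'm alg_closure set" where
  "closure_roots f = {x. poly (map_poly to_ac f) x = 0}"

definition splitting_field :: "'m::field poly \<Rightarrow> 'm alg_closure set" where
  "splitting_field f = generate_field closure_ring (base_field \<union> closure_roots f)"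

definition compositum :: "'m::field alg_closure set \<Rightarrow> 'm alg_closure set \<Rightarrow> 'm alg_closure set" where
  "compositum K L = generate_field closure_ring (K \<union> L)"

text \<open>Automorphisms of \<open>L\<close> are taken extensional on \<open>L\<close>, as in \<^const>\<open>BijGroup\<close>.\<close>

definition Gal :: "'m::field alg_closure set \<Rightarrow> ('m alg_closure \<Rightarrow> 'm alg_closure) monoid" where
  "Gal L = (BijGroup L)
     \<lparr>carrier := {\<sigma> \<in> Bij L.
        \<sigma> \<in> ring_iso (closure_ring\<lparr>carrier := L\<rparr>) (closure_ring\<lparr>carrier := L\<rparr>) \<and>
        (\<forall>x\<in>base_field. \<sigma> x = x)}\<rparr>"

definition quartic :: "'m::field \<times> 'm \<Rightarrow> 'm poly" where
  "quartic = (\<lambda>(a, b). [:b, b, a, 0, 1:])"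

definition quartic_disc :: "'m::field \<times> 'm \<Rightarrow> 'm" where
  "quartic_disc = (\<lambda>(a, b). b * (16 * a^4 - 128 * a^2 * b - 4 * a^3 * b + 256 * b^2
                                  + 144 * a * b^2 - 27 * b^3))"

definition L_field :: "'m::field \<times> 'm \<Rightarrow> 'm alg_closure set" where
  "L_field a = splitting_field (quartic a)"

definition G_single :: "'m::field \<times> 'm \<Rightarrow> ('m alg_closure \<Rightarrow> 'm alg_closure) monoid" where
  "G_single a = Gal (L_field a)"

definition G_pair ::
  "'m::field \<times> 'm \<Rightarrow> 'm \<times> 'm \<Rightarrow> ('m alg_closure \<Rightarrow> 'm alg_closure) monoid" where
  "G_pair a a' = Gal (compositum (L_field a) (L_field a'))"

text \<open>\<open>meet_degree a a' n\<close> says that the intersection of the two splitting fields has degree \<open>n\<close>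
  over \<open>M\<close>.\<close>

definition meet_degree :: "'m::field \<times> 'm \<Rightarrow> 'm \<times> 'm \<Rightarrow> nat \<Rightarrow> bool" where
  "meet_degree a a' n \<longleftrightarrow> ring.dimension closure_ring n base_field (L_field a \<inter> L_field a')"

definition root_bijections ::
  "'m::field \<times> 'm \<Rightarrow> 'm \<times> 'm \<Rightarrow> ('m alg_closure \<Rightarrow> 'm alg_closure) set" where
  "root_bijections a a' =
     {\<phi> \<in> extensional (closure_roots (quartic a)).
        bij_betw \<phi> (closure_roots (quartic a)) (closure_roots (quartic a'))}"

definition root_action ::
  "'m::field \<times> 'm \<Rightarrow> 'm \<times> 'm \<Rightarrow> ('m alg_closure \<Rightarrow> 'm alg_closure) \<Rightarrow>
     ('m alg_closure \<Rightarrow> 'm alg_closure) \<Rightarrow> ('m alg_closure \<Rightarrow> 'm alg_closure)" where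
  "root_action a a' \<sigma> \<phi> =
     (\<lambda>\<alpha> \<in> closure_roots (quartic a). \<sigma> (\<phi> ((inv\<^bsub>G_pair a a'\<^esub> \<sigma>) \<alpha>)))"

definition decomposition_type :: "'m::field \<times> 'm \<Rightarrow> 'm \<times> 'm \<Rightarrow> nat multiset" where
  "decomposition_type a a' =
     image_mset card (mset_set (orbits (G_pair a a') (root_bijections a a') (root_action a a')))"

abbreviation Sym :: "nat \<Rightarrow> (nat \<Rightarrow> nat) monoid" where "Sym \<equiv> sym_group"
abbreviation Alt :: "nat \<Rightarrow> (nat \<Rightarrow> nat) monoid" where "Alt \<equiv> alt_group"
abbreviation Cyc :: "nat \<Rightarrow> int monoid" where "Cyc \<equiv> integer_mod_group"

definition Klein :: "(int \<times> int) monoid" where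
  "Klein = Cyc 2 \<times>\<times> Cyc 2"

definition semidirect ::
  "('a, 'c) monoid_scheme \<Rightarrow> ('b, 'd) monoid_scheme \<Rightarrow> ('b \<Rightarrow> 'a \<Rightarrow> 'a) \<Rightarrow> ('a \<times> 'b) monoid" where
  "semidirect N H \<theta> =
     \<lparr>carrier = carrier N \<times> carrier H,
      monoid.mult = (\<lambda>(m, g) (n, h). (m \<otimes>\<^bsub>N\<^esub> \<theta> g n, g \<otimes>\<^bsub>H\<^esub> h)),
      one = (\<one>\<^bsub>N\<^esub>, \<one>\<^bsub>H\<^esub>)\<rparr>"

text \<open>The dihedral group of order \<open>2n\<close>.\<close>

definition Dih :: "nat \<Rightarrow> (int \<times> int) monoid" where
  "Dih n = semidirect (Cyc n) (Cyc 2) (\<lambda>h x. if h = 0 then x else inv\<^bsub>Cyc n\<^esub> x)"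

text \<open>
  The remaining semidirect products are fixed by their identifiers in the GAP small groups library,
  since the name alone does not determine the action.
\<close>

text \<open>
  \<open>[72,43]\<close>: the involution acts on both factors non-trivially, by inversion on \<open>C\<^sub>3\<close> and by
  conjugation with a transposition on \<open>A\<^sub>4\<close>. (If it acted on one factor only, one would get
  \<open>[72,42]\<close>, that is \<open>C\<^sub>3 \<times> S\<^sub>4\<close>, or \<open>[72,44]\<close>, that is \<open>S\<^sub>3 \<times> A\<^sub>4\<close>.)
\<close>

definition SmallGroup_72_43 :: "((int \<times> (nat \<Rightarrow> nat)) \<times> int) monoid" where
  "SmallGroup_72_43 = semidirect (Cyc 3 \<times>\<times> Alt 4) (Cyc 2)
     (\<lambda>h (x, p). if h = 0 then (x, p)
        else (inv\<^bsub>Cyc 3\<^esub> x,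
              Transposition.transpose 1 2 \<circ> p \<circ> Transposition.transpose 1 2))"

text \<open>\<open>[24,8]\<close>: inversion on \<open>C\<^sub>3\<close>, interchange of the two factors of \<open>V\<^sub>4 = C\<^sub>2 \<times> C\<^sub>2\<close>.\<close>

definition SmallGroup_24_8 :: "((int \<times> int \<times> int) \<times> int) monoid" where
  "SmallGroup_24_8 = semidirect (Cyc 3 \<times>\<times> Klein) (Cyc 2)
     (\<lambda>h (x, y, z). if h = 0 then (x, y, z) else (inv\<^bsub>Cyc 3\<^esub> x, z, y))"

text \<open>\<open>[18,4]\<close>: inversion on both factors.\<close>

definition SmallGroup_18_4 :: "((int \<times> int) \<times> int) monoid" where
  "SmallGroup_18_4 = semidirect (Cyc 3 \<times>\<times> Cyc 3) (Cyc 2)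
     (\<lambda>h (x, y). if h = 0 then (x, y) else (inv\<^bsub>Cyc 3\<^esub> x, inv\<^bsub>Cyc 3\<^esub> y))"

text \<open>\<open>[12,1]\<close>: a generator of \<open>C\<^sub>4\<close> acts by inversion.\<close>

definition SmallGroup_12_1 :: "(int \<times> int) monoid" where
  "SmallGroup_12_1 = semidirect (Cyc 3) (Cyc 4)
     (\<lambda>h x. if even h then x else inv\<^bsub>Cyc 3\<^esub> x)"

text \<open>A table row: isomorphism type of the joint Galois group, relation between the splitting
  fields, decomposition type.\<close>

definition row ::
  "'m::field \<times> 'm \<Rightarrow> 'm \<times> 'm \<Rightarrow> 'g monoid \<Rightarrow> bool \<Rightarrow> nat multiset \<Rightarrow> bool" where
  "row a a' H relation dt \<longleftrightarrow> G_pair a a' \<cong> H \<and> relation \<and> decomposition_type a a' = dt"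

end

theory Submission
  imports Defs
begin

text \<open>
  The group of the compositum embeds into \<open>S\<^sub>4 \<times> S\<^sub>4\<close> through its action on labelled roots. Its
  two projections are the groups of the two quartics, so by Goursat's lemma it is determined by a
  common quotient of these. As \<open>S\<^sub>3\<close> and \<open>C\<^sub>3\<close> have few quotients, there are three
  possibilities: the full product, a fibre product over the sign of \<open>S\<^sub>3\<close>, or the graph of a
  homomorphism onto \<open>S\<^sub>3\<close> or \<open>C\<^sub>3\<close>. Relabelling the roots brings each group into one of
  eight standard forms, and then everything is a finite check.

  The relation between the splitting fields is read off from the fixed field of the group and the
  surjectivity of restriction; a quadratic intersection is generated by the difference product of
  the three roots of the first quartic that are not fixed.
\<close>

section \<open>Subfields and minimal polynomials\<close>

text \<open>Two obstacles shape the proof. The base field need not be perfect, so separability has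
  to come from the discriminant. It is carried along as "as many roots as the degree", which
  survives passing to factors and turns the fixed-field argument into a root count. Secondly, the
  subgroups of S4 x S4 are too many to enumerate. Goursat's lemma avoids this: everything is
  governed by the kernel of the second projection, the elements \<open>p\<close> with
  \<open>(p, pid)\<close> in \<open>H\<close>. It is normal in the group of the first quartic, and
  S3 has only the normal subgroups 1, C3 and S3; the test whether \<open>(cyc3, pid)\<close> lies in
  \<open>H\<close> separates the graph from the other two cases. What then remains is a homomorphism
  from the second group, determined by the images of its generators. A search over tuples of images
  subject to relators can only produce too many candidates, which is harmless because the table
  claims only that no other rows occur. Rows that agree in group and relation but differ in orbit
  sizes come from the transitive and the intransitive Klein group, or from different index-two
  subgroups.\<close>

locale subfield_set =
  fixes K :: "'a::field set"
  assumes zero_mem [simp]: "0 \<in> K"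
    and one_mem [simp]: "1 \<in> K"
    and add_mem: "x \<in> K \<Longrightarrow> y \<in> K \<Longrightarrow> x + y \<in> K"
    and uminus_mem: "x \<in> K \<Longrightarrow> - x \<in> K"
    and mult_mem: "x \<in> K \<Longrightarrow> y \<in> K \<Longrightarrow> x * y \<in> K"
    and inverse_mem: "x \<in> K \<Longrightarrow> inverse x \<in> K"

definition polys_over :: "'a::zero set \<Rightarrow> 'a poly set" where
  "polys_over K = {p. \<forall>i. coeff p i \<in> K}"

text \<open>Values outside \<open>K\<close> are unconstrained. The condition at 1 excludes the zero
  map and thereby makes the map injective on a subfield.\<close>

definition field_hom_on :: "'a::field set \<Rightarrow> ('a \<Rightarrow> 'b::field) \<Rightarrow> bool" where
  "field_hom_on K \<sigma> \<longleftrightarrow> \<sigma> 1 = 1 \<and>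
     (\<forall>x\<in>K. \<forall>y\<in>K. \<sigma> (x + y) = \<sigma> x + \<sigma> y \<and> \<sigma> (x * y) = \<sigma> x * \<sigma> y)"

definition minpoly_over :: "'a::field set \<Rightarrow> 'a \<Rightarrow> 'a poly \<Rightarrow> bool" where
  "minpoly_over K r p \<longleftrightarrow> p \<in> polys_over K \<and> lead_coeff p = 1 \<and> poly p r = 0 \<and>
     (\<forall>q\<in>polys_over K. poly q r = 0 \<longrightarrow> q \<noteq> 0 \<longrightarrow> degree p \<le> degree q)"

definition adjoin1 :: "'a::field set \<Rightarrow> 'a \<Rightarrow> 'a set" where
  "adjoin1 K r = (\<lambda>q. poly q r) ` polys_over K"

context subfield_set
begin

lemma diff_mem: "x \<in> K \<Longrightarrow> y \<in> K \<Longrightarrow> x - y \<in> K"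
  using add_mem[of x "- y"] uminus_mem[of y] by simp

lemma sum_mem: "(\<And>i. i \<in> I \<Longrightarrow> f i \<in> K) \<Longrightarrow> sum f I \<in> K"
  by (induction I rule: infinite_finite_induct) (auto intro: add_mem)

lemma poly_0_mem [simp]: "0 \<in> polys_over K"
  by (simp add: polys_over_def)

lemma poly_pCons_mem: "c \<in> K \<Longrightarrow> p \<in> polys_over K \<Longrightarrow> pCons c p \<in> polys_over K"
  by (auto simp: polys_over_def coeff_pCons split: nat.splits)

lemma poly_add_mem: "p \<in> polys_over K \<Longrightarrow> q \<in> polys_over K \<Longrightarrow> p + q \<in> polys_over K"
  by (auto simp: polys_over_def add_mem)

lemma poly_diff_mem: "p \<in> polys_over K \<Longrightarrow> q \<in> polys_over K \<Longrightarrow> p - q \<in> polys_over K"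
  by (auto simp: polys_over_def diff_mem)

lemma poly_uminus_mem: "p \<in> polys_over K \<Longrightarrow> - p \<in> polys_over K"
  by (auto simp: polys_over_def uminus_mem)

lemma poly_smult_mem: "c \<in> K \<Longrightarrow> p \<in> polys_over K \<Longrightarrow> smult c p \<in> polys_over K"
  by (auto simp: polys_over_def mult_mem)

lemma poly_mult_mem: "p \<in> polys_over K \<Longrightarrow> q \<in> polys_over K \<Longrightarrow> p * q \<in> polys_over K"
  by (auto simp: polys_over_def coeff_mult mult_mem intro: sum_mem)

lemma poly_eval_mem: "p \<in> polys_over K \<Longrightarrow> x \<in> K \<Longrightarrow> poly p x \<in> K"
proof (induction p)
  case (pCons c p)
  have "coeff (pCons c p) 0 \<in> K" "\<And>i. coeff (pCons c p) (Suc i) \<in> K"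
    using pCons.prems by (simp_all only: polys_over_def mem_Collect_eq)
  then have "c \<in> K" "p \<in> polys_over K"
    by (simp_all add: polys_over_def)
  then show ?case
    using pCons by (auto intro!: add_mem mult_mem)
qed simp

text \<open>Induction on the coefficients of the dividend: a new constant coefficient shifts the old
  remainder up to degree at most \<open>degree p\<close>, and subtracting one multiple of the monic
  \<open>p\<close> repairs it. No coefficient is divided, so everything stays over
  \<open>K\<close>.\<close>

lemma monic_division:
  assumes p: "p \<in> polys_over K" "lead_coeff p = 1"
  shows "q \<in> polys_over K \<Longrightarrow> \<exists>s\<in>polys_over K. \<exists>t\<in>polys_over K.
     q = p * s + t \<and> (t = 0 \<or> degree t < degree p)"
proof (induction q)
  case 0
  show ?case by (rule bexI[of _ 0], rule bexI[of _ 0]) auto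
next
  case (pCons c q)
  have "coeff (pCons c q) 0 \<in> K" "\<And>i. coeff (pCons c q) (Suc i) \<in> K"
    using pCons.prems by (simp_all only: polys_over_def mem_Collect_eq)
  then have c: "c \<in> K" "q \<in> polys_over K"
    by (simp_all add: polys_over_def)
  obtain s t where st: "s \<in> polys_over K" "t \<in> polys_over K" "q = p * s + t"
      "t = 0 \<or> degree t < degree p"
    using pCons.IH[OF c(2)] by blast
  define t' where "t' = pCons c t"
  have t': "t' \<in> polys_over K"
    using st c by (simp add: t'_def poly_pCons_mem)
  define d where "d = coeff t' (degree p)"
  have d: "d \<in> K" using t' by (auto simp: d_def polys_over_def)
  define u where "u = t' - smult d p"
  have "degree t' \<le> degree p"
    using st(4) by (auto simp: t'_def)
  then have "degree u \<le> degree p"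
    unfolding u_def by (intro degree_diff_le) auto
  moreover have "coeff u (degree p) = 0"
    using p by (simp add: u_def d_def)
  ultimately have "u = 0 \<or> degree u < degree p"
    by (metis eq_zero_or_degree_less)
  moreover have "pCons c q = p * (pCons 0 s + [:d:]) + u"
    by (simp add: u_def t'_def st(3) algebra_simps)
  moreover have "pCons 0 s + [:d:] \<in> polys_over K" "u \<in> polys_over K"
    using st d t' p by (auto simp: u_def intro!: poly_add_mem poly_diff_mem poly_smult_mem poly_pCons_mem)
  ultimately show ?case by blast
qed

lemma minpoly_exists:
  assumes "q \<in> polys_over K" "q \<noteq> 0" "poly q r = 0"
  shows "\<exists>p. minpoly_over K r p"
proof -
  define P where "P = (\<lambda>q. q \<in> polys_over K \<and> q \<noteq> 0 \<and> poly q r = 0)"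
  obtain p where p: "P p" "\<And>q. P q \<Longrightarrow> degree p \<le> degree q"
    using ex_has_least_nat[of P q degree] assms unfolding P_def by blast
  have "inverse (lead_coeff p) \<in> K"
    using p(1) by (auto simp: P_def polys_over_def intro: inverse_mem)
  then have "minpoly_over K r (smult (inverse (lead_coeff p)) p)"
    using p by (auto simp: minpoly_over_def P_def intro!: poly_smult_mem)
  then show ?thesis ..
qed

lemma minpoly_dvd:
  assumes "minpoly_over K r p" "q \<in> polys_over K" "poly q r = 0"
  shows "\<exists>s\<in>polys_over K. q = p * s"
proof -
  obtain s t where st: "s \<in> polys_over K" "t \<in> polys_over K" "q = p * s + t"
      "t = 0 \<or> degree t < degree p"
    using monic_division[of p q] assms by (auto simp: minpoly_over_def)
  have "poly t r = 0"
    using assms st(3) by (simp add: minpoly_over_def)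
  then have "t = 0"
    using st assms(1) unfolding minpoly_over_def by (metis leD)
  then show ?thesis using st by auto
qed

lemma minpoly_degree_pos: "minpoly_over K r p \<Longrightarrow> degree p > 0"
proof (rule gr0I)
  assume m: "minpoly_over K r p" and "degree p = 0"
  then obtain c where "p = [:c:]" by (auto elim: degree_eq_zeroE)
  then show False using m by (auto simp: minpoly_over_def)
qed

lemma adjoin1_reduced:
  assumes "minpoly_over K r p" "x \<in> adjoin1 K r"
  shows "\<exists>q\<in>polys_over K. degree q < degree p \<and> poly q r = x"
proof -
  obtain q where q: "q \<in> polys_over K" "poly q r = x"
    using assms(2) by (auto simp: adjoin1_def)
  obtain s t where "s \<in> polys_over K" "t \<in> polys_over K" "q = p * s + t"
      "t = 0 \<or> degree t < degree p"
    using monic_division[of p q] assms q by (auto simp: minpoly_over_def)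
  then show ?thesis
    using q assms(1) minpoly_degree_pos[OF assms(1)]
    by (cases "t = 0") (auto simp: minpoly_over_def intro: bexI[of _ 0] bexI[of _ t])
qed

text \<open>Inverses come from dividing the minimal polynomial \<open>p\<close> by \<open>q\<close>: the remainder has smaller
  degree and its value at \<open>r\<close> is a nonzero multiple of that of \<open>q\<close>.\<close>

lemma adjoin1_inverse:
  assumes m: "minpoly_over K r p"
  shows "q \<in> polys_over K \<Longrightarrow> degree q < degree p \<Longrightarrow> poly q r \<noteq> 0 \<Longrightarrow>
     \<exists>v\<in>polys_over K. poly v r * poly q r = 1"
proof (induction "degree q" arbitrary: q rule: less_induct)
  case less
  have q0: "q \<noteq> 0" using less.prems by auto
  define c where "c = inverse (lead_coeff q)"
  have c: "c \<in> K" "c \<noteq> 0"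
    using less.prems q0 by (auto simp: c_def polys_over_def intro: inverse_mem)
  define q' where "q' = smult c q"
  have q': "q' \<in> polys_over K" "lead_coeff q' = 1" "degree q' = degree q" "poly q' r \<noteq> 0"
    using less.prems c q0 by (auto simp: q'_def c_def poly_smult_mem)
  have "\<exists>v\<in>polys_over K. poly v r * poly q' r = 1"
  proof (cases "degree q = 0")
    case True
    then have "q' = 1"
      using q'(2,3) by (auto simp: one_pCons intro: degree_eq_zeroE[of q'])
    then show ?thesis
      using poly_pCons_mem[of 1 0] by (intro bexI[of _ 1]) (simp_all flip: one_pCons)
  next
    case False
    obtain s t where st: "s \<in> polys_over K" "t \<in> polys_over K" "p = q' * s + t"
        "t = 0 \<or> degree t < degree q'"
      using monic_division[of q' p] q' m by (auto simp: minpoly_over_def)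
    have s0: "s \<noteq> 0"
      using st(3,4) less.prems(2) q' by auto
    have "degree p = degree q' + degree s"
    proof -
      have "degree (q' * s) = degree q' + degree s" using s0 q0 c by (simp add: q'_def degree_mult_eq)
      moreover have "degree (q' * s + t) = degree (q' * s)"
        using st(4) calculation by (auto simp: degree_add_eq_left)
      ultimately show ?thesis using st(3) by simp
    qed
    then have "degree s < degree p" using False q' by simp
    \<comment> \<open>As \<open>q\<close> is not constant, the quotient \<open>s\<close> has smaller
      degree than the minimal polynomial and cannot vanish at \<open>r\<close>.\<close>
    then have "poly s r \<noteq> 0"
      using m s0 st(1) unfolding minpoly_over_def by (metis leD)
    moreover have "poly q' r * poly s r + poly t r = 0"
      using m st(3) by (metis minpoly_over_def poly_add poly_mult)
    moreover from this have t: "poly t r = - (poly q' r * poly s r)"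
      by (simp add: add_eq_0_iff)
    ultimately have t0: "poly t r \<noteq> 0"
      using q'(4) by simp
    then have "degree t < degree q" using st(4) q'(3) by auto
    then obtain v where v: "v \<in> polys_over K" "poly v r * poly t r = 1"
      using less.hyps[of t] st(2) t0 less.prems(2) by auto
    have "poly v r * - (poly q' r * poly s r) = 1" using v(2) t by metis
    then have "poly (- (v * s)) r * poly q' r = 1" by (simp add: mult_ac)
    moreover have "- (v * s) \<in> polys_over K" by (intro poly_uminus_mem poly_mult_mem v st)
    ultimately show ?thesis ..
  qed
  then obtain v where v: "v \<in> polys_over K" "poly v r * poly q' r = 1" by blast
  have "poly (smult c v) r * poly q r = 1"
    using v(2) by (simp add: q'_def mult_ac)
  then show ?case
    using poly_smult_mem[OF c(1) v(1)] ..
qed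

lemma adjoin1_subfield:
  assumes m: "minpoly_over K r p"
  shows "subfield_set (adjoin1 K r)"
proof
  show "0 \<in> adjoin1 K r" "1 \<in> adjoin1 K r"
    using poly_pCons_mem[of 1 0] by (auto simp: adjoin1_def image_iff intro: bexI[of _ 0] bexI[of _ "[:1:]"])
  fix x assume x: "x \<in> adjoin1 K r"
  then show "- x \<in> adjoin1 K r"
    by (auto simp: adjoin1_def image_iff intro!: bexI[of _ "- _"] poly_uminus_mem)
  show "inverse x \<in> adjoin1 K r"
  proof (cases "x = 0")
    case True
    with x show ?thesis by simp
  next
    case False
    obtain q where q: "q \<in> polys_over K" "degree q < degree p" "poly q r = x"
      using adjoin1_reduced[OF m x] by blast
    obtain v where "v \<in> polys_over K" "poly v r * x = 1"
      using adjoin1_inverse[OF m q(1,2)] q(3) False by auto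
    then show ?thesis
      by (metis adjoin1_def image_eqI inverse_unique mult.commute)
  qed
  fix y assume y: "y \<in> adjoin1 K r"
  show "x + y \<in> adjoin1 K r" "x * y \<in> adjoin1 K r"
    using x y unfolding adjoin1_def
    by (auto simp flip: poly_add poly_mult intro!: imageI poly_add_mem poly_mult_mem)
qed

lemma adjoin1_incl: "K \<subseteq> adjoin1 K r"
  using poly_pCons_mem[of _ 0] by (force simp: adjoin1_def image_iff)

lemma adjoin1_mem: "r \<in> adjoin1 K r"
  using poly_pCons_mem[of 0 "[:1:]"] poly_pCons_mem[of 1 0] by (force simp: adjoin1_def image_iff)

lemma adjoin1_least:
  assumes "subfield_set F" "K \<subseteq> F" "r \<in> F"
  shows "adjoin1 K r \<subseteq> F"
proof -
  have "polys_over K \<subseteq> polys_over F" using assms by (auto simp: polys_over_def)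
  then show ?thesis
    using assms subfield_set.poly_eval_mem[OF assms(1)] by (auto simp: adjoin1_def)
qed

end

locale subfield_hom = subfield_set K for K :: "'a::field set" +
  fixes \<sigma> :: "'a \<Rightarrow> 'b::field"
  assumes hom: "field_hom_on K \<sigma>"
begin

lemma hom_add: "x \<in> K \<Longrightarrow> y \<in> K \<Longrightarrow> \<sigma> (x + y) = \<sigma> x + \<sigma> y"
  and hom_mult: "x \<in> K \<Longrightarrow> y \<in> K \<Longrightarrow> \<sigma> (x * y) = \<sigma> x * \<sigma> y"
  and hom_1 [simp]: "\<sigma> 1 = 1"
  using hom by (auto simp: field_hom_on_def)

lemma hom_0 [simp]: "\<sigma> 0 = 0"
  by (metis add.right_neutral add_left_cancel hom_add zero_mem)

lemma hom_uminus: "x \<in> K \<Longrightarrow> \<sigma> (- x) = - \<sigma> x"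
  using hom_add[of x "- x"] uminus_mem by (simp add: eq_neg_iff_add_eq_0 add.commute)

lemma hom_diff: "x \<in> K \<Longrightarrow> y \<in> K \<Longrightarrow> \<sigma> (x - y) = \<sigma> x - \<sigma> y"
  using hom_add[of x "- y"] hom_uminus[of y] uminus_mem[of y] by simp

lemma hom_eq_0: "x \<in> K \<Longrightarrow> \<sigma> x = 0 \<longleftrightarrow> x = 0"
  using hom_mult[of x "inverse x"] inverse_mem[of x] by (cases "x = 0") auto

lemma hom_inverse: "x \<in> K \<Longrightarrow> \<sigma> (inverse x) = inverse (\<sigma> x)"
  using hom_mult[of x "inverse x"] inverse_mem[of x] by (cases "x = 0") (auto simp: inverse_unique)

lemma hom_inj: "inj_on \<sigma> K"
  by (rule inj_onI) (metis diff_mem eq_iff_diff_eq_0 hom_diff hom_eq_0)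

lemma hom_sum: "(\<And>i. i \<in> I \<Longrightarrow> f i \<in> K) \<Longrightarrow> \<sigma> (sum f I) = (\<Sum>i\<in>I. \<sigma> (f i))"
  by (induction I rule: infinite_finite_induct) (auto simp: hom_add sum_mem)

lemma map_poly_add:
  "p \<in> polys_over K \<Longrightarrow> q \<in> polys_over K \<Longrightarrow>
    map_poly \<sigma> (p + q) = map_poly \<sigma> p + map_poly \<sigma> q"
  by (rule poly_eqI) (simp add: coeff_map_poly hom_add polys_over_def)

lemma map_poly_diff:
  "p \<in> polys_over K \<Longrightarrow> q \<in> polys_over K \<Longrightarrow>
    map_poly \<sigma> (p - q) = map_poly \<sigma> p - map_poly \<sigma> q"
  by (rule poly_eqI) (simp add: coeff_map_poly hom_diff polys_over_def)

lemma map_poly_mult: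
  "p \<in> polys_over K \<Longrightarrow> q \<in> polys_over K \<Longrightarrow>
    map_poly \<sigma> (p * q) = map_poly \<sigma> p * map_poly \<sigma> q"
  by (rule poly_eqI) (simp add: coeff_map_poly coeff_mult hom_sum hom_mult mult_mem polys_over_def)

lemma hom_poly:
  "p \<in> polys_over K \<Longrightarrow> x \<in> K \<Longrightarrow> \<sigma> (poly p x) = poly (map_poly \<sigma> p) (\<sigma> x)"
proof (induction p)
  case (pCons c p)
  have "coeff (pCons c p) 0 \<in> K" "\<And>i. coeff (pCons c p) (Suc i) \<in> K"
    using pCons.prems by (simp_all only: polys_over_def mem_Collect_eq)
  then have "c \<in> K" "p \<in> polys_over K"
    by (simp_all add: polys_over_def)
  then show ?case
    using pCons by (simp add: map_poly_pCons hom_add hom_mult mult_mem poly_eval_mem)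
qed simp

lemma map_poly_monic:
  assumes "lead_coeff p = 1"
  shows "degree (map_poly \<sigma> p) = degree p" "lead_coeff (map_poly \<sigma> p) = 1"
proof -
  show "degree (map_poly \<sigma> p) = degree p"
    by (rule antisym[OF map_poly_degree_leq le_degree]) (use assms in \<open>simp_all add: coeff_map_poly\<close>)
  then show "lead_coeff (map_poly \<sigma> p) = 1"
    using assms by (simp add: coeff_map_poly)
qed

text \<open>\<open>poly q r\<close> goes to the value at \<open>r'\<close> of \<open>q\<close> with
  \<open>\<sigma>\<close> applied to its coefficients. Two polynomials with the same value at
  \<open>r\<close> differ by a multiple of \<open>p\<close>, whose image vanishes at
  \<open>r'\<close>, so the choice made in \<open>\<tau>\<close> does not matter.\<close>

lemma extend_adjoin1:
  assumes m: "minpoly_over K r p" and r': "poly (map_poly \<sigma> p) r' = 0"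
  shows "\<exists>\<tau>. field_hom_on (adjoin1 K r) \<tau> \<and> (\<forall>x\<in>K. \<tau> x = \<sigma> x) \<and> \<tau> r = r'"
proof -
  define \<tau> where "\<tau> x = poly (map_poly \<sigma> (SOME q. q \<in> polys_over K \<and> poly q r = x)) r'" for x
  have eq: "\<tau> (poly q r) = poly (map_poly \<sigma> q) r'" if q: "q \<in> polys_over K" for q
  proof -
    define q' where "q' = (SOME q'. q' \<in> polys_over K \<and> poly q' r = poly q r)"
    have q': "q' \<in> polys_over K" "poly q' r = poly q r"
      using someI[of "\<lambda>q'. q' \<in> polys_over K \<and> poly q' r = poly q r" q] q by (auto simp: q'_def)
    obtain s where s: "s \<in> polys_over K" "q' - q = p * s"
      using minpoly_dvd[OF m, of "q' - q"] q q' poly_diff_mem by auto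
    have "map_poly \<sigma> q' - map_poly \<sigma> q = map_poly \<sigma> p * map_poly \<sigma> s"
      using s m q q' by (metis map_poly_diff map_poly_mult minpoly_over_def)
    then have "poly (map_poly \<sigma> q') r' - poly (map_poly \<sigma> q) r' = 0"
      using r' by (metis mult_zero_left poly_diff poly_mult)
    then show ?thesis by (simp add: \<tau>_def q'_def)
  qed
  have const: "\<tau> x = \<sigma> x" if "x \<in> K" for x
    using eq[of "[:x:]"] that poly_pCons_mem[of x 0] by (simp add: map_poly_pCons)
  have "\<tau> r = r'"
    using eq[of "[:0, 1:]"] poly_pCons_mem[of 0 "[:1:]"] poly_pCons_mem[of 1 0]
    by (simp add: map_poly_pCons)
  moreover have "\<tau> (x + y) = \<tau> x + \<tau> y \<and> \<tau> (x * y) = \<tau> x * \<tau> y"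
    if xy: "x \<in> adjoin1 K r" "y \<in> adjoin1 K r" for x y
  proof -
    obtain q s where qs: "q \<in> polys_over K" "s \<in> polys_over K" "x = poly q r" "y = poly s r"
      using xy by (auto simp: adjoin1_def)
    have "\<tau> (x + y) = \<tau> (poly (q + s) r)" "\<tau> (x * y) = \<tau> (poly (q * s) r)"
      using qs by simp_all
    then show ?thesis
      using qs by (simp add: eq poly_add_mem poly_mult_mem map_poly_add map_poly_mult del: poly_add poly_mult)
        (simp add: map_poly_add map_poly_mult)
  qed
  ultimately show ?thesis
    using const by (intro exI[of _ \<tau>]) (auto simp: field_hom_on_def const)
qed

end

section \<open>Extension of embeddings\<close>

abbreviation gen :: "'a::field set \<Rightarrow> 'a set" where
  "gen \<equiv> generate_field ring_of_type_algebra"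

lemma type_algebra_simps [simp]:
  "carrier ring_of_type_algebra = (UNIV :: 'a::ring_1 set)"
  "\<one>\<^bsub>ring_of_type_algebra\<^esub> = (1 :: 'a)"
  "\<zero>\<^bsub>ring_of_type_algebra\<^esub> = (0 :: 'a)"
  "x \<otimes>\<^bsub>ring_of_type_algebra\<^esub> y = (x * y :: 'a)"
  "x \<oplus>\<^bsub>ring_of_type_algebra\<^esub> y = (x + y :: 'a)"
  by (simp_all add: ring_of_type_algebra_def)

lemma type_algebra_inv [simp]:
  fixes x :: "'a::field"
  shows "\<ominus>\<^bsub>ring_of_type_algebra\<^esub> x = - x"
    and "x \<noteq> 0 \<Longrightarrow> inv\<^bsub>ring_of_type_algebra\<^esub> x = inverse x"
proof -
  interpret F: Ring.field "ring_of_type_algebra :: 'a ring"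
    by (rule field_from_type_algebra)
  show "\<ominus>\<^bsub>ring_of_type_algebra\<^esub> x = - x"
    using F.minus_equality[of "- x" x] by simp
  show "inv\<^bsub>ring_of_type_algebra\<^esub> x = inverse x" if "x \<noteq> 0"
    using F.inv_char[of x "inverse x"] that by simp
qed

lemma gen_subfield: "subfield_set (gen S)"
proof
  have one: "1 \<in> gen S"
    using generate_field.one[of ring_of_type_algebra S] by simp
  have um: "- x \<in> gen S" if "x \<in> gen S" for x
    using generate_field.a_inv[OF that] by simp
  have add: "x + y \<in> gen S" if "x \<in> gen S" "y \<in> gen S" for x y
    using generate_field.eng_add[OF that] by simp
  show z: "0 \<in> gen S" using add[OF one um[OF one]] by simp
  show "1 \<in> gen S" by (rule one)
  fix x assume x: "x \<in> gen S"
  show "- x \<in> gen S" by (rule um[OF x])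
  show "inverse x \<in> gen S"
    using generate_field.m_inv[OF x] z by (cases "x = 0") auto
  fix y assume y: "y \<in> gen S"
  show "x + y \<in> gen S" by (rule add[OF x y])
  show "x * y \<in> gen S"
    using generate_field.eng_mult[OF x y] by simp
qed

lemma gen_incl: "S \<subseteq> gen S"
  by (auto intro: generate_field.incl)

lemma gen_least:
  assumes "subfield_set F" "S \<subseteq> F"
  shows "gen S \<subseteq> F"
proof
  interpret F: subfield_set F by fact
  fix x assume "x \<in> gen S"
  then show "x \<in> F"
    by induction (use assms in \<open>auto intro: F.uminus_mem F.inverse_mem F.add_mem F.mult_mem\<close>)
qed

lemma gen_mono: "S \<subseteq> T \<Longrightarrow> gen S \<subseteq> gen T"
  by (meson gen_incl gen_least gen_subfield order_trans)

lemma gen_of_subfield: "subfield_set K \<Longrightarrow> gen K = K"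
  using gen_incl gen_least by blast

lemma gen_absorb: "gen (gen S \<union> T) = gen (S \<union> T)"
  by (meson Un_least Un_upper1 Un_upper2 gen_incl gen_least gen_mono gen_subfield order_antisym order_trans)

text \<open>The induction step of the two arguments below: one generator is absorbed into the base
  field.\<close>

lemma (in subfield_set) gen_adjoin1:
  assumes "minpoly_over K r p"
  shows "gen (K \<union> insert r S) = gen (adjoin1 K r \<union> S)"
proof (rule antisym)
  have "K \<union> insert r S \<subseteq> adjoin1 K r \<union> S"
    using adjoin1_incl adjoin1_mem by auto
  then show "gen (K \<union> insert r S) \<subseteq> gen (adjoin1 K r \<union> S)"
    by (rule gen_mono)
  have "adjoin1 K r \<subseteq> gen (K \<union> insert r S)"
    using gen_incl[of "K \<union> insert r S"] by (intro adjoin1_least gen_subfield) auto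
  then show "gen (adjoin1 K r \<union> S) \<subseteq> gen (K \<union> insert r S)"
    using gen_incl[of "K \<union> insert r S"] by (intro gen_least gen_subfield) auto
qed

lemma polys_over_mono: "K \<subseteq> L \<Longrightarrow> polys_over K \<subseteq> polys_over L"
  by (auto simp: polys_over_def)

text \<open>Elements are adjoined one at a time. The target is algebraically closed, so the
  transported minimal polynomial always has a root to which the next element can be sent.\<close>

lemma extend_finite:
  fixes \<sigma> :: "'a::field \<Rightarrow> 'b::alg_closed_field"
  assumes "finite S" "subfield_hom K \<sigma>"
    "\<And>s. s \<in> S \<Longrightarrow> \<exists>q\<in>polys_over K. q \<noteq> 0 \<and> poly q s = 0"
  shows "\<exists>\<tau>. field_hom_on (gen (K \<union> S)) \<tau> \<and> (\<forall>x\<in>K. \<tau> x = \<sigma> x)"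
  using assms
proof (induction S arbitrary: K \<sigma> rule: finite_induct)
  case empty
  then interpret subfield_hom K \<sigma> by simp
  have "gen K = K" by (rule gen_of_subfield) (rule subfield_set_axioms)
  then show ?case using hom by auto
next
  case (insert r S)
  interpret subfield_hom K \<sigma> by fact
  obtain p where p: "minpoly_over K r p"
    using insert.prems(2)[of r] minpoly_exists by auto
  obtain r' where r': "poly (map_poly \<sigma> p) r' = 0"
    using alg_closed_imp_poly_has_root[of "map_poly \<sigma> p"] map_poly_monic(1)[of p] minpoly_degree_pos[OF p] p
    by (auto simp: minpoly_over_def)
  obtain \<tau> where \<tau>: "field_hom_on (adjoin1 K r) \<tau>" "\<And>x. x \<in> K \<Longrightarrow> \<tau> x = \<sigma> x"
    using extend_adjoin1[OF p r'] by blast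
  have sh: "subfield_hom (adjoin1 K r) \<tau>"
    using adjoin1_subfield[OF p] \<tau>(1) by (simp add: subfield_hom_def subfield_hom_axioms_def)
  have "\<exists>q\<in>polys_over (adjoin1 K r). q \<noteq> 0 \<and> poly q s = 0" if "s \<in> S" for s
    using insert.prems(2)[of s] that polys_over_mono[OF adjoin1_incl] by auto
  then obtain \<tau>' where "field_hom_on (gen (adjoin1 K r \<union> S)) \<tau>'" "\<And>x. x \<in> adjoin1 K r \<Longrightarrow> \<tau>' x = \<tau> x"
    using insert.IH[OF sh] by blast
  then show ?case
    using \<tau>(2) adjoin1_incl gen_adjoin1[OF p, of S] by (intro exI[of _ \<tau>']) (simp add: subset_iff)
qed

text \<open>Separability passes to factors: if \<open>q = p * s\<close>, the root counts of
  \<open>p\<close> and \<open>s\<close> are bounded by their degrees, and these bounds must both be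
  attained to reach the degree of \<open>q\<close>.\<close>

lemma card_roots_divisor:
  fixes p q :: "'a::idom poly"
  assumes "card {z. poly q z = 0} = degree q" "p dvd q" "q \<noteq> 0"
  shows "card {z. poly p z = 0} = degree p"
proof -
  obtain s where s: "q = p * s" using assms(2) by blast
  then have ne: "p \<noteq> 0" "s \<noteq> 0" using assms by auto
  have "degree p + degree s = card ({z. poly p z = 0} \<union> {z. poly s z = 0})"
    using assms(1) ne by (simp add: s degree_mult_eq Un_def)
  also have "\<dots> \<le> card {z. poly p z = 0} + card {z. poly s z = 0}"
    by (rule card_Un_le)
  finally show ?thesis
    using card_poly_roots_bound[OF ne(1)] card_poly_roots_bound[OF ne(2)] by linarith
qed

text \<open>Induction on the adjoined roots gives \<open>x = g(r)\<close> with \<open>g\<close> of smaller degree than the minimal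
  polynomial of \<open>r\<close>. Sending \<open>r\<close> to any of its conjugates extends to an embedding, which fixes \<open>x\<close>,
  so \<open>g - x\<close> has more roots than its degree allows.\<close>

lemma fixed_by_embeddings:
  fixes x :: "'a::alg_closed_field"
  assumes "finite S" "subfield_set K"
    "\<And>s. s \<in> S \<Longrightarrow> \<exists>q\<in>polys_over K. q \<noteq> 0 \<and> poly q s = 0 \<and> card {z. poly q z = 0} = degree q"
    "x \<in> gen (K \<union> S)"
    "\<And>\<tau>. field_hom_on (gen (K \<union> S)) \<tau> \<Longrightarrow> (\<And>y. y \<in> K \<Longrightarrow> \<tau> y = y) \<Longrightarrow> \<tau> x = x"
  shows "x \<in> K"
  using assms
proof (induction S arbitrary: K rule: finite_induct)
  case empty
  then show ?case by (simp add: gen_of_subfield)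
next
  case (insert r S)
  interpret subfield_set K by fact
  obtain q where q: "q \<in> polys_over K" "q \<noteq> 0" "poly q r = 0" "card {z. poly q z = 0} = degree q"
    using insert.prems(2)[of r] by auto
  obtain p where p: "minpoly_over K r p"
    using minpoly_exists q by blast
  let ?K = "adjoin1 K r"
  have sub: "subfield_set ?K" by (rule adjoin1_subfield[OF p])
  have sep: "\<exists>q\<in>polys_over ?K. q \<noteq> 0 \<and> poly q s = 0 \<and> card {z. poly q z = 0} = degree q"
    if "s \<in> S" for s
    using insert.prems(2)[of s] that polys_over_mono[OF adjoin1_incl] by auto
  have "x \<in> ?K"
  proof (rule insert.IH[OF sub sep])
    show "x \<in> gen (?K \<union> S)"
      using insert.prems(3) gen_adjoin1[OF p] by simp
    fix \<tau> :: "'a \<Rightarrow> 'a"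
    assume "field_hom_on (gen (?K \<union> S)) \<tau>" "\<And>y. y \<in> ?K \<Longrightarrow> \<tau> y = y"
    then show "\<tau> x = x"
      using insert.prems(4) gen_adjoin1[OF p] adjoin1_incl by (metis subsetD)
  qed
  then obtain g where g: "g \<in> polys_over K" "degree g < degree p" "poly g r = x"
    using adjoin1_reduced[OF p] by blast
  have roots: "poly g r' = x" if r': "poly p r' = 0" for r'
  proof -
    have I: "subfield_hom K (\<lambda>x. x)"
      using insert.prems(1) by (simp add: subfield_hom_def subfield_hom_axioms_def field_hom_on_def)
    have "\<exists>\<tau>. field_hom_on ?K \<tau> \<and> (\<forall>x\<in>K. \<tau> x = x) \<and> \<tau> r = r'"
      using subfield_hom.extend_adjoin1[OF I p, of r'] r' by simp
    then obtain \<tau> where \<tau>: "field_hom_on ?K \<tau>" "\<And>x. x \<in> K \<Longrightarrow> \<tau> x = x" "\<tau> r = r'"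
      by blast
    interpret T: subfield_hom ?K \<tau>
      using sub \<tau>(1) by (simp add: subfield_hom_def subfield_hom_axioms_def)
    have "subfield_hom ?K \<tau>" by (rule T.subfield_hom_axioms)
    moreover have "\<exists>q\<in>polys_over ?K. q \<noteq> 0 \<and> poly q s = 0" if "s \<in> S" for s
      using sep[OF that] by auto
    ultimately obtain \<tau>' where \<tau>': "field_hom_on (gen (?K \<union> S)) \<tau>'" "\<And>y. y \<in> ?K \<Longrightarrow> \<tau>' y = \<tau> y"
      using extend_finite[OF insert.hyps(1), of ?K \<tau>] by blast
    have fix_K: "\<tau>' y = y" if "y \<in> K" for y
      using \<tau>'(2)[OF subsetD[OF adjoin1_incl that]] \<tau>(2)[OF that] by (rule trans)
    have "\<tau>' x = x"
      using insert.prems(4)[of \<tau>'] \<tau>'(1) fix_K gen_adjoin1[OF p] by simp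
    moreover have "\<tau>' x = poly g r'"
    proof -
      have "\<tau> (poly g r) = poly (map_poly \<tau> g) r'"
        using T.hom_poly[of g r] g(1) polys_over_mono[OF adjoin1_incl] adjoin1_mem \<tau>(3) by auto
      moreover have "map_poly \<tau> g = g"
        using g(1) \<tau>(2) by (intro poly_eqI) (simp add: coeff_map_poly polys_over_def)
      ultimately show ?thesis using \<tau>'(2) \<open>x \<in> ?K\<close> g(3) by simp
    qed
    ultimately show ?thesis by simp
  qed
  have "card {z. poly p z = 0} = degree p"
    using card_roots_divisor[OF q(4)] minpoly_dvd[OF p q(1,3)] q(2) by auto
  moreover have "card {z. poly p z = 0} \<le> degree (g - [:x:])" if ne: "g - [:x:] \<noteq> 0"
  proof -
    have "{z. poly p z = 0} \<subseteq> {z. poly (g - [:x:]) z = 0}"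
      using roots by auto
    then have "card {z. poly p z = 0} \<le> card {z. poly (g - [:x:]) z = 0}"
      by (rule card_mono[OF poly_roots_finite[OF ne]])
    then show ?thesis
      using card_poly_roots_bound[OF ne] by linarith
  qed
  moreover have "degree (g - [:x:]) < degree p"
    using g(2) by (intro degree_diff_less) auto
  ultimately have "g = [:x:]" by fastforce
  then have "coeff g 0 = x" by simp
  then show ?case using g(1) by (auto simp: polys_over_def)
qed

section \<open>Galois groups of root sets\<close>

lemma base_field_subfield: "subfield_set (base_field :: 'm::field alg_closure set)"
proof
  show "0 \<in> (base_field :: 'm alg_closure set)" "1 \<in> (base_field :: 'm alg_closure set)"
    by (metis rangeI to_ac_0, metis rangeI to_ac_1)
qed (auto simp flip: to_ac_add to_ac_mult to_ac_minus to_ac_inverse)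

text \<open>The root count expresses separability and the final inclusion normality of the generated
  extension. The polynomial may vary with the element, which makes the notion stable under unions,
  as the compositum requires.\<close>

locale root_set =
  fixes S :: "'m::field alg_closure set"
  assumes finite_S: "finite S"
    and separable: "s \<in> S \<Longrightarrow> \<exists>q\<in>polys_over base_field. q \<noteq> 0 \<and> poly q s = 0 \<and>
          card {z. poly q z = 0} = degree q \<and> {z. poly q z = 0} \<subseteq> S"
begin

abbreviation N :: "'m alg_closure set" where "N \<equiv> gen (base_field \<union> S)"

sublocale N: subfield_set N
  by (rule gen_subfield)

lemma base_subset: "base_field \<subseteq> N" and S_subset: "S \<subseteq> N"
  using gen_incl[of "base_field \<union> S"] by auto

lemma to_ac_mem [simp]: "to_ac x \<in> N"
  using base_subset by blast

text \<open>The domain \<open>K\<close> may be larger than the field generated by \<open>S\<close>,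
  so that an automorphism of the compositum is seen to map each of the two root sets into
  itself.\<close>

lemma embedding_root:
  assumes "base_field \<subseteq> K" "subfield_hom K \<tau>" "\<And>x. x \<in> base_field \<Longrightarrow> \<tau> x = x" "s \<in> S" "s \<in> K"
  shows "\<tau> s \<in> S"
proof -
  interpret subfield_hom K \<tau> by fact
  obtain q where q: "q \<in> polys_over base_field" "poly q s = 0" "{z. poly q z = 0} \<subseteq> S"
    using separable[OF \<open>s \<in> S\<close>] by blast
  have "map_poly \<tau> q = q"
    using q(1) assms(3) by (intro poly_eqI) (simp add: coeff_map_poly polys_over_def)
  moreover have "\<tau> (poly q s) = poly (map_poly \<tau> q) (\<tau> s)"
    using q(1) polys_over_mono[OF assms(1)] \<open>s \<in> K\<close> by (intro hom_poly) auto
  ultimately have "poly q (\<tau> s) = 0" using q(2) by simp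
  then show ?thesis using q(3) by auto
qed

text \<open>An injective map of the finite set \<open>S\<close> into itself is onto. Hence both the
  image of \<open>N\<close> and the part of \<open>N\<close> mapped into \<open>N\<close> are
  subfields containing all generators.\<close>

lemma embedding_image:
  assumes \<tau>: "field_hom_on N \<tau>" "\<And>x. x \<in> base_field \<Longrightarrow> \<tau> x = x"
  shows "bij_betw \<tau> N N"
proof -
  interpret T: subfield_hom N \<tau>
    using \<tau>(1) N.subfield_set_axioms by (simp add: subfield_hom_def subfield_hom_axioms_def)
  have S: "\<tau> s \<in> S" if "s \<in> S" for s
    using embedding_root[OF base_subset T.subfield_hom_axioms \<tau>(2) that] S_subset that by auto
  then have "\<tau> ` S = S"
    using inj_on_subset[OF T.hom_inj S_subset] by (intro endo_inj_surj finite_S) auto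
  have "subfield_set {x \<in> N. \<tau> x \<in> N}"
    by unfold_locales (auto simp: T.hom_add T.hom_mult T.hom_uminus T.hom_inverse
        N.add_mem N.mult_mem N.uminus_mem N.inverse_mem)
  then have "N \<subseteq> {x \<in> N. \<tau> x \<in> N}"
    by (rule gen_least) (use S_subset base_subset S \<tau>(2) in auto)
  moreover have "subfield_set (\<tau> ` N)"
  proof
    show "0 \<in> \<tau> ` N" "1 \<in> \<tau> ` N"
      using T.hom_0 T.hom_1 N.zero_mem N.one_mem by (metis imageI)+
  qed (auto simp flip: T.hom_add T.hom_mult T.hom_uminus T.hom_inverse
        intro!: imageI N.add_mem N.mult_mem N.uminus_mem N.inverse_mem)
  then have "N \<subseteq> \<tau> ` N"
  proof (rule gen_least)
    show "base_field \<union> S \<subseteq> \<tau> ` N"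
    proof (rule Un_least)
      show "base_field \<subseteq> \<tau> ` N"
        using \<tau>(2) base_subset by (metis image_eqI subsetD subsetI)
      show "S \<subseteq> \<tau> ` N"
        using image_mono[OF S_subset, of \<tau>] \<open>\<tau> ` S = S\<close> by simp
    qed
  qed
  ultimately show ?thesis
    using T.hom_inj by (auto simp: bij_betw_def)
qed

text \<open>Bijectivity comes for free from normality, by \<open>embedding_image\<close>; membership
  reduces to being an embedding over the base.\<close>

lemma Gal_carrier:
  "\<sigma> \<in> carrier (Gal N) \<longleftrightarrow>
     \<sigma> \<in> extensional N \<and> field_hom_on N \<sigma> \<and> (\<forall>x\<in>base_field. \<sigma> x = x)"
  using embedding_image[of \<sigma>]
  by (auto simp: Gal_def Bij_def ring_iso_def ring_hom_def field_hom_on_def bij_betw_imp_funcset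
      ring_of_type_algebra_def dest: bij_betwE)

lemma restrict_embedding:
  assumes "field_hom_on N \<tau>" "\<And>x. x \<in> base_field \<Longrightarrow> \<tau> x = x"
  shows "restrict \<tau> N \<in> carrier (Gal N)"
  unfolding Gal_carrier using assms by (auto simp: field_hom_on_def N.add_mem N.mult_mem)

lemma Gal_hom: "\<sigma> \<in> carrier (Gal N) \<Longrightarrow> subfield_hom N \<sigma>"
  using N.subfield_set_axioms by (simp add: subfield_hom_def subfield_hom_axioms_def Gal_carrier)

lemma Gal_bij: "\<sigma> \<in> carrier (Gal N) \<Longrightarrow> bij_betw \<sigma> N N"
  and Gal_fixes: "\<sigma> \<in> carrier (Gal N) \<Longrightarrow> x \<in> base_field \<Longrightarrow> \<sigma> x = x"
  and Gal_Bij: "\<sigma> \<in> carrier (Gal N) \<Longrightarrow> \<sigma> \<in> Bij N"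
  using embedding_image[of \<sigma>] by (auto simp: Gal_carrier Bij_def)

lemma Gal_mem: "\<sigma> \<in> carrier (Gal N) \<Longrightarrow> x \<in> N \<Longrightarrow> \<sigma> x \<in> N"
  using Gal_bij bij_betwE by blast

lemma Gal_root: "\<sigma> \<in> carrier (Gal N) \<Longrightarrow> s \<in> S \<Longrightarrow> \<sigma> s \<in> S"
  by (rule embedding_root[OF base_subset Gal_hom Gal_fixes]) (use S_subset in auto)

lemma Gal_mult: "\<sigma> \<in> carrier (Gal N) \<Longrightarrow> \<tau> \<in> carrier (Gal N) \<Longrightarrow> \<sigma> \<otimes>\<^bsub>Gal N\<^esub> \<tau> = compose N \<sigma> \<tau>"
  using Gal_Bij[of \<sigma>] Gal_Bij[of \<tau>] by (simp add: Gal_def BijGroup_def)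

lemma Gal_one: "\<one>\<^bsub>Gal N\<^esub> = (\<lambda>x\<in>N. x)"
  by (simp add: Gal_def BijGroup_def)

lemma Gal_mult_apply:
  "\<sigma> \<in> carrier (Gal N) \<Longrightarrow> \<tau> \<in> carrier (Gal N) \<Longrightarrow> x \<in> N \<Longrightarrow> (\<sigma> \<otimes>\<^bsub>Gal N\<^esub> \<tau>) x = \<sigma> (\<tau> x)"
  by (simp add: Gal_mult compose_def)

lemma Gal_group: "group (Gal N)"
proof (rule groupI)
  show one: "\<one>\<^bsub>Gal N\<^esub> \<in> carrier (Gal N)"
    using restrict_embedding[of "\<lambda>x. x"] by (simp add: Gal_one field_hom_on_def)
  fix \<sigma> assume s: "\<sigma> \<in> carrier (Gal N)"
  interpret s: subfield_hom N \<sigma> by (rule Gal_hom[OF s])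
  show "\<one>\<^bsub>Gal N\<^esub> \<otimes>\<^bsub>Gal N\<^esub> \<sigma> = \<sigma>"
  proof (rule extensionalityI[of _ N])
    show "\<one>\<^bsub>Gal N\<^esub> \<otimes>\<^bsub>Gal N\<^esub> \<sigma> \<in> extensional N"
      by (simp add: Gal_mult[OF one s])
    show "\<sigma> \<in> extensional N" using s by (simp add: Gal_carrier)
    fix x assume x: "x \<in> N"
    have "(\<one>\<^bsub>Gal N\<^esub> \<otimes>\<^bsub>Gal N\<^esub> \<sigma>) x = \<one>\<^bsub>Gal N\<^esub> (\<sigma> x)"
      by (rule Gal_mult_apply[OF one s x])
    then show "(\<one>\<^bsub>Gal N\<^esub> \<otimes>\<^bsub>Gal N\<^esub> \<sigma>) x = \<sigma> x"
      using Gal_mem[OF s x] by (simp add: Gal_one)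
  qed
  define \<rho> where "\<rho> = inv_into N \<sigma>"
  have img: "\<sigma> ` N = N" using Gal_bij[OF s] by (simp add: bij_betw_def)
  have \<rho>: "\<rho> x \<in> N" "\<sigma> (\<rho> x) = x" if "x \<in> N" for x
    using that img inv_into_into[of x \<sigma> N] f_inv_into_f[of x \<sigma> N] by (auto simp: \<rho>_def)
  have \<rho>': "\<rho> (\<sigma> x) = x" if "x \<in> N" for x
    using that s.hom_inj by (simp add: \<rho>_def)
  have inv_hom: "field_hom_on N \<rho>"
    unfolding field_hom_on_def
  proof (intro conjI ballI)
    show "\<rho> 1 = 1" using \<rho>'[of 1] by simp
    fix x y assume xy: "x \<in> N" "y \<in> N"
    show "\<rho> (x + y) = \<rho> x + \<rho> y"
      using \<rho>'[of "\<rho> x + \<rho> y"] \<rho> xy by (simp add: s.hom_add N.add_mem)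
    show "\<rho> (x * y) = \<rho> x * \<rho> y"
      using \<rho>'[of "\<rho> x * \<rho> y"] \<rho> xy by (simp add: s.hom_mult N.mult_mem)
  qed
  have "\<rho> x = x" if "x \<in> base_field" for x
    using \<rho>'[of x] Gal_fixes[OF s that] base_subset that by auto
  then have inv: "restrict \<rho> N \<in> carrier (Gal N)"
    by (rule restrict_embedding[OF inv_hom])
  show "\<exists>\<tau>\<in>carrier (Gal N). \<tau> \<otimes>\<^bsub>Gal N\<^esub> \<sigma> = \<one>\<^bsub>Gal N\<^esub>"
    using inv s \<rho>' Gal_mem[OF s]
    by (intro bexI[of _ "restrict \<rho> N"]) (auto simp: Gal_mult Gal_one compose_def restrict_def fun_eq_iff)
  fix \<tau> assume t: "\<tau> \<in> carrier (Gal N)"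
  interpret t: subfield_hom N \<tau> by (rule Gal_hom[OF t])
  show st: "\<sigma> \<otimes>\<^bsub>Gal N\<^esub> \<tau> \<in> carrier (Gal N)"
    unfolding Gal_mult[OF s t] compose_def
    by (rule restrict_embedding)
      (use s t Gal_mem[OF t] in \<open>auto simp: field_hom_on_def t.hom_add t.hom_mult s.hom_add s.hom_mult Gal_fixes\<close>)
next
  fix \<sigma> \<tau> \<rho> assume s: "\<sigma> \<in> carrier (Gal N)" and t: "\<tau> \<in> carrier (Gal N)" and r: "\<rho> \<in> carrier (Gal N)"
  \<comment> \<open>Associativity is inherited from the group of all bijections of
    \<open>N\<close>.\<close>
  interpret B: group "BijGroup N" by (rule group_BijGroup)
  have "\<sigma> \<otimes>\<^bsub>BijGroup N\<^esub> \<tau> \<otimes>\<^bsub>BijGroup N\<^esub> \<rho> = \<sigma> \<otimes>\<^bsub>BijGroup N\<^esub> (\<tau> \<otimes>\<^bsub>BijGroup N\<^esub> \<rho>)"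
    using s t r Gal_Bij by (intro B.m_assoc) (auto simp: BijGroup_def)
  then show "\<sigma> \<otimes>\<^bsub>Gal N\<^esub> \<tau> \<otimes>\<^bsub>Gal N\<^esub> \<rho> = \<sigma> \<otimes>\<^bsub>Gal N\<^esub> (\<tau> \<otimes>\<^bsub>Gal N\<^esub> \<rho>)"
    by (simp add: Gal_def)
qed

text \<open>The points where two automorphisms agree form a subfield; once it contains
  \<open>S\<close>, it is all of \<open>N\<close>.\<close>

lemma Gal_eqI:
  assumes s: "\<sigma> \<in> carrier (Gal N)" and t: "\<tau> \<in> carrier (Gal N)" and eq: "\<And>x. x \<in> S \<Longrightarrow> \<sigma> x = \<tau> x"
  shows "\<sigma> = \<tau>"
proof (rule extensionalityI[of _ N])
  show "\<sigma> \<in> extensional N" "\<tau> \<in> extensional N" using s t by (auto simp: Gal_carrier)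
  interpret s: subfield_hom N \<sigma> by (rule Gal_hom[OF s])
  interpret t: subfield_hom N \<tau> by (rule Gal_hom[OF t])
  have "subfield_set {x \<in> N. \<sigma> x = \<tau> x}"
    by unfold_locales (auto simp: s.hom_add s.hom_mult s.hom_uminus s.hom_inverse
        t.hom_add t.hom_mult t.hom_uminus t.hom_inverse N.add_mem N.mult_mem N.uminus_mem N.inverse_mem)
  then have "N \<subseteq> {x \<in> N. \<sigma> x = \<tau> x}"
    by (rule gen_least) (use S_subset base_subset eq Gal_fixes[OF s] Gal_fixes[OF t] in auto)
  then show "\<sigma> x = \<tau> x" if "x \<in> N" for x using that by auto
qed

text \<open>\<open>S\<close> also generates \<open>N\<close> over the intermediate field
  \<open>K\<close>, and every embedding of \<open>N\<close> over \<open>K\<close> is, after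
  restriction, a member of the Galois group. So the statement on embeddings becomes one on
  automorphisms.\<close>

lemma fixed_field:
  assumes K: "subfield_set K" "base_field \<subseteq> K" "K \<subseteq> N" and x: "x \<in> N"
    and fixed: "\<And>\<sigma>. \<sigma> \<in> carrier (Gal N) \<Longrightarrow> (\<And>y. y \<in> K \<Longrightarrow> \<sigma> y = y) \<Longrightarrow> \<sigma> x = x"
  shows "x \<in> K"
proof -
  have N: "gen (K \<union> S) = N"
  proof (rule antisym)
    show "gen (K \<union> S) \<subseteq> N" using K S_subset by (intro gen_least gen_subfield) auto
    show "N \<subseteq> gen (K \<union> S)" using K by (intro gen_mono) auto
  qed
  show ?thesis
  proof (rule fixed_by_embeddings[OF finite_S K(1)])
    show "\<exists>q\<in>polys_over K. q \<noteq> 0 \<and> poly q s = 0 \<and> card {z. poly q z = 0} = degree q" if "s \<in> S" for s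
      using separable[OF that] polys_over_mono[OF K(2)] by blast
    show "x \<in> gen (K \<union> S)" using x N by simp
    fix \<tau> :: "'m alg_closure \<Rightarrow> 'm alg_closure"
    assume t: "field_hom_on (gen (K \<union> S)) \<tau>" "\<And>y. y \<in> K \<Longrightarrow> \<tau> y = y"
    have "restrict \<tau> N \<in> carrier (Gal N)"
      using t K(2) N by (intro restrict_embedding) auto
    then have "restrict \<tau> N x = x"
      by (rule fixed) (use t(2) K(3) in auto)
    then show "\<tau> x = x" using x by simp
  qed
qed

end

text \<open>\<open>T\<close> generates the big field over the small one, so \<open>\<sigma>\<close>
  extends to an embedding; by normality the extension is an automorphism. This is surjectivity of
  restriction.\<close>

lemma restriction_extends:
  assumes "root_set S" "root_set T" "S \<subseteq> T"
    and "\<sigma> \<in> carrier (Gal (gen (base_field \<union> S)))"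
  shows "\<exists>\<tau>\<in>carrier (Gal (gen (base_field \<union> T))). restrict \<tau> (gen (base_field \<union> S)) = \<sigma>"
proof -
  interpret S: root_set S by fact
  interpret T: root_set T by fact
  have incl: "S.N \<subseteq> T.N" using assms(3) by (intro gen_mono) auto
  have N: "gen (S.N \<union> T) = T.N"
  proof (rule antisym)
    show "gen (S.N \<union> T) \<subseteq> T.N" using incl T.S_subset by (intro gen_least gen_subfield) auto
    show "T.N \<subseteq> gen (S.N \<union> T)" using S.base_subset by (intro gen_mono) auto
  qed
  have alg: "\<exists>q\<in>polys_over S.N. q \<noteq> 0 \<and> poly q t = 0" if "t \<in> T" for t
    using T.separable[OF that] polys_over_mono[OF S.base_subset] by blast
  obtain \<tau> where t: "field_hom_on (gen (S.N \<union> T)) \<tau>" "\<And>x. x \<in> S.N \<Longrightarrow> \<tau> x = \<sigma> x"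
    using extend_finite[OF T.finite_S S.Gal_hom[OF assms(4)] alg] by blast
  have "\<tau> x = x" if "x \<in> base_field" for x
    using t(2) S.base_subset that S.Gal_fixes[OF assms(4)] by auto
  then have "restrict \<tau> T.N \<in> carrier (Gal T.N)"
    using t(1) N by (intro T.restrict_embedding) auto
  moreover have "restrict (restrict \<tau> T.N) S.N = \<sigma>"
    using assms(4) t(2) incl
    by (intro extensionalityI[of _ S.N]) (auto simp: S.Gal_carrier)
  ultimately show ?thesis by blast
qed

lemma restriction_in_Gal:
  assumes "root_set S" "root_set T" "S \<subseteq> T"
    and t: "\<tau> \<in> carrier (Gal (gen (base_field \<union> T)))"
  shows "restrict \<tau> (gen (base_field \<union> S)) \<in> carrier (Gal (gen (base_field \<union> S)))"
proof -
  interpret S: root_set S by fact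
  interpret T: root_set T by fact
  have incl: "S.N \<subseteq> T.N" using assms(3) by (intro gen_mono) auto
  show ?thesis
    using t incl T.Gal_fixes[OF t] unfolding T.Gal_carrier
    by (intro S.restrict_embedding) (auto simp: field_hom_on_def)
qed

lemma root_set_Un: "root_set S \<Longrightarrow> root_set T \<Longrightarrow> root_set (S \<union> T)"
  unfolding root_set_def by (auto; blast)

section \<open>Pairs of labelled root sets\<close>

text \<open>The map \<open>\<sigma>\<close> read through the numbering \<open>e\<close>, and the
  identity elsewhere, so that it is a permutation of \<open>{1..4}\<close> in the sense of
  \<open>permutes\<close>.\<close>

definition lab :: "(nat \<Rightarrow> 'a) \<Rightarrow> ('a \<Rightarrow> 'a) \<Rightarrow> nat \<Rightarrow> nat" where
  "lab e \<sigma> = (\<lambda>i. if i \<in> {1..4} then inv_into {1..4} e (\<sigma> (e i)) else i)"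

context
  fixes e :: "nat \<Rightarrow> 'a" and S :: "'a set"
  assumes e: "bij_betw e {1..4} S"
begin

lemma lab_in: "x \<in> S \<Longrightarrow> inv_into {1..4} e x \<in> {1..4}"
  using e by (metis bij_betw_imp_surj_on inv_into_into)

lemma lab_e: "x \<in> S \<Longrightarrow> e (inv_into {1..4} e x) = x"
  using e by (metis bij_betw_inv_into_right)

lemma lab_mem: "i \<in> {1..4} \<Longrightarrow> e i \<in> S"
  using e bij_betwE by blast

lemma lab_apply: "\<sigma> ` S \<subseteq> S \<Longrightarrow> i \<in> {1..4} \<Longrightarrow> e (lab e \<sigma> i) = \<sigma> (e i)"
  using lab_e[of "\<sigma> (e i)"] lab_mem[of i] by (auto simp: lab_def)

lemma lab_apply_in: "\<sigma> ` S \<subseteq> S \<Longrightarrow> i \<in> {1..4} \<Longrightarrow> lab e \<sigma> i \<in> {1..4}"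
  using lab_in[of "\<sigma> (e i)"] lab_mem[of i] by (simp add: lab_def image_subset_iff)

lemma e_inj: "i \<in> {1..4} \<Longrightarrow> j \<in> {1..4} \<Longrightarrow> e i = e j \<Longrightarrow> i = j"
  using e by (meson bij_betw_def inj_onD)

lemma lab_permutes:
  assumes "\<sigma> ` S \<subseteq> S" "inj_on \<sigma> S"
  shows "lab e \<sigma> permutes {1..4}"
proof (rule inj_imp_permutes)
  show "inj_on (lab e \<sigma>) {1..4}"
    using assms lab_mem by (intro inj_onI) (metis e_inj inj_onD lab_apply)
qed (use assms lab_apply_in in \<open>auto simp: lab_def\<close>)

lemma lab_comp:
  assumes "\<sigma> ` S \<subseteq> S" "\<tau> ` S \<subseteq> S" "\<And>x. x \<in> S \<Longrightarrow> \<rho> x = \<sigma> (\<tau> x)"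
  shows "lab e \<rho> = lab e \<sigma> \<circ> lab e \<tau>"
proof
  fix i show "lab e \<rho> i = (lab e \<sigma> \<circ> lab e \<tau>) i"
  proof (cases "i \<in> {1..4}")
    case True
    have "e (lab e \<rho> i) = e (lab e \<sigma> (lab e \<tau> i))"
      using True assms lab_mem[OF True] lab_apply[of \<rho> i] lab_apply[of \<tau> i]
        lab_apply[of \<sigma> "lab e \<tau> i"] lab_apply_in[of \<tau> i]
      by (simp add: image_subset_iff)
    then show ?thesis
      using True assms lab_mem[OF True] lab_apply_in[of \<rho> i] lab_apply_in[of \<tau> i]
        lab_apply_in[of \<sigma> "lab e \<tau> i"] e_inj by (simp add: image_subset_iff)
  next
    case False
    then have "lab e f i = i" for f by (simp only: lab_def if_False)
    then show ?thesis by simp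
  qed
qed

lemma lab_eqD:
  assumes "\<sigma> ` S \<subseteq> S" "\<tau> ` S \<subseteq> S" "lab e \<sigma> = lab e \<tau>" "x \<in> S"
  shows "\<sigma> x = \<tau> x"
proof -
  obtain i where "i \<in> {1..4}" "x = e i"
    using e \<open>x \<in> S\<close> by (metis bij_betw_imp_surj_on imageE)
  then show ?thesis
    using assms lab_apply[of \<sigma> i] lab_apply[of \<tau> i] by simp
qed

lemma lab_cong: "(\<And>x. x \<in> S \<Longrightarrow> \<sigma> x = \<tau> x) \<Longrightarrow> lab e \<sigma> = lab e \<tau>"
  using lab_mem by (auto simp: lab_def fun_eq_iff)

lemma lab_id: "(\<And>x. x \<in> S \<Longrightarrow> \<sigma> x = x) \<Longrightarrow> lab e \<sigma> = id"
  using lab_mem e by (auto simp: lab_def fun_eq_iff bij_betw_inv_into_left)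

end

lemma inj_hom_iso_image:
  assumes "f \<in> hom G H" "inj_on f (carrier G)"
  shows "G \<cong> H\<lparr>carrier := f ` carrier G\<rparr>"
  using assms by (intro is_isoI[of f]) (auto simp: iso_def hom_def bij_betw_def)

lemma DirProd_Sym_group: "group (Sym m \<times>\<times> Sym n)"
  by (simp add: DirProd_group sym_group_is_group)

text \<open>A square root of the discriminant of the cubic with roots \<open>x 1\<close>,
  \<open>x 2\<close>, \<open>x 3\<close>.\<close>

definition difference_product :: "(nat \<Rightarrow> 'a::comm_ring_1) \<Rightarrow> 'a" where
  "difference_product x = (x 1 - x 2) * (x 2 - x 3) * (x 1 - x 3)"

lemma difference_product_permute:
  assumes "p permutes {1..3}"
  shows "difference_product (x \<circ> p) = (if evenperm p then difference_product x else - difference_product x)"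
  using assms finite_atLeastAtMost[of 1 "3::nat"]
proof (induction arbitrary: x rule: permutes_induct)
  case id
  then show ?case by simp
next
  case (swap a b p)
  have "difference_product (x \<circ> Transposition.transpose a b) = - difference_product x"
  proof -
    have "a = 1 \<or> a = 2 \<or> a = 3" "b = 1 \<or> b = 2 \<or> b = 3" using swap(1,2) by auto
    then show ?thesis using swap(3)
      by (auto simp: difference_product_def Transposition.transpose_def) (simp_all add: algebra_simps)
  qed
  moreover have "evenperm (Transposition.transpose a b \<circ> p) \<longleftrightarrow> \<not> evenperm p"
  proof -
    have "permutation p"
      by (rule permutes_imp_permutation[OF finite_atLeastAtMost \<open>p permutes {1..3}\<close>])
    then show ?thesis
      using \<open>a \<noteq> b\<close> permutation_swap_id[of a b] by (simp add: evenperm_comp evenperm_swap)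
  qed
  \<comment> \<open>The induction hypothesis is applied to \<open>x\<close> already relabelled by
    the transposition, which is why \<open>x\<close> is kept arbitrary.\<close>
  moreover have "difference_product (x \<circ> (Transposition.transpose a b \<circ> p)) =
      (if evenperm p then difference_product (x \<circ> Transposition.transpose a b)
       else - difference_product (x \<circ> Transposition.transpose a b))"
    unfolding o_assoc by (rule swap.IH)
  ultimately show ?case by (simp only: minus_minus split: if_split) simp
qed

locale root_pair = S1: root_set S1 + S2: root_set S2
  for S1 S2 :: "'m::field alg_closure set" +
  fixes e1 e2 :: "nat \<Rightarrow> 'm alg_closure"
  assumes e1: "bij_betw e1 {1..4} S1" and e2: "bij_betw e2 {1..4} S2"
begin

sublocale T: root_set "S1 \<union> S2"
  by (rule root_set_Un) unfold_locales

definition "G = Gal T.N"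

definition "J = (\<lambda>\<sigma>. (lab e1 \<sigma>, lab e2 \<sigma>)) ` carrier G"

lemma N1_subset: "S1.N \<subseteq> T.N" and N2_subset: "S2.N \<subseteq> T.N"
  by (auto intro!: gen_mono)

lemma G_group: "group G" unfolding G_def by (rule T.Gal_group)

lemma G_root_img:
  assumes "\<sigma> \<in> carrier G"
  shows "\<sigma> ` S1 \<subseteq> S1" "\<sigma> ` S2 \<subseteq> S2" "inj_on \<sigma> S1" "inj_on \<sigma> S2"
proof -
  have s: "\<sigma> \<in> carrier (Gal T.N)" using assms by (simp add: G_def)
  show "\<sigma> ` S1 \<subseteq> S1"
    using S1.embedding_root[OF T.base_subset T.Gal_hom[OF s] T.Gal_fixes[OF s]] T.S_subset by auto
  show "\<sigma> ` S2 \<subseteq> S2"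
    using S2.embedding_root[OF T.base_subset T.Gal_hom[OF s] T.Gal_fixes[OF s]] T.S_subset by auto
  have "inj_on \<sigma> T.N" using T.Gal_bij[OF s] by (rule bij_betw_imp_inj_on)
  then show "inj_on \<sigma> S1" "inj_on \<sigma> S2"
    using T.S_subset by (auto intro: inj_on_subset)
qed

lemma S1_img: "\<sigma> \<in> carrier (Gal S1.N) \<Longrightarrow> \<sigma> ` S1 \<subseteq> S1"
  using S1.Gal_root by auto

lemma G_restrict1: "\<sigma> \<in> carrier G \<Longrightarrow> restrict \<sigma> S1.N \<in> carrier (Gal S1.N)"
  and G_restrict2: "\<sigma> \<in> carrier G \<Longrightarrow> restrict \<sigma> S2.N \<in> carrier (Gal S2.N)"
  unfolding G_def
  by (auto intro!: restriction_in_Gal S1.root_set_axioms S2.root_set_axioms T.root_set_axioms)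

lemma G_agree1:
  assumes "\<sigma> \<in> carrier G" "\<tau> \<in> carrier G" "lab e1 \<sigma> = lab e1 \<tau>" "x \<in> S1.N"
  shows "\<sigma> x = \<tau> x"
proof -
  have "restrict \<sigma> S1.N = restrict \<tau> S1.N"
    using G_restrict1[OF assms(1)] G_restrict1[OF assms(2)]
  proof (rule S1.Gal_eqI)
    fix x assume "x \<in> S1"
    then show "restrict \<sigma> S1.N x = restrict \<tau> S1.N x"
      using lab_eqD[OF e1 G_root_img(1)[OF assms(1)] G_root_img(1)[OF assms(2)] assms(3)] S1.S_subset
      by auto
  qed
  then show ?thesis using assms(4) by (metis restrict_apply')
qed

text \<open>Exchanging the two root sets leaves \<open>G\<close> as it is and swaps the components
  of \<open>J\<close>; statements about the first set thus carry over to the second.\<close>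

lemma flip: "root_pair S2 S1 e2 e1"
  by unfold_locales (rule e2, rule e1)

lemma flip_G: "root_pair.G S2 S1 = G"
  by (simp add: root_pair.G_def[OF flip] G_def Un_commute)

lemma flip_J: "root_pair.J S2 S1 e2 e1 = prod.swap ` J"
  by (simp add: root_pair.J_def[OF flip] J_def flip_G image_image)

lemmas G_agree2 = root_pair.G_agree1[OF flip, unfolded flip_G]

lemma lab_one: "lab e1 \<one>\<^bsub>G\<^esub> = id" "lab e2 \<one>\<^bsub>G\<^esub> = id"
  using T.S_subset by (auto simp: G_def T.Gal_one intro!: lab_id[OF e1] lab_id[OF e2])

lemma lab_mult:
  assumes "\<sigma> \<in> carrier G" "\<tau> \<in> carrier G"
  shows "lab e1 (\<sigma> \<otimes>\<^bsub>G\<^esub> \<tau>) = lab e1 \<sigma> \<circ> lab e1 \<tau>" "lab e2 (\<sigma> \<otimes>\<^bsub>G\<^esub> \<tau>) = lab e2 \<sigma> \<circ> lab e2 \<tau>"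
  using assms T.S_subset G_root_img[OF assms(1)] G_root_img[OF assms(2)]
  by (auto intro!: lab_comp[OF e1] lab_comp[OF e2] simp: G_def T.Gal_mult_apply)

lemma lab_hom: "(\<lambda>\<sigma>. (lab e1 \<sigma>, lab e2 \<sigma>)) \<in> hom G (Sym 4 \<times>\<times> Sym 4)"
  using G_root_img lab_permutes[OF e1] lab_permutes[OF e2]
  by (auto simp: hom_def DirProd_def sym_group_def lab_mult)

lemma G_iso_J: "G \<cong> (Sym 4 \<times>\<times> Sym 4)\<lparr>carrier := J\<rparr>"
  unfolding J_def
proof (rule inj_hom_iso_image[OF lab_hom], rule inj_onI)
  fix \<sigma> \<tau> assume st: "\<sigma> \<in> carrier G" "\<tau> \<in> carrier G"
    and eq: "(lab e1 \<sigma>, lab e2 \<sigma>) = (lab e1 \<tau>, lab e2 \<tau>)"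
  show "\<sigma> = \<tau>"
  proof (rule T.Gal_eqI)
    show "\<sigma> \<in> carrier (Gal T.N)" "\<tau> \<in> carrier (Gal T.N)" using st by (auto simp: G_def)
    fix x assume "x \<in> S1 \<union> S2"
    then show "\<sigma> x = \<tau> x"
      using G_agree1[OF st] G_agree2[OF st] S1.S_subset S2.S_subset eq by auto
  qed
qed

lemma J_subgroup: "subgroup J (Sym 4 \<times>\<times> Sym 4)"
  unfolding J_def using lab_hom G_group DirProd_Sym_group
  by (intro group_hom.img_is_subgroup) (simp add: group_hom_def group_hom_axioms_def)

text \<open>One inclusion restricts an automorphism of the compositum. The other extends an
  automorphism of the smaller field, so the projection of \<open>J\<close> is the full group and not
  just a part of it.\<close>

lemma fst_J: "fst ` J = lab e1 ` carrier (Gal S1.N)"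
proof (intro Set.set_eqI iffI)
  fix p assume "p \<in> fst ` J"
  then obtain \<sigma> where s: "\<sigma> \<in> carrier G" "p = lab e1 \<sigma>" by (auto simp: J_def)
  then have "p = lab e1 (restrict \<sigma> S1.N)"
    using S1.S_subset by (auto intro!: lab_cong[OF e1])
  then show "p \<in> lab e1 ` carrier (Gal S1.N)" using G_restrict1[OF s(1)] by blast
next
  fix p assume "p \<in> lab e1 ` carrier (Gal S1.N)"
  then obtain \<sigma> where s: "\<sigma> \<in> carrier (Gal S1.N)" "p = lab e1 \<sigma>" by auto
  obtain \<tau> where t: "\<tau> \<in> carrier G" "restrict \<tau> S1.N = \<sigma>"
    using restriction_extends[OF S1.root_set_axioms T.root_set_axioms _ s(1)] by (auto simp: G_def)
  then have "p = lab e1 \<tau>"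
    unfolding s(2) using S1.S_subset by (intro lab_cong[OF e1]) auto
  then show "p \<in> fst ` J" using t(1) by (force simp: J_def)
qed

lemma snd_J: "snd ` J = lab e2 ` carrier (Gal S2.N)"
  using root_pair.fst_J[OF flip] by (simp add: flip_J image_image)

text \<open>Some \<open>\<rho>\<close> in \<open>G\<close> acts like \<open>\<sigma>\<close> on the
  first field and like \<open>\<tau>\<close> on the second, so on the intersection all three
  coincide. This is how membership in \<open>J\<close> becomes information about the
  intersection.\<close>

lemma agree_on_meet:
  assumes "\<sigma> \<in> carrier G" "\<tau> \<in> carrier G" "(lab e1 \<sigma>, lab e2 \<tau>) \<in> J" "x \<in> S1.N" "x \<in> S2.N"
  shows "\<sigma> x = \<tau> x"
proof -
  obtain \<rho> where "\<rho> \<in> carrier G" "lab e1 \<sigma> = lab e1 \<rho>" "lab e2 \<tau> = lab e2 \<rho>"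
    using assms(3) by (auto simp: J_def)
  then show ?thesis
    using G_agree1[of \<sigma> \<rho> x] G_agree2[of \<tau> \<rho> x] assms by simp
qed

lemma base_of_fixed:
  assumes "x \<in> T.N" "\<And>\<sigma>. \<sigma> \<in> carrier G \<Longrightarrow> \<sigma> x = x"
  shows "x \<in> base_field"
  by (rule T.fixed_field[OF base_field_subfield order_refl T.base_subset assms(1)])
    (use assms(2) in \<open>simp add: G_def\<close>)

lemma one_in_G: "\<one>\<^bsub>G\<^esub> \<in> carrier G"
  using G_group by (simp add: group.is_monoid)

lemma one_apply: "x \<in> T.N \<Longrightarrow> \<one>\<^bsub>G\<^esub> x = x"
  by (simp add: G_def T.Gal_one)

text \<open>In a full product every \<open>\<sigma>\<close> may be paired with the identity, so it
  acts trivially on the intersection.\<close>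

lemma meet_trivial:
  assumes "J = fst ` J \<times> snd ` J"
  shows "S1.N \<inter> S2.N = base_field"
proof (rule antisym)
  show "base_field \<subseteq> S1.N \<inter> S2.N" using S1.base_subset S2.base_subset by auto
  have "\<sigma> x = x" if x: "x \<in> S1.N \<inter> S2.N" and s: "\<sigma> \<in> carrier G" for x \<sigma>
  proof -
    have "(lab e1 \<sigma>, lab e2 \<one>\<^bsub>G\<^esub>) \<in> J"
    proof -
      have "(lab e1 \<sigma>, lab e2 \<sigma>) \<in> J" "(lab e1 \<one>\<^bsub>G\<^esub>, lab e2 \<one>\<^bsub>G\<^esub>) \<in> J"
        using s one_in_G by (auto simp: J_def)
      from imageI[OF this(1), of fst] imageI[OF this(2), of snd] show ?thesis
        using equalityD2[OF assms] by auto
    qed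
    then show ?thesis
      using agree_on_meet[OF s one_in_G] x one_apply[of x] N1_subset by auto
  qed
  then show "S1.N \<inter> S2.N \<subseteq> base_field"
    using base_of_fixed subsetD[OF N1_subset] by blast
qed

text \<open>An automorphism fixing the second field has trivial second label, hence by hypothesis
  trivial first label, and so fixes the first field as well; the second field is its own fixed
  field.\<close>

lemma N1_subset_N2:
  assumes "\<And>g. (g, id) \<in> J \<Longrightarrow> g = id"
  shows "S1.N \<subseteq> S2.N"
proof
  fix x assume x: "x \<in> S1.N"
  show "x \<in> S2.N"
  proof (rule T.fixed_field[OF S2.N.subfield_set_axioms S2.base_subset N2_subset])
    show "x \<in> T.N" using x N1_subset by auto
    fix \<sigma> assume s: "\<sigma> \<in> carrier (Gal T.N)" "\<And>y. y \<in> S2.N \<Longrightarrow> \<sigma> y = y"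
    have "lab e2 \<sigma> = id" using s(2) S2.S_subset by (intro lab_id[OF e2]) auto
    then have "lab e1 \<sigma> = id"
      using assms s(1) by (force simp: J_def G_def)
    then show "\<sigma> x = x"
      using G_agree1[of \<sigma> "\<one>\<^bsub>G\<^esub>" x] lab_one one_in_G s(1) x one_apply[of x] N1_subset
      by (auto simp: G_def)
  qed
qed

lemma N2_subset_N1:
  assumes "\<And>h. (id, h) \<in> J \<Longrightarrow> h = id"
  shows "S2.N \<subseteq> S1.N"
  by (rule root_pair.N1_subset_N2[OF flip]) (use assms in \<open>auto simp: flip_J\<close>)

lemma N1_eq_N2D:
  assumes "S1.N = S2.N" "(id, h) \<in> J"
  shows "h = id"
proof -
  obtain \<sigma> where s: "\<sigma> \<in> carrier G" "lab e1 \<sigma> = id" "lab e2 \<sigma> = h"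
    using assms(2) by (auto simp: J_def)
  have "\<sigma> x = x" if "x \<in> S2" for x
  proof -
    have x: "x \<in> S2.N" "x \<in> T.N" using that S2.S_subset N2_subset by auto
    then have "\<sigma> x = \<one>\<^bsub>G\<^esub> x"
      using G_agree1[OF s(1) one_in_G] s(2) lab_one(1) assms(1) by simp
    then show ?thesis using one_apply[OF x(2)] by simp
  qed
  then show ?thesis using lab_id[OF e2, of \<sigma>] s(3) by simp
qed

text \<open>All first labels fix 4, so \<open>\<delta>\<close>, built from the other three roots, is
  negated exactly by the odd ones. On the intersection an automorphism acts through its parity
  alone. An odd \<open>\<tau>\<close> is therefore an involution there, and splitting by its two
  eigenspaces gives the basis 1, \<open>\<delta>\<close>.\<close>

lemma meet_quadratic:
  assumes two: "(2 :: 'm) \<noteq> 0"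
    and sub: "fst ` J \<subseteq> {p. p permutes {1..3}}"
    and odd: "\<exists>g\<in>fst ` J. \<not> evenperm g"
    and fib: "J = {(g, h) \<in> fst ` J \<times> snd ` J. evenperm g \<longleftrightarrow> h \<in> K}"
  shows "ring.dimension ring_of_type_algebra 2 base_field (S1.N \<inter> S2.N)"
proof -
  define \<delta> where "\<delta> = difference_product e1"
  have two': "(2 :: 'm alg_closure) \<noteq> 0"
    using two by (metis to_ac_eq_0_iff' to_ac_numeral)
  have inj: "e1 i \<noteq> e1 j" if "i \<in> {1..3}" "j \<in> {1..3}" "i \<noteq> j" for i j
    using e_inj[OF e1, of i j] that by auto
  have d0: "\<delta> \<noteq> 0"
    using inj[of 1 2] inj[of 2 3] inj[of 1 3] by (simp add: \<delta>_def difference_product_def)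
  have e1_mem: "e1 1 \<in> S1.N" "e1 2 \<in> S1.N" "e1 3 \<in> S1.N"
    using lab_mem[OF e1] S1.S_subset by auto
  then have d1: "\<delta> \<in> S1.N"
    by (auto simp: \<delta>_def difference_product_def intro!: S1.N.mult_mem S1.N.diff_mem)
  then have dN: "\<delta> \<in> T.N" using N1_subset by auto
  have act: "\<sigma> \<delta> = (if evenperm (lab e1 \<sigma>) then \<delta> else - \<delta>)" if s: "\<sigma> \<in> carrier G" for \<sigma>
  proof -
    interpret subfield_hom T.N \<sigma>
      using s by (intro T.Gal_hom) (simp add: G_def)
    have "e1 1 \<in> T.N" "e1 2 \<in> T.N" "e1 3 \<in> T.N" using e1_mem N1_subset by auto
    then have "\<sigma> \<delta> = difference_product (\<lambda>i. \<sigma> (e1 i))"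
      by (simp add: \<delta>_def difference_product_def hom_mult hom_diff T.N.mult_mem T.N.diff_mem)
    also have "\<dots> = difference_product (e1 \<circ> lab e1 \<sigma>)"
      using lab_apply[OF e1 G_root_img(1)[OF s]] by (simp add: difference_product_def)
    also have "\<dots> = (if evenperm (lab e1 \<sigma>) then \<delta> else - \<delta>)"
    proof -
      have "lab e1 \<sigma> permutes {1..3}" using sub s unfolding J_def image_image by auto
      then show ?thesis by (simp add: \<delta>_def difference_product_permute)
    qed
    finally show ?thesis .
  qed
  have fibD: "evenperm g \<longleftrightarrow> h \<in> K" if "(g, h) \<in> J" for g h
    using equalityD1[OF fib] that by blast
  \<comment> \<open>The fibre condition sees a first label only through its parity, so labels of two
    automorphisms of equal parity may be combined.\<close>
  have in_J: "(lab e1 \<sigma>, lab e2 \<tau>) \<in> J"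
    if "\<sigma> \<in> carrier G" "\<tau> \<in> carrier G" "evenperm (lab e1 \<sigma>) \<longleftrightarrow> evenperm (lab e1 \<tau>)" for \<sigma> \<tau>
  proof -
    have m: "(lab e1 \<sigma>, lab e2 \<sigma>) \<in> J" "(lab e1 \<tau>, lab e2 \<tau>) \<in> J" using that by (auto simp: J_def)
    have "lab e1 \<sigma> \<in> fst ` J" "lab e2 \<tau> \<in> snd ` J" using imageI[OF m(1), of fst] imageI[OF m(2), of snd] by simp_all
    then show ?thesis using equalityD2[OF fib] fibD[OF m(2)] that(3) by blast
  qed
  have even_one: "evenperm (lab e1 \<one>\<^bsub>G\<^esub>)" by (simp add: lab_one)
  have d2: "\<delta> \<in> S2.N"
  proof (rule T.fixed_field[OF S2.N.subfield_set_axioms S2.base_subset N2_subset dN])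
    fix \<sigma> assume s: "\<sigma> \<in> carrier (Gal T.N)" "\<And>y. y \<in> S2.N \<Longrightarrow> \<sigma> y = y"
    have sG: "\<sigma> \<in> carrier G" using s(1) by (simp add: G_def)
    have "lab e2 \<sigma> = id" using s(2) S2.S_subset by (intro lab_id[OF e2]) auto
    moreover have "(lab e1 \<sigma>, lab e2 \<sigma>) \<in> J" "(lab e1 \<one>\<^bsub>G\<^esub>, lab e2 \<one>\<^bsub>G\<^esub>) \<in> J"
      using sG one_in_G by (auto simp: J_def)
    note this[THEN fibD]
    ultimately have "evenperm (lab e1 \<sigma>)" by (simp add: lab_one)
    then show "\<sigma> \<delta> = \<delta>" using act[OF sG] by simp
  qed
  obtain \<tau> where t: "\<tau> \<in> carrier G" "\<not> evenperm (lab e1 \<tau>)"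
    using odd by (auto simp: J_def)
  interpret t: subfield_hom T.N \<tau>
    using t(1) by (intro T.Gal_hom) (simp add: G_def)
  \<comment> \<open>Comparison with the identity for even \<open>\<sigma>\<close> and with
    \<open>\<tau>\<close> for odd \<open>\<sigma>\<close>.\<close>
  have base_tau: "\<sigma> x = (if evenperm (lab e1 \<sigma>) then x else \<tau> x)"
    if "\<sigma> \<in> carrier G" "x \<in> S1.N" "x \<in> S2.N" for \<sigma> x
    using agree_on_meet[OF that(1) one_in_G in_J[OF that(1) one_in_G]] agree_on_meet[OF that(1) t(1) in_J[OF that(1) t(1)]]
      even_one t(2) that(2,3) one_apply[of x] N1_subset by auto
  have tt: "\<tau> (\<tau> x) = x" if x: "x \<in> S1.N" "x \<in> S2.N" for x
  proof -
    have "\<tau> \<otimes>\<^bsub>G\<^esub> \<tau> \<in> carrier G" using G_group t(1) by (simp add: group.is_monoid monoid.m_closed)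
    moreover have "evenperm (lab e1 (\<tau> \<otimes>\<^bsub>G\<^esub> \<tau>))"
    proof -
      have "permutation (lab e1 \<tau>)"
        by (rule permutes_imp_permutation[OF finite_atLeastAtMost lab_permutes[OF e1 G_root_img(1,3)[OF t(1)]]])
      then show ?thesis by (simp add: lab_mult[OF t(1) t(1)] evenperm_comp)
    qed
    ultimately have "(\<tau> \<otimes>\<^bsub>G\<^esub> \<tau>) x = x" using base_tau[of "\<tau> \<otimes>\<^bsub>G\<^esub> \<tau>", OF _ x] by simp
    then show ?thesis using t(1) x N1_subset by (auto simp: G_def T.Gal_mult_apply)
  qed
  have mem1: "x \<in> base_field" if x: "x \<in> S1.N" "x \<in> S2.N" "\<tau> x = x" for x
  proof (rule base_of_fixed)
    show "x \<in> T.N" using x(1) N1_subset by blast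
    show "\<sigma> x = x" if "\<sigma> \<in> carrier G" for \<sigma>
      using base_tau[OF that x(1,2)] x(3) by simp
  qed
  have td: "\<tau> \<delta> = - \<delta>" using act[OF t(1)] t(2) by simp
  interpret R: ring "ring_of_type_algebra :: 'm alg_closure ring" by (rule ring_from_type_algebra)
  interpret B: subfield_set "base_field :: 'm alg_closure set" by (rule base_field_subfield)
  let ?M = "base_field :: 'm alg_closure set"
  \<comment> \<open>Dimension is built up one line at a time: 1 added to the zero space gives the
    base field, and \<open>\<delta>\<close> is added next.\<close>
  have "R.dimension (Suc 0) ?M (R.line_extension ?M 1 {0})"
    using R.zero_dim[of ?M] by (intro R.Suc_dim) auto
  moreover have "R.line_extension ?M 1 {0} = ?M"
    by (auto simp: R.line_extension_mem_iff)
  ultimately have "R.dimension (Suc 0) ?M ?M" by simp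
  moreover have "\<delta> \<notin> ?M"
  proof
    assume "\<delta> \<in> ?M"
    then have "\<tau> \<delta> = \<delta>" using T.Gal_fixes[of \<tau> \<delta>] t(1) by (simp add: G_def)
    \<comment> \<open>The characteristic enters here: otherwise \<open>\<delta>\<close> and
      \<open>- \<delta>\<close> would not be distinguished.\<close>
    then have "2 * \<delta> = 0" using td by (metis add.right_inverse mult_2)
    then show False using d0 two' by simp
  qed
  ultimately have "R.dimension (Suc (Suc 0)) ?M (R.line_extension ?M \<delta> ?M)"
    by (intro R.Suc_dim) auto
  moreover have "R.line_extension ?M \<delta> ?M = S1.N \<inter> S2.N"
  proof (intro Set.set_eqI iffI)
    fix x assume "x \<in> R.line_extension ?M \<delta> ?M"
    then show "x \<in> S1.N \<inter> S2.N"
      using d1 d2 S1.base_subset S2.base_subset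
      by (auto simp: R.line_extension_mem_iff intro!: S1.N.add_mem S1.N.mult_mem S2.N.add_mem S2.N.mult_mem)
  next
    fix x assume "x \<in> S1.N \<inter> S2.N"
    then have x: "x \<in> S1.N" "x \<in> S2.N" by auto
    define y where "y = \<tau> x"
    have y: "y \<in> S1.N" "y \<in> S2.N"
    proof -
      have "restrict \<tau> S1.N x \<in> S1.N" "restrict \<tau> S2.N x \<in> S2.N"
        using S1.Gal_mem[OF G_restrict1[OF t(1)] x(1)] S2.Gal_mem[OF G_restrict2[OF t(1)] x(2)] .
      then show "y \<in> S1.N" "y \<in> S2.N" using x by (simp_all add: y_def)
    qed
    have xyN: "x \<in> T.N" "y \<in> T.N" using x y N1_subset by auto
    have ty: "\<tau> y = x" using tt[OF x] by (simp add: y_def)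
    have half: "(1 / 2 :: 'm alg_closure) \<in> base_field"
      using B.inverse_mem[of 2] B.add_mem[of 1 1] by (simp add: inverse_eq_divide)
    have u: "x + y \<in> base_field"
      using x y ty xyN by (intro mem1) (auto simp: t.hom_add y_def[symmetric] add.commute intro: S1.N.add_mem S2.N.add_mem)
    have v: "(x - y) * inverse \<delta> \<in> base_field"
    proof (rule mem1)
      show "(x - y) * inverse \<delta> \<in> S1.N" "(x - y) * inverse \<delta> \<in> S2.N"
        using x y d1 d2 by (auto intro!: S1.N.mult_mem S1.N.diff_mem S1.N.inverse_mem
            S2.N.mult_mem S2.N.diff_mem S2.N.inverse_mem)
      have "\<tau> ((x - y) * inverse \<delta>) = (\<tau> x - \<tau> y) * inverse (\<tau> \<delta>)"
        using xyN dN by (simp add: t.hom_mult t.hom_diff t.hom_inverse T.N.diff_mem T.N.inverse_mem)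
      also have "\<dots> = (x - y) * inverse \<delta>"
        using ty td by (simp add: y_def[symmetric] inverse_minus_eq algebra_simps)
      finally show "\<tau> ((x - y) * inverse \<delta>) = (x - y) * inverse \<delta>" .
    qed
    \<comment> \<open>The symmetric part \<open>x + y\<close> is fixed by \<open>\<tau>\<close>; the
      antisymmetric part \<open>x - y\<close> is negated, and so becomes fixed after division by
      \<open>\<delta>\<close>.\<close>
    have "x = (1 / 2 * ((x - y) * inverse \<delta>)) * \<delta> + 1 / 2 * (x + y)"
      using d0 two' by (simp add: field_simps)
    then have "\<exists>k\<in>?M. \<exists>v\<in>?M. x = k * \<delta> + v"
      using B.mult_mem[OF half u] B.mult_mem[OF half v] by blast
    then show "x \<in> R.line_extension ?M \<delta> ?M"
      by (simp only: R.line_extension_mem_iff type_algebra_simps)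
  qed
  ultimately show ?thesis by (simp add: numeral_2_eq_2)
qed

end

section \<open>The quartics and their root bijections\<close>

text \<open>Once both root sets are numbered, conjugating a bijection by an automorphism becomes
  multiplication by the second label on the left and by the inverse of the first on the
  right.\<close>

definition bijection_orbit ::
  "((nat \<Rightarrow> nat) \<times> (nat \<Rightarrow> nat)) set \<Rightarrow> (nat \<Rightarrow> nat) \<Rightarrow> (nat \<Rightarrow> nat) set" where
  "bijection_orbit J p = (\<lambda>(g, h). h \<circ> p \<circ> inv' g) ` J"

definition orbit_type :: "((nat \<Rightarrow> nat) \<times> (nat \<Rightarrow> nat)) set \<Rightarrow> nat multiset" where
  "orbit_type J = image_mset card (mset_set (bijection_orbit J ` {p. p permutes {1..4}}))"

section \<open>Distinct roots of the quartics\<close>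

lemma map_poly_quartic: "map_poly to_ac (quartic (a, b)) = [:to_ac b, to_ac b, to_ac a, 0, 1:]"
  by (simp add: quartic_def map_poly_pCons)

lemma closure_roots_quartic: "closure_roots (quartic (a, b)) = {x. poly [:to_ac b, to_ac b, to_ac a, 0, 1:] x = 0}"
  by (simp add: closure_roots_def map_poly_quartic)

text \<open>The two equations give \<open>b\<close> once from the derivative, as \<open>b'\<close>,
  and then from the polynomial, as \<open>c\<close>, both expressed in \<open>a\<close> and
  \<open>r\<close>. The quartic with linear coefficient \<open>b'\<close> and constant term
  \<open>c\<close> has the double root \<open>r\<close> identically.\<close>

lemma disc_of_double_root:
  fixes a b r :: "'a::comm_ring_1"
  assumes "r ^ 4 + a * r ^ 2 + b * r + b = 0" "4 * r ^ 3 + 2 * a * r + b = 0"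
  shows "b * (16 * a^4 - 128 * a^2 * b - 4 * a^3 * b + 256 * b^2 + 144 * a * b^2 - 27 * b^3) = 0"
proof -
  define b' c where "b' = - (4 * r ^ 3 + 2 * a * r)" and "c = 3 * r ^ 4 + a * r ^ 2"
  have b: "b = b'"
    using assms(2) unfolding b'_def eq_neg_iff_add_eq_0 by (subst add.commute)
  have "b = - (r ^ 4 + a * r ^ 2 + b * r)"
    using assms(1) unfolding eq_neg_iff_add_eq_0 by (subst add.commute)
  also have "\<dots> = c" unfolding b b'_def c_def by (simp add: algebra_simps power4_eq_xxxx power3_eq_cube power2_eq_square)
  finally have c: "b = c" .
  \<comment> \<open>The discriminant of \<open>X^4 + a X^2 + q X + s\<close> is \<open>16 a^4 s -
    128 a^2 s^2 - 4 a^3 q^2 + 256 s^3 + 144 a q^2 s - 27 q^4\<close>. With \<open>b'\<close> for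
    \<open>q\<close> and \<open>c\<close> for \<open>s\<close> it vanishes as a polynomial in
    \<open>a\<close> and \<open>r\<close>, so each factor \<open>b\<close> is replaced according to
    its slot.\<close>
  have "b * (16 * a^4 - 128 * a^2 * b - 4 * a^3 * b + 256 * b^2 + 144 * a * b^2 - 27 * b^3) =
      16 * a^4 * b - 128 * a^2 * (b * b) - 4 * a^3 * (b * b) + 256 * (b * b * b) + 144 * a * (b * b * b) - 27 * (b * b * b * b)"
    by (simp add: algebra_simps power2_eq_square power3_eq_cube)
  also have "\<dots> = 16 * a^4 * c - 128 * a^2 * (c * c) - 4 * a^3 * (b' * b') + 256 * (c * c * c)
      + 144 * a * (b' * b' * c) - 27 * (b' * b' * b' * b')"
    using b c by metis
  also have "\<dots> = 0"
    unfolding b'_def c_def by (simp add: algebra_simps power4_eq_xxxx power3_eq_cube power2_eq_square)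
  finally show ?thesis .
qed

text \<open>The polynomial splits into linear factors, and a repeated one would give a common root
  with the derivative. Hence the multiset of roots has no multiplicities.\<close>

lemma card_roots_if_no_double_root:
  fixes p :: "'a::alg_closed_field poly"
  assumes p: "p \<noteq> 0" and simple: "\<And>x. poly p x = 0 \<Longrightarrow> poly (pderiv p) x \<noteq> 0"
  shows "card {x. poly p x = 0} = degree p"
proof -
  obtain A where A: "size A = degree p" "p = smult (lead_coeff p) (\<Prod>x\<in>#A. [:-x, 1:])"
    using alg_closed_imp_factorization[OF p] by blast
  have roots: "{x. poly p x = 0} = set_mset A"
    using p by (subst A(2)) (auto simp: poly_prod_mset)
  have "count A x \<le> 1" for x
  proof (rule ccontr)
    assume "\<not> count A x \<le> 1"
    then have "{#x, x#} \<subseteq># A" by (auto simp: subseteq_mset_def)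
    then obtain B where "A = {#x, x#} + B" by (metis subset_mset.le_iff_add)
    then have "p = [:-x, 1:] * ([:-x, 1:] * smult (lead_coeff p) (\<Prod>x\<in>#B. [:-x, 1:]))"
      using A(2) by (simp del: mult_pCons_left mult_pCons_right add: mult_smult_right)
    then obtain q where "p = [:-x, 1:] * ([:-x, 1:] * q)" ..
    then have "poly p x = 0" "poly (pderiv p) x = 0"
      by (simp_all add: pderiv_mult del: mult_pCons_left mult_pCons_right)
    then show False using simple by blast
  qed
  then have "count A x = 1" if "x \<in># A" for x
    using that by (metis One_nat_def count_greater_eq_one_iff le_antisym)
  then have "size A = card (set_mset A)"
    by (simp add: size_multiset_overloaded_eq)
  then show ?thesis using A(1) roots by simp
qed

lemma card_quartic_roots:
  fixes a :: "'m::field \<times> 'm"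
  assumes "quartic_disc a \<noteq> 0"
  shows "card (closure_roots (quartic a)) = 4"
proof -
  obtain u v where a: "a = (u, v)" by (cases a)
  define p where "p = [:to_ac v, to_ac v, to_ac u, 0, 1:]"
  have "card {x. poly p x = 0} = degree p"
  proof (rule card_roots_if_no_double_root)
    show "p \<noteq> 0" by (simp add: p_def)
    fix r assume r: "poly p r = 0"
    show "poly (pderiv p) r \<noteq> 0"
    proof
      assume r': "poly (pderiv p) r = 0"
      have "r ^ 4 + to_ac u * r ^ 2 + to_ac v * r + to_ac v = 0"
        using r by (simp add: p_def algebra_simps power4_eq_xxxx power2_eq_square)
      moreover have "4 * r ^ 3 + 2 * to_ac u * r + to_ac v = 0"
        using r' by (simp add: p_def pderiv_pCons algebra_simps power3_eq_cube)
      ultimately have "to_ac (quartic_disc a) = 0"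
        using disc_of_double_root[of r "to_ac u" "to_ac v"] by (simp add: a quartic_disc_def)
      then show False using assms by simp
    qed
  qed
  then show ?thesis
    by (simp add: a closure_roots_quartic p_def)
qed

lemma quartic_root_set:
  fixes a :: "'m::field \<times> 'm"
  assumes "quartic_disc a \<noteq> 0"
  shows "root_set (closure_roots (quartic a))"
proof
  show "finite (closure_roots (quartic a))"
    using card_quartic_roots[OF assms] by (metis card.infinite zero_neq_numeral)
  fix s assume s: "s \<in> closure_roots (quartic a)"
  obtain u v where a: "a = (u, v)" by (cases a)
  let ?p = "[:to_ac v, to_ac v, to_ac u, 0, 1:]"
  have "?p \<in> polys_over base_field"
  proof -
    interpret subfield_set "base_field :: 'm alg_closure set" by (rule base_field_subfield)
    show ?thesis by (intro poly_pCons_mem poly_0_mem) simp_all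
  qed
  then show "\<exists>q\<in>polys_over base_field. q \<noteq> 0 \<and> poly q s = 0 \<and>
      card {z. poly q z = 0} = degree q \<and> {z. poly q z = 0} \<subseteq> closure_roots (quartic a)"
    using s card_quartic_roots[OF assms] unfolding a closure_roots_quartic
    by (intro bexI[of _ ?p]) auto
qed

lemma L_field_gen: "L_field a = gen (base_field \<union> closure_roots (quartic a))"
  by (simp add: L_field_def splitting_field_def)

lemma G_single_Gal: "G_single a = Gal (gen (base_field \<union> closure_roots (quartic a)))"
  by (simp add: G_single_def L_field_gen)

lemma G_pair_Gal:
  "G_pair a a' = Gal (gen (base_field \<union> (closure_roots (quartic a) \<union> closure_roots (quartic a'))))"
proof -
  have "compositum (L_field a) (L_field a') =
      gen (base_field \<union> closure_roots (quartic a) \<union> gen (base_field \<union> closure_roots (quartic a')))"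
    by (simp add: compositum_def L_field_gen gen_absorb)
  also have "\<dots> = gen (base_field \<union> closure_roots (quartic a') \<union> (base_field \<union> closure_roots (quartic a)))"
    by (subst Un_commute) (rule gen_absorb)
  also have "\<dots> = gen (base_field \<union> (closure_roots (quartic a) \<union> closure_roots (quartic a')))"
    by (rule arg_cong[where f = gen]) auto
  finally show ?thesis by (simp add: G_pair_def)
qed

section \<open>The action on root bijections in numbered form\<close>

lemma (in root_pair) lab_inverse:
  assumes "\<sigma> \<in> carrier G"
  shows "lab e1 (inv\<^bsub>G\<^esub> \<sigma>) = inv' (lab e1 \<sigma>)"
proof -
  interpret group G by (rule G_group)
  have "lab e1 \<sigma> \<circ> lab e1 (inv\<^bsub>G\<^esub> \<sigma>) = id"
    using assms by (simp flip: lab_mult add: lab_one)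
  moreover have "lab e1 (inv\<^bsub>G\<^esub> \<sigma>) \<circ> lab e1 \<sigma> = id"
    using assms by (simp flip: lab_mult add: lab_one)
  ultimately show ?thesis by (metis inv_unique_comp)
qed

locale quartic_pair = root_pair "closure_roots (quartic a)" "closure_roots (quartic a')" e1 e2
  for a a' :: "'m::field \<times> 'm" and e1 e2
begin

lemma G_pair_G: "G_pair a a' = G"
  by (simp add: G_pair_Gal G_def)

definition coords :: "('m alg_closure \<Rightarrow> 'm alg_closure) \<Rightarrow> nat \<Rightarrow> nat" where
  "coords \<phi> = (\<lambda>i. if i \<in> {1..4} then inv_into {1..4} e2 (\<phi> (e1 i)) else i)"

lemma coords_apply:
  assumes "\<phi> \<in> root_bijections a a'" "i \<in> {1..4}"
  shows "e2 (coords \<phi> i) = \<phi> (e1 i)" "coords \<phi> i \<in> {1..4}"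
proof -
  have "\<phi> (e1 i) \<in> closure_roots (quartic a')"
    using assms lab_mem[OF e1] by (auto simp: root_bijections_def dest: bij_betwE)
  then show "e2 (coords \<phi> i) = \<phi> (e1 i)" "coords \<phi> i \<in> {1..4}"
    using assms(2) lab_e[OF e2] lab_in[OF e2] by (simp_all add: coords_def)
qed

lemma coords_bij: "bij_betw coords (root_bijections a a') {p. p permutes {1..4}}"
proof (rule bij_betw_imageI)
  show "inj_on coords (root_bijections a a')"
  proof (rule inj_onI)
    fix \<phi> \<psi> assume m: "\<phi> \<in> root_bijections a a'" "\<psi> \<in> root_bijections a a'" and eq: "coords \<phi> = coords \<psi>"
    have ext: "\<phi> \<in> extensional (closure_roots (quartic a))" "\<psi> \<in> extensional (closure_roots (quartic a))"
      using m by (auto simp: root_bijections_def)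
    show "\<phi> = \<psi>"
    proof (rule extensionalityI[OF ext])
      fix x assume "x \<in> closure_roots (quartic a)"
      then obtain i where "i \<in> {1..4}" "x = e1 i"
        using e1 by (metis bij_betw_imp_surj_on imageE)
      then show "\<phi> x = \<psi> x" using coords_apply(1)[OF m(1)] coords_apply(1)[OF m(2)] eq by simp
    qed
  qed
  show "coords ` root_bijections a a' = {p. p permutes {1..4}}"
  proof (intro Set.set_eqI iffI)
    fix p assume "p \<in> coords ` root_bijections a a'"
    then obtain \<phi> where p: "p = coords \<phi>" and m: "\<phi> \<in> root_bijections a a'" by blast
    have inj: "inj_on \<phi> (closure_roots (quartic a))"
      using m by (auto simp: root_bijections_def bij_betw_def)
    have "p permutes {1..4}"
      unfolding p
    proof (rule inj_imp_permutes)
      show "inj_on (coords \<phi>) {1..4}"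
        using coords_apply(1)[OF m] inj lab_mem[OF e1] e_inj[OF e1]
        by (intro inj_onI) (metis inj_onD)
    qed (use coords_apply(2)[OF m] in \<open>auto simp: coords_def\<close>)
    then show "p \<in> {p. p permutes {1..4}}" by simp
  next
    fix p :: "nat \<Rightarrow> nat" assume "p \<in> {p. p permutes {1..4}}"
    then have p: "p permutes {1..4}" by simp
    define \<phi> where "\<phi> = restrict (e2 \<circ> p \<circ> inv_into {1..4} e1) (closure_roots (quartic a))"
    have "bij_betw (e2 \<circ> p \<circ> inv_into {1..4} e1) (closure_roots (quartic a)) (closure_roots (quartic a'))"
      using bij_betw_trans[OF bij_betw_trans[OF bij_betw_inv_into[OF e1] permutes_imp_bij[OF p]] e2]
      by (simp add: o_assoc)
    then have "\<phi> \<in> root_bijections a a'"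
      by (simp add: root_bijections_def \<phi>_def bij_betw_restrict_eq)
    moreover have "coords \<phi> = p"
    proof
      fix i show "coords \<phi> i = p i"
      proof (cases "i \<in> {1..4}")
        case True
        then show ?thesis
          using lab_mem[OF e1 True] permutes_in_image[OF p, of i]
            bij_betw_inv_into_left[OF e1 True] bij_betw_inv_into_left[OF e2, of "p i"]
          by (simp add: coords_def \<phi>_def)
      next
        case False
        then have "coords \<phi> i = i" unfolding coords_def by (simp only: if_False)
        then show ?thesis using permutes_not_in[OF p False] by simp
      qed
    qed
    ultimately show "p \<in> coords ` root_bijections a a'" by blast
  qed
qed

lemma root_action_closed:
  assumes s: "\<sigma> \<in> carrier G" and m: "\<phi> \<in> root_bijections a a'"
  shows "root_action a a' \<sigma> \<phi> \<in> root_bijections a a'"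
proof -
  have inv: "inv\<^bsub>G\<^esub> \<sigma> \<in> carrier G"
    using G_group s by (simp add: group.inv_closed)
  have "bij_betw (inv\<^bsub>G\<^esub> \<sigma>) (closure_roots (quartic a)) (closure_roots (quartic a))"
    using G_root_img(1,3)[OF inv] S1.finite_S by (simp add: bij_betw_def endo_inj_surj)
  moreover have "bij_betw \<phi> (closure_roots (quartic a)) (closure_roots (quartic a'))"
    using m by (simp add: root_bijections_def)
  moreover have "bij_betw \<sigma> (closure_roots (quartic a')) (closure_roots (quartic a'))"
    using G_root_img(2,4)[OF s] S2.finite_S by (simp add: bij_betw_def endo_inj_surj)
  ultimately have "bij_betw (\<sigma> \<circ> (\<phi> \<circ> inv\<^bsub>G\<^esub> \<sigma>)) (closure_roots (quartic a)) (closure_roots (quartic a'))"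
    by (intro bij_betw_trans)
  then show ?thesis
    by (simp add: root_action_def root_bijections_def G_pair_G bij_betw_restrict_eq o_def)
qed

lemma coords_root_action:
  assumes s: "\<sigma> \<in> carrier G" and m: "\<phi> \<in> root_bijections a a'"
  shows "coords (root_action a a' \<sigma> \<phi>) = lab e2 \<sigma> \<circ> coords \<phi> \<circ> inv' (lab e1 \<sigma>)"
proof
  have inv: "inv\<^bsub>G\<^esub> \<sigma> \<in> carrier G"
    using G_group s by (simp add: group.inv_closed)
  let ?l = "lab e1 (inv\<^bsub>G\<^esub> \<sigma>)"
  fix i show "coords (root_action a a' \<sigma> \<phi>) i = (lab e2 \<sigma> \<circ> coords \<phi> \<circ> inv' (lab e1 \<sigma>)) i"
  proof (cases "i \<in> {1..4}")
    case True
    have l: "?l i \<in> {1..4}" "e1 (?l i) = (inv\<^bsub>G\<^esub> \<sigma>) (e1 i)"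
      using lab_apply_in[OF e1 G_root_img(1)[OF inv] True] lab_apply[OF e1 G_root_img(1)[OF inv] True] .
    have "e2 (coords (root_action a a' \<sigma> \<phi>) i) = \<sigma> (\<phi> (e1 (?l i)))"
      using coords_apply(1)[OF root_action_closed[OF s m] True] lab_mem[OF e1 True] l(2)
      by (simp add: root_action_def G_pair_G)
    also have "\<dots> = e2 (lab e2 \<sigma> (coords \<phi> (?l i)))"
      using coords_apply[OF m l(1)] lab_apply[OF e2 G_root_img(2)[OF s]] by simp
    finally have "coords (root_action a a' \<sigma> \<phi>) i = lab e2 \<sigma> (coords \<phi> (?l i))"
      using coords_apply(2)[OF root_action_closed[OF s m] True]
        lab_apply_in[OF e2 G_root_img(2)[OF s] coords_apply(2)[OF m l(1)]]
      by (intro e_inj[OF e2])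
    then show ?thesis by (simp add: lab_inverse[OF s])
  next
    case False
    have "coords f i = i" "lab e2 f i = i" "?l i = i" for f
      using False by (simp_all only: coords_def lab_def if_False)
    then show ?thesis by (simp flip: lab_inverse[OF s])
  qed
qed

text \<open>\<open>coords\<close> is injective and equivariant, so it carries orbits to orbits of
  the same size and keeps different orbits different. The multisets therefore have equal entries
  with equal multiplicities.\<close>

lemma decomposition_type_orbit_type: "decomposition_type a a' = orbit_type J"
proof -
  define E where "E = root_bijections a a'"
  define orb where "orb = orbit G (root_action a a')"
  have inj: "inj_on coords E" and img: "coords ` E = {p. p permutes {1..4}}"
    using coords_bij by (auto simp: bij_betw_def E_def)
  have sub: "orb \<phi> \<subseteq> E" if "\<phi> \<in> E" for \<phi>
    using root_action_closed that by (auto simp: orb_def orbit_def E_def)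
  have orb_img: "coords ` orb \<phi> = bijection_orbit J (coords \<phi>)" if "\<phi> \<in> E" for \<phi>
  proof -
    have "orb \<phi> = (\<lambda>\<sigma>. root_action a a' \<sigma> \<phi>) ` carrier G"
      by (auto simp: orb_def orbit_def)
    then show ?thesis
      using coords_root_action that by (simp add: bijection_orbit_def J_def image_image E_def)
  qed
  have "inj_on ((`) coords) (orb ` E)"
  proof (rule inj_onI)
    fix A B assume "A \<in> orb ` E" "B \<in> orb ` E" "coords ` A = coords ` B"
    then show "A = B" using sub inj_on_image_eq_iff[OF inj, of A B] by blast
  qed
  then have "mset_set (bijection_orbit J ` coords ` E) = image_mset ((`) coords) (mset_set (orb ` E))"
    using orb_img by (subst image_mset_mset_set) (simp_all add: image_image)
  moreover have "orbit_type J = image_mset card (mset_set (bijection_orbit J ` coords ` E))"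
    by (simp only: orbit_type_def img)
  ultimately have "orbit_type J = image_mset (\<lambda>A. card (coords ` A)) (mset_set (orb ` E))"
    by (simp add: multiset.map_comp comp_def)
  also have "\<dots> = image_mset card (mset_set (orb ` E))"
  proof (rule image_mset_cong)
    fix A assume A: "A \<in># mset_set (orb ` E)"
    \<comment> \<open>\<open>mset_set\<close> of an infinite set is empty, so having an element
      already forces finiteness.\<close>
    have "finite (orb ` E)" using A by (metis empty_iff mset_set.infinite set_mset_empty)
    then have "A \<in> orb ` E" using A by simp
    then show "card (coords ` A) = card A"
      using sub inj by (auto intro!: card_image intro: inj_on_subset)
  qed
  also have "orb ` E = orbits G E (root_action a a')"
    by (auto simp: orbits_def orb_def)
  finally show ?thesis by (simp add: decomposition_type_def G_pair_G E_def)
qed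

end

section \<open>Permutations of four points\<close>

text \<open>A permutation of \<open>{1..4}\<close> is encoded by its four values, so that statements about the
  symmetric group are decided by rewriting.\<close>

datatype pt = P1 | P2 | P3 | P4
datatype pm = Pm pt pt pt pt

fun ap :: "pm \<Rightarrow> pt \<Rightarrow> pt" where
  "ap (Pm a b c d) P1 = a"
| "ap (Pm a b c d) P2 = b"
| "ap (Pm a b c d) P3 = c"
| "ap (Pm a b c d) P4 = d"

fun cmp :: "pm \<Rightarrow> pm \<Rightarrow> pm" where
  "cmp p (Pm a b c d) = Pm (ap p a) (ap p b) (ap p c) (ap p d)"

abbreviation "pid \<equiv> Pm P1 P2 P3 P4"

fun num :: "pt \<Rightarrow> nat" where
  "num P1 = 1" | "num P2 = 2" | "num P3 = 3" | "num P4 = 4"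

definition perm4 :: "pm \<Rightarrow> nat \<Rightarrow> nat" where
  "perm4 p i = (if i = 1 then num (ap p P1) else if i = 2 then num (ap p P2)
     else if i = 3 then num (ap p P3) else if i = 4 then num (ap p P4) else i)"

definition all_pm :: "pm list" where
  "all_pm = [Pm a b c d. a \<leftarrow> [P1, P2, P3, P4], b \<leftarrow> [P1, P2, P3, P4], b \<noteq> a,
     c \<leftarrow> [P1, P2, P3, P4], c \<noteq> a, c \<noteq> b, d \<leftarrow> [P1, P2, P3, P4], d \<noteq> a, d \<noteq> b, d \<noteq> c]"

text \<open>The inverse is found by search, hence meaningful only for members of
  \<open>all_pm\<close>.\<close>

definition pinv :: "pm \<Rightarrow> pm" where
  "pinv p = hd (filter (\<lambda>q. cmp p q = pid) all_pm)"

lemma num_inj [simp]: "num a = num b \<longleftrightarrow> a = b"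
  by (cases a; cases b) auto

lemma num_range: "num a \<in> {1..4}"
  by (cases a) auto

lemma num_cases: "i \<in> {1..4} \<Longrightarrow> \<exists>a. i = num a"
proof -
  assume "i \<in> {1..4}"
  then have "i = 1 \<or> i = 2 \<or> i = 3 \<or> i = 4" by auto
  then show ?thesis by (metis num.simps)
qed

lemma perm_num [simp]: "perm4 p (num a) = num (ap p a)"
  by (cases a) (simp_all add: perm4_def)

lemma perm_outside: "i \<notin> {1..4} \<Longrightarrow> perm4 p i = i"
  by (auto simp: perm4_def)

lemma ap_cmp [simp]: "ap (cmp p q) a = ap p (ap q a)"
  by (cases q; cases a) auto

lemma pm_eqI: "(\<And>a. ap p a = ap q a) \<Longrightarrow> p = q"
  by (cases p; cases q) (metis ap.simps)

lemma perm_eqI: "(\<And>a. f (num a) = g (num a)) \<Longrightarrow> (\<And>i. i \<notin> {1..4} \<Longrightarrow> f i = g i) \<Longrightarrow> f = g"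
  by (rule ext) (metis num_cases)

lemma perm_cmp: "perm4 (cmp p q) = perm4 p \<circ> perm4 q"
  by (rule perm_eqI) (simp_all add: perm_outside del: atLeastAtMost_iff)

lemma perm_inj: "perm4 p = perm4 q \<longleftrightarrow> p = q"
  by (metis num_inj perm_num pm_eqI)

lemma perm_pid: "perm4 pid = id"
proof (rule perm_eqI)
  fix a show "perm4 pid (num a) = id (num a)" by (cases a) (simp_all add: perm4_def)
qed (simp_all add: perm_outside del: atLeastAtMost_iff)

lemma cmp_assoc: "cmp (cmp p q) r = cmp p (cmp q r)"
  by (rule pm_eqI) simp

lemma ap_pid [simp]: "ap pid a = a"
  by (cases a) simp_all

lemma cmp_pid [simp]: "cmp p pid = p" "cmp pid p = p"
  by (rule pm_eqI, simp only: ap_cmp ap_pid)+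

lemma all_pm_code: "length all_pm = 24" "distinct all_pm"
  "\<forall>p\<in>set all_pm. \<forall>a\<in>set [P1,P2,P3,P4]. \<forall>b\<in>set [P1,P2,P3,P4]. ap p a = ap p b \<longrightarrow> a = b"
  "\<forall>p\<in>set all_pm. pinv p \<in> set all_pm \<and> cmp p (pinv p) = pid \<and> cmp (pinv p) p = pid"
  by code_simp+

lemma perm_permutes: 
  assumes "p \<in> set all_pm"
  shows "perm4 p permutes {1..4}"
proof (rule inj_imp_permutes)
  have mem: "a \<in> set [P1, P2, P3, P4]" for a by (cases a) simp_all
  have inj: "a = b" if "ap p a = ap p b" for a b
    using bspec[OF bspec[OF bspec[OF all_pm_code(3) assms] mem[of a]] mem[of b]] that by simp
  show "inj_on (perm4 p) {1..4}"
  proof (rule inj_onI)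
    fix i j :: nat assume "i \<in> {1..4}" "j \<in> {1..4}" and eq: "perm4 p i = perm4 p j"
    then obtain a b where "i = num a" "j = num b" using num_cases by blast
    then show "i = j" using eq inj by simp
  qed
  show "perm4 p i \<in> {1..4}" if "i \<in> {1..4}" for i
    using num_cases[OF that] num_range by auto
qed (simp_all add: perm_outside del: atLeastAtMost_iff)

text \<open>The coding is injective and there are 24 codes, as many as permutations of four
  points.\<close>

lemma perm_image: "perm4 ` set all_pm = {p. p permutes {1..4}}"
proof (rule card_subset_eq)
  show "finite {p. p permutes {1..4::nat}}" by (rule finite_permutations) simp
  show "perm4 ` set all_pm \<subseteq> {p. p permutes {1..4}}" using perm_permutes by auto
  have "card (perm4 ` set all_pm) = card (set all_pm)"
    by (rule card_image) (simp add: inj_on_def perm_inj)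
  also have "\<dots> = 24" using all_pm_code(1,2) distinct_card by metis
  also have "\<dots> = card {p. p permutes {1..4::nat}}"
    by (simp add: card_permutations[of _ 4] fact_numeral)
  finally show "card (perm4 ` set all_pm) = card {p. p permutes {1..4::nat}}" .
qed

lemma perm_pinv: "p \<in> set all_pm \<Longrightarrow> perm4 (pinv p) = inv' (perm4 p)"
  using all_pm_code(4) by (metis inv_unique_comp perm_cmp perm_pid)

section \<open>Standard subgroups of S4 and computed orbit sizes\<close>

abbreviation "cyc3 \<equiv> Pm P2 P3 P1 P4"
abbreviation "cyc4 \<equiv> Pm P2 P3 P4 P1"
abbreviation "t12 \<equiv> Pm P2 P1 P3 P4"
abbreviation "t23 \<equiv> Pm P1 P3 P2 P4"
abbreviation "t34 \<equiv> Pm P1 P2 P4 P3"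
abbreviation "t13 \<equiv> Pm P3 P2 P1 P4"
abbreviation "v12 \<equiv> Pm P2 P1 P4 P3"
abbreviation "v13 \<equiv> Pm P3 P4 P1 P2"

text \<open>A standard subgroup is given by generators (suffix \<open>g\<close>), words in them representing each element
  once (suffix \<open>w\<close>), and relators (suffix \<open>r\<close>, below); suffix \<open>l\<close> is the resulting list of elements.
  \<open>V4\<close> is the normal Klein four-group and \<open>W4\<close> the intransitive one.\<close>

fun evalw :: "pm list \<Rightarrow> nat list \<Rightarrow> pm" where
  "evalw gs [] = pid"
| "evalw gs (i # w) = cmp (gs ! i) (evalw gs w)"

definition elts :: "pm list \<Rightarrow> nat list list \<Rightarrow> pm list" where
  "elts gs ws = map (evalw gs) ws"

definition "S4g = [t12, t23, t34]"
text \<open>Normal forms of the Coxeter group: each factor runs through coset representatives in the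
  chain 1 < S2 < S3 < S4, giving 2 * 3 * 4 words. The noncyclic groups below are factored in the
  same manner.\<close>

definition S4w :: "nat list list" where
  "S4w = [u @ v @ w. u \<leftarrow> [[], [0]], v \<leftarrow> [[], [1], [1, 0]], w \<leftarrow> [[], [2], [2, 1], [2, 1, 0]]]"
definition "A4g = [v12, v13, cyc3]"
definition A4w :: "nat list list" where
  "A4w = [u @ v @ w. u \<leftarrow> [[], [0]], v \<leftarrow> [[], [1]], w \<leftarrow> [[], [2], [2, 2]]]"
definition "D4g = [cyc4, t13]"
definition D4w :: "nat list list" where
  "D4w = [u @ v. u \<leftarrow> [[], [0], [0, 0], [0, 0, 0]], v \<leftarrow> [[], [1]]]"
definition "C4g = [cyc4]"
definition C4w :: "nat list list" where
  "C4w = [[], [0], [0, 0], [0, 0, 0]]"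
definition "V4g = [v12, v13]"
definition "W4g = [t12, t34]"
definition V4w :: "nat list list" where
  "V4w = [u @ v. u \<leftarrow> [[], [0]], v \<leftarrow> [[], [1]]]"
definition "S3g = [t12, t23]"
definition S3w :: "nat list list" where
  "S3w = [u @ v. u \<leftarrow> [[], [0]], v \<leftarrow> [[], [1], [1, 0]]]"
definition "C3g = [cyc3]"
definition C3w :: "nat list list" where
  "C3w = [[], [0], [0, 0]]"

definition "S4l = elts S4g S4w"
definition "A4l = elts A4g A4w"
definition "D4l = elts D4g D4w"
definition "C4l = elts C4g C4w"
definition "V4l = elts V4g V4w"
definition "W4l = elts W4g V4w"
definition "S3l = elts S3g S3w"
definition "C3l = elts C3g C3w"

text \<open>The pairs \<open>(g, h)\<close> in \<open>hl\<close> act by \<open>x \<mapsto> h x g\<close>; \<open>dt\<close> inverts the first components beforehand.\<close>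

definition act_orbit :: "(pm \<times> pm) list \<Rightarrow> pm \<Rightarrow> pm list" where
  "act_orbit hl x = map (\<lambda>(g, h). cmp h (cmp x g)) hl"

text \<open>Peels off the orbit of the head, with \<open>Suc\<close> counting the head itself. The
  result lists true orbit sizes when the list is a union of orbits without repetitions.\<close>

function orbs :: "(pm \<times> pm) list \<Rightarrow> pm list \<Rightarrow> nat list" where
  "orbs hl [] = []"
| "orbs hl (x # xs) = (let ob = set (act_orbit hl x) in
     Suc (length (filter (\<lambda>y. y \<in> ob) xs)) # orbs hl (filter (\<lambda>y. y \<notin> ob) xs))"
  by pat_completeness auto
termination by (relation "measure (length \<circ> snd)") (auto simp: le_imp_less_Suc)

definition dt :: "(pm \<times> pm) list \<Rightarrow> nat list" where
  "dt hl = orbs (map (\<lambda>(g, h). (pinv g, h)) hl) all_pm"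

section \<open>Subgroups of pairs of permutations\<close>

lemma perm_t12: "perm4 t12 = Transposition.transpose 1 2"
  by (auto simp: perm4_def Transposition.transpose_def)

text \<open>A parity certificate that can be evaluated: squares are even, and every permutation
  outside \<open>A4l\<close> is an element of \<open>A4l\<close> times one transposition.\<close>

lemma even_products:
  "\<forall>p\<in>set A4l. \<exists>x\<in>set all_pm. \<exists>y\<in>set all_pm. p = cmp (cmp x x) (cmp y y)"
  "\<forall>p\<in>set all_pm. p \<notin> set A4l \<longrightarrow> (\<exists>q\<in>set A4l. p = cmp t12 q)"
  "\<forall>p\<in>set A4l. p \<in> set all_pm"
  by code_simp+

lemma evenperm_perm4:
  assumes "p \<in> set all_pm"
  shows "evenperm (perm4 p) \<longleftrightarrow> p \<in> set A4l"
proof -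
  have perm: "permutation (perm4 q)" if "q \<in> set all_pm" for q
    by (rule permutes_imp_permutation[OF _ perm_permutes[OF that]]) simp
  have even: "evenperm (perm4 q)" if q: "q \<in> set A4l" for q
  proof -
    obtain x y where xy: "x \<in> set all_pm" "y \<in> set all_pm" "q = cmp (cmp x x) (cmp y y)"
      using bspec[OF even_products(1) q] by blast
    then have "evenperm (perm4 x \<circ> perm4 x)" "evenperm (perm4 y \<circ> perm4 y)"
      "permutation (perm4 x \<circ> perm4 x)" "permutation (perm4 y \<circ> perm4 y)"
      using perm by (simp_all add: evenperm_comp permutation_compose)
    then show ?thesis unfolding xy(3) perm_cmp by (simp add: evenperm_comp)
  qed
  moreover have "\<not> evenperm (perm4 p)" if "p \<notin> set A4l"
  proof -
    from even_products(2)[rule_format, OF assms that]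
    obtain q where q: "q \<in> set A4l" "p = cmp t12 q" ..
    have "permutation (perm4 t12)" unfolding perm_t12 by (rule permutation_swap_id)
    moreover have "\<not> evenperm (perm4 t12)" unfolding perm_t12 by (simp add: evenperm_swap)
    moreover have "permutation (perm4 q)" by (rule perm[OF bspec[OF even_products(3) q(1)]])
    ultimately show ?thesis
      using even[OF q(1)] by (simp add: q(2) perm_cmp evenperm_comp)
  qed
  ultimately show ?thesis by blast
qed

definition perm2 :: "(pm \<times> pm) \<Rightarrow> (nat \<Rightarrow> nat) \<times> (nat \<Rightarrow> nat)" where
  "perm2 = map_prod perm4 perm4"

lemma perm2_inj: "perm2 x = perm2 y \<longleftrightarrow> x = y"
  by (cases x; cases y) (simp add: perm2_def perm_inj)

locale pm_subgroup =
  fixes H :: "(pm \<times> pm) set"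
  assumes sub: "H \<subseteq> set all_pm \<times> set all_pm"
    and one: "(pid, pid) \<in> H"
    and mult: "(p, q) \<in> H \<Longrightarrow> (p', q') \<in> H \<Longrightarrow> (cmp p p', cmp q q') \<in> H"
    and inv: "(p, q) \<in> H \<Longrightarrow> (pinv p, pinv q) \<in> H"

lemma pinv_simps:
  assumes "p \<in> set all_pm"
  shows "pinv p \<in> set all_pm" "cmp p (pinv p) = pid" "cmp (pinv p) p = pid"
  using assms all_pm_code(4) by auto

lemma pinv_unique:
  assumes "p \<in> set all_pm" "cmp p q = pid"
  shows "q = pinv p"
  by (metis assms cmp_assoc cmp_pid pinv_simps(3))

lemma pinv_pinv: "p \<in> set all_pm \<Longrightarrow> pinv (pinv p) = p"
  by (metis pinv_simps pinv_unique)

lemma cmp_closed: "p \<in> set all_pm \<Longrightarrow> q \<in> set all_pm \<Longrightarrow> cmp p q \<in> set all_pm"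
proof -
  have *: "\<forall>p\<in>set all_pm. \<forall>q\<in>set all_pm. cmp p q \<in> set all_pm" by code_simp
  show "p \<in> set all_pm \<Longrightarrow> q \<in> set all_pm \<Longrightarrow> cmp p q \<in> set all_pm" using * by blast
qed

lemma pinv_cmp:
  assumes "p \<in> set all_pm" "q \<in> set all_pm"
  shows "pinv (cmp p q) = cmp (pinv q) (pinv p)"
proof (rule sym, rule pinv_unique)
  show "cmp p q \<in> set all_pm" using assms by (rule cmp_closed)
  have "cmp (cmp p q) (cmp (pinv q) (pinv p)) = cmp p (cmp (cmp q (pinv q)) (pinv p))"
    by (simp only: cmp_assoc)
  then show "cmp (cmp p q) (cmp (pinv q) (pinv p)) = pid"
    using assms by (simp only: pinv_simps cmp_pid)
qed

lemma pm_subgroup_of_image: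
  assumes J: "subgroup J (Sym 4 \<times>\<times> Sym 4)"
  obtains H where "J = perm2 ` H" "pm_subgroup H"
proof -
  interpret group "Sym 4 \<times>\<times> Sym 4" by (rule DirProd_Sym_group)
  interpret J: subgroup J "Sym 4 \<times>\<times> Sym 4" by fact
  define H where "H = {x \<in> set all_pm \<times> set all_pm. perm2 x \<in> J}"
  have mem: "(g, h) \<in> J \<Longrightarrow> g permutes {1..4} \<and> h permutes {1..4}" for g h
    using J.subset by (auto simp: DirProd_def sym_group_def)
  have "J \<subseteq> perm2 ` H"
  proof
    fix x assume x: "x \<in> J"
    obtain g h where gh: "x = (g, h)" by (cases x)
    have "g \<in> perm4 ` set all_pm" "h \<in> perm4 ` set all_pm"
      unfolding perm_image using mem x gh by simp_all
    then show "x \<in> perm2 ` H"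
      using x gh by (auto simp: H_def perm2_def image_iff)
  qed
  moreover have "perm2 ` H \<subseteq> J" by (auto simp: H_def)
  ultimately have "J = perm2 ` H" by (rule subset_antisym)
  moreover have "pm_subgroup H"
  proof
    show "H \<subseteq> set all_pm \<times> set all_pm" by (auto simp: H_def)
    have "pid \<in> set all_pm" by code_simp
    then show "(pid, pid) \<in> H"
      using J.one_closed by (simp add: H_def perm2_def perm_pid DirProd_def sym_group_def)
    fix p q assume pq: "(p, q) \<in> H"
    show "(pinv p, pinv q) \<in> H"
    proof -
      have m: "p \<in> set all_pm" "q \<in> set all_pm" "(perm4 p, perm4 q) \<in> J"
        using pq by (auto simp: H_def perm2_def)
      have c: "perm4 p \<in> carrier (Sym 4)" "perm4 q \<in> carrier (Sym 4)"
        using perm_permutes m by (auto simp: sym_group_def)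
      have "inv\<^bsub>Sym 4 \<times>\<times> Sym 4\<^esub> (perm4 p, perm4 q) \<in> J" using m(3) by (rule J.m_inv_closed)
      then have "(perm4 (pinv p), perm4 (pinv q)) \<in> J"
        using m c by (simp add: inv_DirProd sym_group_is_group perm_pinv)
      then show ?thesis using m pinv_simps(1) by (simp add: H_def perm2_def)
    qed
    fix p' q' assume pq': "(p', q') \<in> H"
    show "(cmp p p', cmp q q') \<in> H"
      using pq pq' J.m_closed[of "(perm4 p, perm4 q)" "(perm4 p', perm4 q')"]
      by (auto simp: H_def perm2_def perm_cmp DirProd_def sym_group_def cmp_closed)
  qed
  ultimately show thesis by (rule that)
qed

context
  fixes hl :: "(pm \<times> pm) list" and A :: "pm list"
  assumes orbit_refl: "\<And>x. x \<in> set A \<Longrightarrow> x \<in> set (act_orbit hl x)"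
    and orbit_eq: "\<And>x y. x \<in> set A \<Longrightarrow> y \<in> set (act_orbit hl x) \<Longrightarrow>
          set (act_orbit hl y) = set (act_orbit hl x)"
begin

text \<open>The two assumptions of the context say that the orbits partition \<open>A\<close>.
  Removing one orbit from a list closed under orbits leaves a closed list, which lets the recursion
  of \<open>orbs\<close> be followed by induction on the length.\<close>

abbreviation "ob x \<equiv> set (act_orbit hl x)"

lemma orbs_mset:
  "distinct xs \<Longrightarrow> set xs \<subseteq> set A \<Longrightarrow> (\<And>x. x \<in> set xs \<Longrightarrow> ob x \<subseteq> set xs) \<Longrightarrow>
    mset (orbs hl xs) = image_mset card (mset_set (ob ` set xs))"
proof (induction "length xs" arbitrary: xs rule: less_induct)
  case less
  show ?case
  proof (cases xs)
    case Nil
    then show ?thesis by simp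
  next
    case (Cons x ys)
    define rest where "rest = filter (\<lambda>y. y \<notin> ob x) ys"
    have x: "x \<in> set A" "ob x \<subseteq> set xs" using less.prems Cons by auto
    have A: "set ys \<subseteq> set A" using less.prems(2) Cons by simp
    have IH: "mset (orbs hl rest) = image_mset card (mset_set (ob ` set rest))"
    proof (rule less.hyps)
      show "length rest < length xs" by (simp add: rest_def Cons le_imp_less_Suc)
      show "distinct rest" "set rest \<subseteq> set A" using less.prems(1) A Cons by (auto simp: rest_def)
      show "ob y \<subseteq> set rest" if y: "y \<in> set rest" for y
      proof
        fix z assume z: "z \<in> ob y"
        have y': "y \<in> set ys" "y \<notin> ob x" "y \<in> set A" using y A by (auto simp: rest_def)
        have zx: "z \<in> set xs" using less.prems(3)[of y] y' z Cons by auto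
        have "z \<notin> ob x"
        proof
          assume "z \<in> ob x"
          then have "ob z = ob x" "ob z = ob y"
            using orbit_eq[of x z] orbit_eq[of y z] x(1) y'(3) z by simp_all
          then show False using orbit_refl[of y] y' by simp
        qed
        moreover have "z \<noteq> x" using calculation orbit_refl[OF x(1)] by auto
        ultimately show "z \<in> set rest" using zx by (simp add: rest_def Cons)
      qed
    qed
    have img: "ob ` set xs = insert (ob x) (ob ` set rest)"
    proof -
      have "ob y = ob x" if "y \<in> ob x" for y using orbit_eq[OF x(1) that] .
      then show ?thesis by (auto simp: Cons rest_def)
    qed
    have new: "ob x \<notin> ob ` set rest"
    proof
      assume "ob x \<in> ob ` set rest"
      then obtain y where y: "y \<in> set rest" "ob x = ob y" by auto
      then have "y \<in> ob x" using orbit_refl[of y] A by (auto simp: rest_def)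
      then show False using y(1) by (simp add: rest_def)
    qed
    have "ob x = insert x (set (filter (\<lambda>y. y \<in> ob x) ys))"
      using x(2) orbit_refl[OF x(1)] by (auto simp: Cons)
    moreover have "card (insert x (set (filter (\<lambda>y. y \<in> ob x) ys))) = Suc (length (filter (\<lambda>y. y \<in> ob x) ys))"
    proof -
      have "x \<notin> set (filter (\<lambda>y. y \<in> ob x) ys)" "distinct (filter (\<lambda>y. y \<in> ob x) ys)"
        using less.prems(1) Cons by auto
      then show ?thesis by (metis List.finite_set card_insert_disjoint distinct_card)
    qed
    ultimately have "card (ob x) = Suc (length (filter (\<lambda>y. y \<in> ob x) ys))" by metis
    then show ?thesis
      using IH new unfolding img by (simp add: Cons Let_def rest_def)
  qed
qed

end

text \<open>The subgroup laws yield reflexivity, transitivity and symmetry of the orbit relation, so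
  the computed sizes are those of a partition; the injective coding \<open>perm4\<close> then
  transports orbits without changing their size or number.\<close>

lemma orbit_type_dt:
  assumes H: "pm_subgroup H" and J: "J = perm2 ` H" and hl: "H = set hl"
  shows "orbit_type J = mset (dt hl)"
proof -
  interpret pm_subgroup H by fact
  define hl' where "hl' = map (\<lambda>(g, h). (pinv g, h)) hl"
  have orb: "set (act_orbit hl' x) = {cmp h (cmp x (pinv g)) |g h. (g, h) \<in> H}" for x
    by (force simp: act_orbit_def hl'_def hl)
  have all: "g \<in> set all_pm \<and> h \<in> set all_pm" if "(g, h) \<in> H" for g h
    using that sub by auto
  have pinv_pid: "pinv pid = pid"
    using pinv_unique[of pid pid] all[OF one] by simp
  have refl: "x \<in> set (act_orbit hl' x)" for x
    unfolding orb using one pinv_pid by (force simp: cmp_pid simp del: cmp.simps)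
  have sub: "set (act_orbit hl' y) \<subseteq> set (act_orbit hl' x)" if y: "y \<in> set (act_orbit hl' x)" for x y
  proof
    fix z assume "z \<in> set (act_orbit hl' y)"
    then obtain g h where z: "(g, h) \<in> H" "z = cmp h (cmp y (pinv g))" unfolding orb by blast
    obtain g' h' where y': "(g', h') \<in> H" "y = cmp h' (cmp x (pinv g'))" using y unfolding orb by blast
    have "z = cmp (cmp h h') (cmp x (pinv (cmp g g')))"
      using all[OF z(1)] all[OF y'(1)] by (simp only: z(2) y'(2) pinv_cmp cmp_assoc)
    then show "z \<in> set (act_orbit hl' x)"
      unfolding orb using mult[OF z(1) y'(1)] by blast
  qed
  have sym: "x \<in> set (act_orbit hl' y)" if y: "y \<in> set (act_orbit hl' x)" for x y
  proof -
    obtain g h where y': "(g, h) \<in> H" "y = cmp h (cmp x (pinv g))" using y unfolding orb by blast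
    have "cmp (pinv h) (cmp y (pinv (pinv g))) = cmp (cmp (pinv h) h) (cmp x (cmp (pinv g) g))"
      using all[OF y'(1)] by (simp only: y'(2) pinv_pinv cmp_assoc)
    also have "\<dots> = x" using all[OF y'(1)] by (simp only: pinv_simps cmp_pid)
    finally show ?thesis unfolding orb using inv[OF y'(1)] by blast
  qed
  have eq: "set (act_orbit hl' y) = set (act_orbit hl' x)" if "y \<in> set (act_orbit hl' x)" for x y
    using sub[OF that] sub[OF sym[OF that]] by (rule subset_antisym)
  have closed: "set (act_orbit hl' x) \<subseteq> set all_pm" if "x \<in> set all_pm" for x
  proof
    fix z assume "z \<in> set (act_orbit hl' x)"
    then obtain g h where z: "(g, h) \<in> H" "z = cmp h (cmp x (pinv g))" unfolding orb by blast
    show "z \<in> set all_pm"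
      unfolding z(2) using all[OF z(1)] that by (intro cmp_closed pinv_simps(1)) auto
  qed
  have main: "mset (dt hl) = image_mset card (mset_set ((\<lambda>x. set (act_orbit hl' x)) ` set all_pm))"
    unfolding dt_def hl'_def[symmetric]
    by (rule orbs_mset[of all_pm]) (use refl eq closed all_pm_code(2) in auto)
  have img: "bijection_orbit J (perm4 x) = perm4 ` set (act_orbit hl' x)" if "x \<in> set all_pm" for x
  proof -
    have "perm4 h \<circ> perm4 x \<circ> inv' (perm4 g) = perm4 (cmp h (cmp x (pinv g)))" if "(g, h) \<in> H" for g h
      using all[OF that] by (simp add: perm_cmp perm_pinv o_assoc del: cmp.simps)
    then show ?thesis
      unfolding bijection_orbit_def J orb perm2_def by (force simp: image_iff)
  qed
  have inj: "inj perm4" by (simp add: inj_on_def perm_inj)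
  have "bijection_orbit J ` {p. p permutes {1..4}} = (\<lambda>x. bijection_orbit J (perm4 x)) ` set all_pm"
    unfolding perm_image[symmetric] image_image ..
  also have "\<dots> = (\<lambda>x. perm4 ` set (act_orbit hl' x)) ` set all_pm"
    using img by (intro image_cong) auto
  also have "\<dots> = (`) perm4 ` (\<lambda>x. set (act_orbit hl' x)) ` set all_pm"
    by (simp add: image_image)
  finally have "orbit_type J = image_mset card (mset_set ((`) perm4 ` (\<lambda>x. set (act_orbit hl' x)) ` set all_pm))"
    by (simp only: orbit_type_def)
  also have "mset_set ((`) perm4 ` (\<lambda>x. set (act_orbit hl' x)) ` set all_pm) =
      image_mset ((`) perm4) (mset_set ((\<lambda>x. set (act_orbit hl' x)) ` set all_pm))"
    by (rule image_mset_mset_set[symmetric]) (simp add: inj_on_def inj_image_eq_iff[OF inj])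
  also have "image_mset card \<dots> = image_mset card (mset_set ((\<lambda>x. set (act_orbit hl' x)) ` set all_pm))"
    using inj by (simp add: multiset.map_comp comp_def card_image inj_on_subset)
  finally show ?thesis using main by simp
qed

section \<open>Standard subgroups and Goursat's lemma\<close>

definition closed_pm :: "pm set \<Rightarrow> bool" where
  "closed_pm U \<longleftrightarrow> U \<subseteq> set all_pm \<and> pid \<in> U \<and> (\<forall>p\<in>U. \<forall>q\<in>U. cmp p q \<in> U)"

definition cj :: "pm \<Rightarrow> pm \<Rightarrow> pm" where
  "cj s x = cmp (pinv s) (cmp x s)"

text \<open>In S4 the elements of order three are exactly the 3-cycles, and those of order four
  exactly the 4-cycles, so cycle types can be tested by powers.\<close>

definition three_cycle :: "pm \<Rightarrow> bool" where
  "three_cycle x \<longleftrightarrow> x \<noteq> pid \<and> cmp x (cmp x x) = pid"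

definition four_cycle :: "pm \<Rightarrow> bool" where
  "four_cycle x \<longleftrightarrow> cmp x x \<noteq> pid \<and> cmp (cmp x x) (cmp x x) = pid"

lemma three_cycle_cj: "s \<in> set all_pm \<Longrightarrow> x \<in> set all_pm \<Longrightarrow> three_cycle (cj s x) \<longleftrightarrow> three_cycle x"
proof -
  have *: "\<forall>s\<in>set all_pm. \<forall>x\<in>set all_pm. three_cycle (cj s x) \<longleftrightarrow> three_cycle x" by code_simp
  show "s \<in> set all_pm \<Longrightarrow> x \<in> set all_pm \<Longrightarrow> three_cycle (cj s x) \<longleftrightarrow> three_cycle x"
    using * by blast
qed

lemma four_cycle_cj: "s \<in> set all_pm \<Longrightarrow> x \<in> set all_pm \<Longrightarrow> four_cycle (cj s x) \<longleftrightarrow> four_cycle x"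
proof -
  have *: "\<forall>s\<in>set all_pm. \<forall>x\<in>set all_pm. four_cycle (cj s x) \<longleftrightarrow> four_cycle x" by code_simp
  show "s \<in> set all_pm \<Longrightarrow> x \<in> set all_pm \<Longrightarrow> four_cycle (cj s x) \<longleftrightarrow> four_cycle x"
    using * by blast
qed

text \<open>Conjugacy in S4 is equality of cycle type; apart from 3-cycles, 4-cycles and the normal
  Klein group only the transpositions are left.\<close>

lemma conjugate_to_standard:
  "\<forall>x\<in>set all_pm. three_cycle x \<longrightarrow> (\<exists>s\<in>set all_pm. cj s x = cyc3)"
  "\<forall>x\<in>set all_pm. four_cycle x \<longrightarrow> (\<exists>s\<in>set all_pm. cj s x = cyc4)"
  "\<forall>x\<in>set all_pm. \<not> three_cycle x \<longrightarrow> \<not> four_cycle x \<longrightarrow> x \<notin> set V4l \<longrightarrow> (\<exists>s\<in>set all_pm. cj s x = t12)"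
  by code_simp+

lemma closed_cj:
  assumes "closed_pm U" "s \<in> set all_pm"
  shows "closed_pm (cj s ` U)"
proof -
  have U: "x \<in> set all_pm" if "x \<in> U" for x using assms that by (auto simp: closed_pm_def)
  have mult: "cmp (cj s x) (cj s y) = cj s (cmp x y)" for x y
  proof -
    have "cmp (cj s x) (cj s y) = cmp (pinv s) (cmp x (cmp (cmp s (pinv s)) (cmp y s)))"
      by (simp only: cj_def cmp_assoc)
    also have "\<dots> = cj s (cmp x y)"
      using assms(2) by (simp only: pinv_simps cmp_pid cj_def cmp_assoc)
    finally show ?thesis .
  qed
  have "cj s pid = pid" using assms(2) by (simp only: cj_def cmp_pid pinv_simps)
  moreover have "pid \<in> U" using assms(1) by (simp add: closed_pm_def)
  ultimately have one: "pid \<in> cj s ` U" by (metis imageI)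
  have "cj s x \<in> set all_pm" if "x \<in> U" for x
    unfolding cj_def using U[OF that] assms(2) by (intro cmp_closed pinv_simps(1))
  moreover have "cmp p q \<in> cj s ` U" if pq: "p \<in> cj s ` U" "q \<in> cj s ` U" for p q
  proof -
    obtain x y where "x \<in> U" "y \<in> U" "p = cj s x" "q = cj s y" using pq by blast
    then show ?thesis using mult assms(1) by (auto simp: closed_pm_def)
  qed
  ultimately show ?thesis using one unfolding closed_pm_def by blast
qed

lemma card_cj:
  assumes "U \<subseteq> set all_pm" "s \<in> set all_pm"
  shows "card (cj s ` U) = card U"
proof (rule card_image, rule inj_onI)
  fix x y assume "x \<in> U" "y \<in> U" and eq: "cj s x = cj s y"
  have "cmp (cmp s (cj s z)) (pinv s) = z" for z
  proof -
    have "cmp (cmp s (cj s z)) (pinv s) = cmp (cmp s (pinv s)) (cmp z (cmp s (pinv s)))"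
      by (simp only: cj_def cmp_assoc)
    then show ?thesis using assms(2) by (simp only: pinv_simps cmp_pid)
  qed
  then show "x = y" using eq by metis
qed

text \<open>The hypothesis \<open>gen\<close> says that \<open>small\<close> has index two in
  \<open>big\<close>: an outside element \<open>x\<close> represents the only other coset, so no
  closed set lies strictly between.\<close>

lemma subset_or_all:
  assumes U: "closed_pm U" "set small \<subseteq> U" "U \<subseteq> set big"
    and gen: "\<forall>x\<in>set big. x \<notin> set small \<longrightarrow> (\<forall>y\<in>set big. \<exists>z\<in>set small. y = z \<or> y = cmp z x)"
  shows "U = set small \<or> U = set big"
proof (rule disjCI)
  assume "U \<noteq> set big"
  show "U = set small"
  proof (rule ccontr)
    assume "U \<noteq> set small"
    then obtain x where x: "x \<in> U" "x \<notin> set small" using U(2) by blast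
    have "y \<in> U" if y: "y \<in> set big" for y
    proof -
      obtain z where "z \<in> set small" "y = z \<or> y = cmp z x"
        using gen x U(3) y by blast
      then show ?thesis using U x by (auto simp: closed_pm_def simp del: cmp.simps)
    qed
    then show False using U(3) \<open>U \<noteq> set big\<close> by blast
  qed
qed

text \<open>The first three say that a subgroup has index two. The fifth to seventh concern double
  cosets of \<open>C3l\<close>: the elements moving the fourth point form two of them, represented
  by \<open>t34\<close> and \<open>v12\<close>, and \<open>A4l\<close> is \<open>C3l\<close>
  together with that of \<open>v12\<close>. The eighth and ninth expose a forbidden cycle in
  products of a stray element.\<close>

lemma classify_checks:
  "\<forall>x\<in>set S3l. x \<notin> set C3l \<longrightarrow> (\<forall>y\<in>set S3l. \<exists>z\<in>set C3l. y = z \<or> y = cmp z x)"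
  "\<forall>x\<in>set all_pm. x \<notin> set A4l \<longrightarrow> (\<forall>y\<in>set all_pm. \<exists>z\<in>set A4l. y = z \<or> y = cmp z x)"
  "\<forall>x\<in>set D4l. x \<notin> set C4l \<longrightarrow> (\<forall>y\<in>set D4l. \<exists>z\<in>set C4l. y = z \<or> y = cmp z x)"
  "\<forall>x\<in>set all_pm. ap x P4 = P4 \<longrightarrow> x \<in> set S3l"
  "\<forall>x\<in>set all_pm. ap x P4 \<noteq> P4 \<longrightarrow> (\<exists>i\<in>set C3l. \<exists>j\<in>set C3l. cmp i (cmp x j) \<in> set [t34, v12])"
  "\<exists>i\<in>set C3l. \<exists>j\<in>set C3l. \<exists>k\<in>set C3l. cmp i (cmp t34 (cmp j (cmp t34 k))) = v12"
  "\<forall>y\<in>set A4l. y \<in> set C3l \<or> (\<exists>i\<in>set C3l. \<exists>j\<in>set C3l. y = cmp i (cmp v12 j))"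
  "\<forall>x\<in>set all_pm. x \<notin> set D4l \<longrightarrow> three_cycle x \<or> three_cycle (cmp cyc4 x) \<or> three_cycle (cmp (cmp cyc4 cyc4) x)"
  "\<forall>x\<in>set all_pm. x \<notin> set W4l \<longrightarrow> three_cycle x \<or> four_cycle x \<or> three_cycle (cmp t12 x) \<or> four_cycle (cmp t12 x)"
  "set C3l = {pid, cyc3, cmp cyc3 cyc3}"
  "set C4l = {pid, cyc4, cmp cyc4 cyc4, cmp cyc4 (cmp cyc4 cyc4)}"
  "set V4l = {pid, v12, v13, cmp v12 v13}"
  "set W4l = {pid, t12, t34, cmp t12 t34}"
  "set S4l = set all_pm"
  by code_simp+

text \<open>If the fourth point is fixed, \<open>U\<close> lies between C3 and S3. Otherwise
  multiplication by C3 on both sides turns an element moving that point into \<open>t34\<close> or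
  \<open>v12\<close>; either way \<open>v12\<close> lies in \<open>U\<close>, which forces
  A4.\<close>

lemma contains_cyc3:
  assumes U: "closed_pm U" and c: "cyc3 \<in> U"
  shows "U \<in> {set S3l, set C3l, set A4l, set S4l}"
proof -
  have sub: "U \<subseteq> set all_pm" and mult: "\<And>p q. p \<in> U \<Longrightarrow> q \<in> U \<Longrightarrow> cmp p q \<in> U" and one: "pid \<in> U"
    using U by (auto simp: closed_pm_def)
  have C3: "set C3l \<subseteq> U"
    unfolding classify_checks(10) using c one mult[OF c c] by blast
  show ?thesis
  proof (cases "\<forall>x\<in>U. ap x P4 = P4")
    case True
    then have "U \<subseteq> set S3l" using classify_checks(4) sub by blast
    then show ?thesis using subset_or_all[OF U C3 _ classify_checks(1)] by blast
  next
    case False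
    then obtain x where x: "x \<in> U" "ap x P4 \<noteq> P4" by blast
    then have "\<exists>i\<in>set C3l. \<exists>j\<in>set C3l. cmp i (cmp x j) \<in> set [t34, v12]"
      using bspec[OF classify_checks(5), of x] sub by blast
    then obtain i j where ij: "i \<in> U" "j \<in> U" "cmp i (cmp x j) \<in> set [t34, v12]"
      using C3 by blast
    then obtain y where y: "y \<in> U" "y = t34 \<or> y = v12"
      using mult[OF ij(1) mult[OF x(1) ij(2)]] by auto
    have "v12 \<in> U"
      using y(2)
    proof
      assume "y = t34"
      then have "t34 \<in> U" using y(1) by simp
      then show ?thesis using classify_checks(6) mult C3 by (metis subsetD)
    qed (use y(1) in simp)
    then have "set A4l \<subseteq> U" using classify_checks(7) mult C3 by (metis subsetD subsetI)
    then show ?thesis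
      using subset_or_all[OF U _ sub classify_checks(2)] classify_checks(14) by blast
  qed
qed

text \<open>An element outside the dihedral group becomes a 3-cycle after multiplication by a
  suitable power of \<open>cyc4\<close>, so \<open>U\<close> lies between C4 and D4.\<close>

lemma contains_cyc4:
  assumes U: "closed_pm U" and c: "cyc4 \<in> U" and no3: "\<And>x. x \<in> U \<Longrightarrow> \<not> three_cycle x"
  shows "U \<in> {set C4l, set D4l}"
proof -
  have sub: "U \<subseteq> set all_pm" and mult: "\<And>p q. p \<in> U \<Longrightarrow> q \<in> U \<Longrightarrow> cmp p q \<in> U" and one: "pid \<in> U"
    using U by (auto simp: closed_pm_def)
  have C4: "set C4l \<subseteq> U"
    unfolding classify_checks(11) using c one mult[OF c c] mult[OF c mult[OF c c]] by blast
  have "U \<subseteq> set D4l"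
  proof
    fix x assume x: "x \<in> U"
    show "x \<in> set D4l"
      using bspec[OF classify_checks(8), of x] x sub no3[OF x] no3[OF mult[OF c x]]
        no3[OF mult[OF mult[OF c c] x]] by blast
  qed
  then show ?thesis using subset_or_all[OF U C4 _ classify_checks(3)] by blast
qed

text \<open>Three elements of a Klein group include two of its involutions; their product is the
  third, and a square gives the identity.\<close>

lemma four_element_subset:
  assumes U: "U \<subseteq> {e, b, c, d}" "card U \<ge> 3"
    and mult: "\<And>p q. p \<in> U \<Longrightarrow> q \<in> U \<Longrightarrow> cmp p q \<in> U"
    and m: "e = cmp b b" "cmp b c = d" "cmp c d = b" "cmp b d = c"
  shows "U = {e, b, c, d}"
proof -
  have fin: "card {e, u} < 3" for u by (cases "e = u") auto
  have two: "\<not> U \<subseteq> {e, u}" for u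
    using card_mono[of "{e, u}" U] U(2) fin[of u] by fastforce
  have "b \<in> U \<and> c \<in> U \<or> c \<in> U \<and> d \<in> U \<or> b \<in> U \<and> d \<in> U"
    using two[of b] two[of c] two[of d] U(1) by blast
  then have "b \<in> U" "c \<in> U" "d \<in> U" using mult m by metis+
  then show ?thesis using mult[of b b] m(1) U(1) by blast
qed

text \<open>A closed set is a subgroup since S4 is finite. The cases are ordered by the strongest
  cycle present: a 3-cycle, then a 4-cycle, then a transposition, and finally only elements of the
  normal Klein group. The bound on the cardinality excludes the groups of order one and two.\<close>

theorem classify_subgroups:
  assumes U: "closed_pm U" and card: "card U \<ge> 3"
  shows "\<exists>s\<in>set all_pm. cj s ` U \<in> {set S4l, set A4l, set D4l, set C4l, set V4l, set W4l, set S3l, set C3l}"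
proof -
  have sub: "U \<subseteq> set all_pm" using U by (simp add: closed_pm_def)
  have pid: "pid \<in> set all_pm" using sub U by (auto simp: closed_pm_def)
  consider (three) x where "x \<in> U" "three_cycle x"
    | (four) x where "x \<in> U" "four_cycle x" "\<forall>x\<in>U. \<not> three_cycle x"
    | (two) x where "x \<in> U" "x \<notin> set V4l" "\<forall>x\<in>U. \<not> three_cycle x" "\<forall>x\<in>U. \<not> four_cycle x"
    | (klein) "U \<subseteq> set V4l" by blast
  then show ?thesis
  proof cases
    case three
    then obtain s where s: "s \<in> set all_pm" "cj s x = cyc3"
      using conjugate_to_standard(1) sub by blast
    then have "cyc3 \<in> cj s ` U" using three(1) by (metis imageI)
    from contains_cyc3[OF closed_cj[OF U s(1)] this] show ?thesis using s(1) by blast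
  next
    case four
    then obtain s where s: "s \<in> set all_pm" "cj s x = cyc4"
      using conjugate_to_standard(2) sub by blast
    then have c: "cyc4 \<in> cj s ` U" using four(1) by (metis imageI)
    have "\<not> three_cycle y" if "y \<in> cj s ` U" for y
      using that four(3) sub three_cycle_cj[OF s(1)] by blast
    from contains_cyc4[OF closed_cj[OF U s(1)] c this] show ?thesis using s(1) by blast
  next
    case two
    then obtain s where s: "s \<in> set all_pm" "cj s x = t12"
      using conjugate_to_standard(3) sub by blast
    let ?Y = "cj s ` U"
    have Y: "closed_pm ?Y" by (rule closed_cj[OF U s(1)])
    have t: "t12 \<in> ?Y" using two(1) s(2) by (metis imageI)
    have no: "\<not> three_cycle y" "\<not> four_cycle y" if "y \<in> ?Y" for y
      using that two(3,4) sub three_cycle_cj[OF s(1)] four_cycle_cj[OF s(1)] by blast+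
    have mult: "cmp p q \<in> ?Y" if "p \<in> ?Y" "q \<in> ?Y" for p q using Y that by (auto simp: closed_pm_def)
    have "?Y \<subseteq> set W4l"
    proof
      fix y assume y: "y \<in> ?Y"
      show "y \<in> set W4l"
        using bspec[OF classify_checks(9), of y] Y y no[OF y] no[OF mult[OF t y]]
        unfolding closed_pm_def by blast
    qed
    then have "?Y = set W4l"
      unfolding classify_checks(13)
      using mult card card_cj[OF sub s(1)] by (intro four_element_subset) simp_all
    then show ?thesis using s(1) by blast
  next
    case klein
    then have V: "U = set V4l"
      unfolding classify_checks(12)
      using U card by (intro four_element_subset) (simp_all add: closed_pm_def)
    \<comment> \<open>A normal subgroup is its only conjugate, so the identity serves as
      conjugator.\<close>
    have "cj pid x = x" for x
      using pinv_simps(2)[OF pid] by (simp only: cj_def cmp_pid)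
    then have "cj pid ` U = set V4l" using V by simp
    then show ?thesis using pid by blast
  qed
qed

section \<open>Homomorphisms given by the images of generators\<close>

definition word_graph :: "pm list \<Rightarrow> pm list \<Rightarrow> nat list list \<Rightarrow> (pm \<times> pm) list" where
  "word_graph us gs ws = map (\<lambda>w. (evalw us w, evalw gs w)) ws"

text \<open>All tuples in \<open>tgt\<close> that satisfy the relators: a superset of the generator
  images of genuine homomorphisms.\<close>

definition images :: "pm list \<Rightarrow> pm list \<Rightarrow> nat list list \<Rightarrow> pm list list" where
  "images tgt gs rels = filter (\<lambda>us. list_all (\<lambda>r. evalw us r = pid) rels) (List.n_lists (length gs) tgt)"

definition presented :: "pm list \<Rightarrow> nat list list \<Rightarrow> nat list list \<Rightarrow> bool" where
  "presented gs ws rels \<longleftrightarrow> list_all (list_all (\<lambda>i. i < length gs)) (ws @ rels) \<and>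
     list_all (\<lambda>r. evalw gs r = pid) rels \<and> list_all (\<lambda>g. g \<in> set (elts gs ws)) gs"

text \<open>A homomorphism is determined by the images of the generators, which satisfy the relators.\<close>

lemma graph_of_hom:
  assumes one: "(pid, pid) \<in> Q"
    and mult: "\<And>p q p' q'. (p, q) \<in> Q \<Longrightarrow> (p', q') \<in> Q \<Longrightarrow> (cmp p p', cmp q q') \<in> Q"
    and func: "\<And>p p' q. (p, q) \<in> Q \<Longrightarrow> (p', q) \<in> Q \<Longrightarrow> p = p'"
    and dom: "snd ` Q = set (elts gs ws)" and ran: "fst ` Q \<subseteq> set tgt"
    and pres: "presented gs ws rels"
  shows "\<exists>us\<in>set (images tgt gs rels). Q = set (word_graph us gs ws)"
proof -
  have "\<exists>u. (u, gs ! i) \<in> Q" if "i < length gs" for i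
  proof -
    have "gs ! i \<in> snd ` Q"
      unfolding dom using pres that by (simp add: presented_def list_all_length)
    then show ?thesis by force
  qed
  then obtain f where f: "\<And>i. i < length gs \<Longrightarrow> (f i, gs ! i) \<in> Q" by metis
  define us where "us = map f [0..<length gs]"
  have us: "(us ! i, gs ! i) \<in> Q" if "i < length gs" for i
    using f that by (simp add: us_def)
  have word: "(evalw us w, evalw gs w) \<in> Q" if "list_all (\<lambda>i. i < length gs) w" for w
    using that by (induction w) (auto intro: one mult us simp del: cmp.simps)
  have "set us \<subseteq> set tgt"
    using us ran by (force simp: in_set_conv_nth us_def)
  then have "us \<in> set (List.n_lists (length gs) tgt)"
    by (simp add: set_n_lists us_def)
  \<comment> \<open>A relator evaluates to the identity in the second component, and
    \<open>func\<close> leaves only the identity as its partner.\<close>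
  moreover have "evalw us r = pid" if "r \<in> set rels" for r
  proof -
    have "(evalw us r, pid) \<in> Q"
      using word[of r] pres that by (auto simp: presented_def list_all_iff)
    then show ?thesis using func one by blast
  qed
  ultimately have "us \<in> set (images tgt gs rels)"
    by (simp add: images_def list_all_iff)
  moreover have "Q = set (word_graph us gs ws)"
  proof (rule subset_antisym)
    show "set (word_graph us gs ws) \<subseteq> Q"
      using word pres by (auto simp: word_graph_def presented_def list_all_iff)
    show "Q \<subseteq> set (word_graph us gs ws)"
    proof
      fix x assume x: "x \<in> Q"
      obtain p q where pq: "x = (p, q)" by (cases x)
      have "q \<in> set (elts gs ws)" using x pq dom by force
      then obtain w where w: "w \<in> set ws" "q = evalw gs w" by (auto simp: elts_def)
      then have "(evalw us w, q) \<in> Q" using word[of w] pres by (auto simp: presented_def list_all_iff)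
      then have "p = evalw us w" using func x pq by blast
      then show "x \<in> set (word_graph us gs ws)" using w pq by (auto simp: word_graph_def)
    qed
  qed
  ultimately show ?thesis by blast
qed

section \<open>Goursat's lemma with first group S3 or C3\<close>

definition kernel_list :: "(pm \<times> pm) list \<Rightarrow> pm list" where
  "kernel_list gl = map snd (filter (\<lambda>x. fst x = pid) gl)"

text \<open>The fibre product of S3 and \<open>G\<close> over a quotient of order two: the sign on
  one side, the character with kernel \<open>K\<close> on the other.\<close>

definition sign_fibre :: "pm list \<Rightarrow> pm list \<Rightarrow> (pm \<times> pm) list" where
  "sign_fibre G K = filter (\<lambda>(p, q). p \<in> set A4l \<longleftrightarrow> q \<in> set K) (List.product S3l G)"

text \<open>The sign takes values in the permutations \<open>pid\<close> and \<open>t12\<close>, so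
  that characters of order two are covered by the same search through generator images.\<close>

definition par :: "pm \<Rightarrow> pm" where
  "par p = (if p \<in> set A4l then pid else t12)"

text \<open>The fifth item drives the normality argument below: a transposition of S3 times its
  conjugate by \<open>cyc3\<close> is a nontrivial 3-cycle.\<close>

lemma fibre_checks:
  "\<forall>p\<in>set S3l. \<forall>p'\<in>set S3l. par (cmp p p') = cmp (par p) (par p')"
  "\<forall>p\<in>set S3l. \<forall>p'\<in>set S3l. cmp p (pinv p') \<in> set A4l \<longleftrightarrow> par p = par p'"
  "\<forall>p\<in>set S3l. \<forall>p'\<in>set S3l. cmp p (pinv p') \<in> set S3l"
  "\<forall>p\<in>set S3l. p \<in> set A4l \<longleftrightarrow> p \<in> set C3l"
  "\<forall>p\<in>set S3l. p \<notin> set C3l \<longrightarrow> cmp (cmp cyc3 (cmp p (pinv cyc3))) p \<in> set C3l - {pid}"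
  "\<forall>p\<in>set C3l. p \<noteq> pid \<longrightarrow> p = cyc3 \<or> cmp p p = cyc3"
  "\<forall>p\<in>set C3l. p \<in> set S3l"
  "cyc3 \<in> set C3l" "pid \<in> set A4l" "t12 \<in> set S3l" "t12 \<notin> set A4l"
  "\<forall>p\<in>set C3l. \<forall>p'\<in>set C3l. cmp p (pinv p') \<in> set C3l"
  "\<forall>p\<in>set S3l. cmp p (pinv p) = pid \<and> cmp (pinv p) p = pid"
  by code_simp+

context pm_subgroup
begin

lemma all_mem: "(p, q) \<in> H \<Longrightarrow> p \<in> set all_pm \<and> q \<in> set all_pm"
  using sub by auto

text \<open>Together with \<open>translate_mem\<close>: the first components above a fixed
  \<open>q\<close> form a coset of the kernel of the second projection.\<close>

lemma quotient_mem:
  assumes "(p, q) \<in> H" "(p', q) \<in> H"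
  shows "(cmp p (pinv p'), pid) \<in> H"
  using mult[OF assms(1) inv[OF assms(2)]] all_mem[OF assms(1)] by (simp only: pinv_simps)

lemma translate_mem:
  assumes "(p', q) \<in> H" "(cmp p (pinv p'), pid) \<in> H"
  shows "(p, q) \<in> H"
proof -
  have "(cmp (cmp p (pinv p')) p', cmp pid q) \<in> H" by (rule mult[OF assms(2,1)])
  moreover have "cmp (cmp p (pinv p')) p' = p"
    using all_mem[OF assms(1)] by (simp only: cmp_assoc pinv_simps cmp_pid)
  ultimately show ?thesis by (simp only: cmp_pid)
qed

text \<open>Each fibre of the second projection is a coset of the kernel; when the kernel is all of
  the first group, every fibre is full.\<close>

lemma full_if_kernel:
  assumes "fst ` H = set G1" "snd ` H = set G2" "\<And>p. p \<in> set G1 \<Longrightarrow> (p, pid) \<in> H"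
    and "\<And>p p'. p \<in> set G1 \<Longrightarrow> p' \<in> set G1 \<Longrightarrow> cmp p (pinv p') \<in> set G1"
  shows "H = set (List.product G1 G2)"
proof (rule subset_antisym)
  show "H \<subseteq> set (List.product G1 G2)"
    using assms(1,2) by (force simp flip: assms)
  show "set (List.product G1 G2) \<subseteq> H"
  proof
    fix x assume "x \<in> set (List.product G1 G2)"
    then obtain p q where x: "x = (p, q)" "p \<in> set G1" "q \<in> set G2" by auto
    then obtain p' where p': "(p', q) \<in> H" using assms(2) by force
    then have "p' \<in> set G1" using assms(1) by force
    then show "x \<in> H" using translate_mem[OF p'] assms(3,4) x by blast
  qed
qed

lemma C3_kernel:
  assumes "(cyc3, pid) \<in> H" "p \<in> set C3l"
  shows "(p, pid) \<in> H"
proof -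
  have "p \<in> {pid, cyc3, cmp cyc3 cyc3}" using assms(2) unfolding classify_checks(10) .
  then show ?thesis using one assms(1) mult[OF assms(1) assms(1)] by (auto simp only: cmp_pid)
qed

lemma functional:
  assumes "fst ` H \<subseteq> set S3l" "\<And>p. (p, pid) \<in> H \<Longrightarrow> p = pid" "(p, q) \<in> H" "(p', q) \<in> H"
  shows "p = p'"
proof -
  have "cmp p (pinv p') = pid" by (rule assms(2)[OF quotient_mem[OF assms(3,4)]])
  then have "cmp (cmp p (pinv p')) p' = p'" by (simp only: cmp_pid)
  then show ?thesis using all_mem[OF assms(4)] by (simp only: cmp_assoc pinv_simps cmp_pid)
qed

text \<open>A group of prime order has no proper nontrivial subgroup: the kernel is everything,
  giving the product, or trivial, giving a graph over the second group.\<close>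

lemma C3_cases:
  assumes F: "fst ` H = set C3l" and S: "snd ` H = set (elts gs ws)" and pres: "presented gs ws rels"
  shows "H = set (List.product C3l (elts gs ws)) \<or>
    (\<exists>us\<in>set (images C3l gs rels). H = set (word_graph us gs ws))"
proof (cases "(cyc3, pid) \<in> H")
  case True
  have "H = set (List.product C3l (elts gs ws))"
    by (rule full_if_kernel[OF F S C3_kernel[OF True]]) (use fibre_checks(12) in blast)+
  then show ?thesis ..
next
  case False
  have triv: "p = pid" if p: "(p, pid) \<in> H" for p
  proof (rule ccontr)
    assume "p \<noteq> pid"
    moreover have "p \<in> set C3l" using p F by force
    ultimately have "p = cyc3 \<or> cmp p p = cyc3" using fibre_checks(6) by blast
    then show False using False p mult[OF p p] by (auto simp only: cmp_pid)
  qed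
  have sub3: "fst ` H \<subseteq> set S3l" using F fibre_checks(7) by blast
  have "\<exists>us\<in>set (images C3l gs rels). H = set (word_graph us gs ws)"
  proof (rule graph_of_hom[OF one _ _ S _ pres])
    show "(cmp p p', cmp q q') \<in> H" if "(p, q) \<in> H" "(p', q') \<in> H" for p q p' q'
      by (rule mult[OF that])
    show "p = p'" if "(p, q) \<in> H" "(p', q) \<in> H" for p p' q
      by (rule functional[OF sub3 triv that])
    show "fst ` H \<subseteq> set C3l" using F by simp
  qed
  then show ?thesis by blast
qed

text \<open>The kernel of the second projection is normal in S3, hence S3, C3 or trivial. These give
  the product, the fibre over the sign and the graph, respectively.\<close>

lemma S3_cases:
  assumes F: "fst ` H = set S3l" and S: "snd ` H = set (elts gs ws)" and pres: "presented gs ws rels"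
  shows "H = set (List.product S3l (elts gs ws)) \<or>
    (\<exists>us\<in>set (images [pid, t12] gs rels). let K = kernel_list (word_graph us gs ws) in
        H = set (sign_fibre (elts gs ws) K) \<and> \<not> set (elts gs ws) \<subseteq> set K) \<or>
    (\<exists>us\<in>set (images S3l gs rels). H = set (word_graph us gs ws))"
proof -
  have F': "p \<in> set S3l" if "(p, q) \<in> H" for p q using that F by force
  consider (full) p where "(cyc3, pid) \<in> H" "(p, pid) \<in> H" "p \<notin> set C3l"
    | (sign) "(cyc3, pid) \<in> H" "\<And>p. (p, pid) \<in> H \<Longrightarrow> p \<in> set C3l"
    | (graph) "(cyc3, pid) \<notin> H" by blast
  then show ?thesis
  proof cases
    case full
    have "(y, pid) \<in> H" if y: "y \<in> set S3l" for y
    proof -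
      obtain z where z: "z \<in> set C3l" "y = z \<or> y = cmp z p"
        using classify_checks(1) F'[OF full(2)] full(3) y by blast
      have "(z, pid) \<in> H" by (rule C3_kernel[OF full(1) z(1)])
      from this mult[OF this full(2)] show ?thesis using z(2) by (auto simp only: cmp_pid)
    qed
    from full_if_kernel[OF F S this] show ?thesis using fibre_checks(3) by blast
  next
    case sign
    \<comment> \<open>The kernel consists of even elements, so the sign of the first component
      depends on the second alone: \<open>Q\<close> is the graph of a character of the second
      group.\<close>
    define Q where "Q = (\<lambda>(p, q). (par p, q)) ` H"
    have QI: "(par p, q) \<in> Q" if "(p, q) \<in> H" for p q using that by (force simp: Q_def)
    have QE: "\<exists>p. x = par p \<and> (p, q) \<in> H" if "(x, q) \<in> Q" for x q using that by (auto simp: Q_def)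
    have par_pid: "par pid = pid" using fibre_checks(9) by (simp add: par_def)
    have func: "x = x'" if xx: "(x, q) \<in> Q" "(x', q) \<in> Q" for x x' q
    proof -
      obtain p p' where p: "x = par p" "(p, q) \<in> H" "x' = par p'" "(p', q) \<in> H"
        using QE[OF xx(1)] QE[OF xx(2)] by blast
      have "cmp p (pinv p') \<in> set C3l" by (rule sign(2)[OF quotient_mem[OF p(2,4)]])
      then have "cmp p (pinv p') \<in> set A4l" using fibre_checks(4,7) by blast
      then show ?thesis using fibre_checks(2) F'[OF p(2)] F'[OF p(4)] p(1,3) by blast
    qed
    have Qmult: "(cmp x x', cmp q q') \<in> Q" if xx: "(x, q) \<in> Q" "(x', q') \<in> Q" for x x' q q'
    proof -
      obtain p p' where p: "x = par p" "(p, q) \<in> H" "x' = par p'" "(p', q') \<in> H"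
        using QE[OF xx(1)] QE[OF xx(2)] by blast
      have "par (cmp p p') = cmp x x'" using fibre_checks(1) F'[OF p(2)] F'[OF p(4)] p(1,3) by blast
      then show ?thesis using QI[OF mult[OF p(2,4)]] by simp
    qed
    have "snd ` Q = set (elts gs ws)" unfolding S[symmetric] Q_def by force
    moreover have "fst ` Q \<subseteq> set [pid, t12]" by (auto simp: Q_def par_def)
    moreover have "(pid, pid) \<in> Q" using QI[OF one] par_pid by simp
    ultimately have "\<exists>us\<in>set (images [pid, t12] gs rels). Q = set (word_graph us gs ws)"
    proof (intro graph_of_hom[OF _ _ _ _ _ pres])
      show "(cmp p p', cmp q q') \<in> Q" if "(p, q) \<in> Q" "(p', q') \<in> Q" for p q p' q'
        by (rule Qmult[OF that])
      show "p = p'" if "(p, q) \<in> Q" "(p', q) \<in> Q" for p p' q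
        by (rule func[OF that])
    qed
    then obtain us where us: "us \<in> set (images [pid, t12] gs rels)" "Q = set (word_graph us gs ws)"
      by blast
    define K where "K = kernel_list (word_graph us gs ws)"
    have K: "q \<in> set K \<longleftrightarrow> (pid, q) \<in> Q" for q
      unfolding us(2) K_def kernel_list_def by force
    have parity: "p \<in> set A4l \<longleftrightarrow> q \<in> set K" if pq: "(p, q) \<in> H" for p q
    proof
      assume "p \<in> set A4l"
      then show "q \<in> set K" using QI[OF pq] by (simp add: K par_def)
    next
      assume "q \<in> set K"
      then have "par p = pid" using func QI[OF pq] K by blast
      then show "p \<in> set A4l" by (auto simp: par_def split: if_splits)
    qed
    have "H = set (sign_fibre (elts gs ws) K)"
    proof (rule subset_antisym)
      show "H \<subseteq> set (sign_fibre (elts gs ws) K)"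
      proof
        fix x assume x: "x \<in> H"
        obtain p q where pq: "x = (p, q)" by (cases x)
        have "q \<in> set (elts gs ws)" unfolding S[symmetric] using x pq by force
        then show "x \<in> set (sign_fibre (elts gs ws) K)"
          using parity[of p q] F'[of p q] x pq by (simp add: sign_fibre_def)
      qed
      show "set (sign_fibre (elts gs ws) K) \<subseteq> H"
      proof
        fix x assume "x \<in> set (sign_fibre (elts gs ws) K)"
        then obtain p q where x: "x = (p, q)" "p \<in> set S3l" "q \<in> set (elts gs ws)" "p \<in> set A4l \<longleftrightarrow> q \<in> set K"
          by (auto simp: sign_fibre_def)
        obtain p' where p': "(p', q) \<in> H" using x(3) unfolding S[symmetric] by force
        have "par p = par p'" using x(4) parity[OF p'] by (simp add: par_def)
        then have "cmp p (pinv p') \<in> set A4l" using fibre_checks(2) x(2) F'[OF p'] by blast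
        moreover have "cmp p (pinv p') \<in> set S3l" using fibre_checks(3) x(2) F'[OF p'] by blast
        ultimately have "cmp p (pinv p') \<in> set C3l" using fibre_checks(4) by blast
        then show "x \<in> H" using translate_mem[OF p' C3_kernel[OF sign(1)]] x(1) by blast
      qed
    qed
    \<comment> \<open>The character is not trivial because S3 contains the odd element
      \<open>t12\<close>.\<close>
    moreover have "\<not> set (elts gs ws) \<subseteq> set K"
    proof
      assume sub: "set (elts gs ws) \<subseteq> set K"
      obtain q where q: "(t12, q) \<in> H" using F fibre_checks(10) by force
      then have "q \<in> set (elts gs ws)" unfolding S[symmetric] by force
      then show False using parity[OF q] sub fibre_checks(11) by blast
    qed
    ultimately show ?thesis using us(1) unfolding K_def Let_def by blast
  next
    case graph
    have triv: "p = pid" if p: "(p, pid) \<in> H" for p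
    proof (rule ccontr)
      assume "p \<noteq> pid"
      have no: "r \<notin> set C3l - {pid}" if r: "(r, pid) \<in> H" for r
      proof
        assume "r \<in> set C3l - {pid}"
        then have "r = cyc3 \<or> cmp r r = cyc3" using fibre_checks(6) by blast
        then show False using graph r mult[OF r r] by (auto simp only: cmp_pid)
      qed
      \<comment> \<open>Lifting \<open>cyc3\<close> conjugates \<open>p\<close> inside the kernel.
        An odd \<open>p\<close> times its conjugate would be a nontrivial 3-cycle in the kernel,
        which then would contain \<open>cyc3\<close>.\<close>
      obtain q where q: "(cyc3, q) \<in> H" using F fibre_checks(7,8) by force
      have "(cmp (cmp cyc3 (cmp p (pinv cyc3))) p, cmp (cmp q (cmp pid (pinv q))) pid) \<in> H"
        by (rule mult[OF mult[OF q mult[OF p inv[OF q]]] p])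
      then have "(cmp (cmp cyc3 (cmp p (pinv cyc3))) p, pid) \<in> H"
        using all_mem[OF q] by (simp only: cmp_pid pinv_simps)
      from no[OF this] have "p \<in> set C3l" using fibre_checks(5) F'[OF p] by blast
      then show False using no[OF p] \<open>p \<noteq> pid\<close> by blast
    qed
    have sub3: "fst ` H \<subseteq> set S3l" using F by blast
    have "\<exists>us\<in>set (images S3l gs rels). H = set (word_graph us gs ws)"
    proof (rule graph_of_hom[OF one _ _ S _ pres])
      show "(cmp p p', cmp q q') \<in> H" if "(p, q) \<in> H" "(p', q') \<in> H" for p q p' q'
        by (rule mult[OF that])
      show "p = p'" if "(p, q) \<in> H" "(p', q) \<in> H" for p p' q
        by (rule functional[OF sub3 triv that])
      show "fst ` H \<subseteq> set S3l" using F by simp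
    qed
    then show ?thesis by blast
  qed
qed

end

section \<open>Finite checks and isomorphisms\<close>

definition "S4r = [[0,0],[1,1],[2,2],[0,1,0,1,0,1],[1,2,1,2,1,2],[0,2,0,2::nat]]"
definition "A4r = [[0,0],[1,1],[2,2,2],[2,0,2,0,2,0],[2,1,2,1,2,1::nat]]"
definition "D4r = [[0,0,0,0],[1,1],[0,1,0,1::nat]]"
definition "C4r = [[0,0,0,0::nat]]"
definition "V4r = [[0,0],[1,1],[0,1,0,1::nat]]"
definition "S3r = [[0,0],[1,1],[0,1,0,1,0,1::nat]]"
definition "C3r = [[0,0,0::nat]]"

lemma presented:
  "presented S4g S4w S4r" "presented A4g A4w A4r" "presented D4g D4w D4r" "presented C4g C4w C4r"
  "presented V4g V4w V4r" "presented W4g V4w V4r" "presented S3g S3w S3r" "presented C3g C3w C3r"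
  by code_simp+

definition "t24 = Pm P1 P4 P3 P2"
definition "v14 = Pm P4 P3 P2 P1"

text \<open>The subgroups of index two of the standard groups which are not themselves standard.\<close>

definition "D4k = [pid, t13, t24, v13]"
definition "C4k = [pid, v13]"

text \<open>The relators listed above are only those needed to rule out or determine the homomorphisms
  onto \<open>S3l\<close>, \<open>C3l\<close> and \<open>{pid, t12}\<close>; they need not present the group.\<close>

definition "no_map T gs ws rels \<longleftrightarrow>
  list_all (\<lambda>us. \<not> list_all (\<lambda>p. p \<in> set (map fst (word_graph us gs ws))) T) (images T gs rels)"

lemma no_map_checks:
  "no_map S3l A4g A4w A4r" "no_map S3l D4g D4w D4r" "no_map S3l C4g C4w C4r"
  "no_map S3l V4g V4w V4r" "no_map S3l W4g V4w V4r" "no_map S3l C3g C3w C3r"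
  "no_map C3l S4g S4w S4r" "no_map C3l D4g D4w D4r" "no_map C3l C4g C4w C4r"
  "no_map C3l V4g V4w V4r" "no_map C3l W4g V4w V4r" "no_map C3l S3g S3w S3r"
  by code_simp+

text \<open>The first alternative discards maps that are not onto. The flag \<open>nontriv\<close>
  says whether the homomorphism has a nontrivial kernel, that is, whether the inclusion of fields is
  strict. Sorting removes the dependence on the order in which orbits are met.\<close>

definition "graph_check T gs ws rels ds nontriv \<longleftrightarrow>
  list_all (\<lambda>us. let gl = word_graph us gs ws in
     \<not> list_all (\<lambda>p. p \<in> set (map fst gl)) T \<or>
     (sort (dt gl) = ds \<and> list_all (\<lambda>x. snd x = pid \<longrightarrow> fst x = pid) gl \<and>
      (if nontriv then list_ex (\<lambda>x. fst x = pid \<and> snd x \<noteq> pid) gl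
       else list_all (\<lambda>x. fst x = pid \<longrightarrow> snd x = pid) gl))) (images T gs rels)"

lemma graph_checks:
  "graph_check S3l S4g S4w S4r [4, 8, 12] True"
  "graph_check S3l S3g S3w S3r [1, 2, 3, 3, 3, 6, 6] False"
  "graph_check C3l A4g A4w A4r [4, 4, 4, 12] True"
  "graph_check C3l C3g C3w C3r [1, 1, 1, 3, 3, 3, 3, 3, 3, 3] False"
  by code_simp+

text \<open>The first alternative is the trivial character, excluded later. Kernels are compared as
  sets, since \<open>sign_fibre\<close> depends on them through membership only.\<close>

definition "kernels_check gs ws rels Ks \<longleftrightarrow>
  list_all (\<lambda>us. let K = kernel_list (word_graph us gs ws) in
     list_all (\<lambda>q. q \<in> set K) (elts gs ws) \<or>
     list_ex (\<lambda>K'. list_all (\<lambda>q. q \<in> set K) K' \<and> list_all (\<lambda>q. q \<in> set K') K) Ks) (images [pid, t12] gs rels)"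

lemma kernels_checks:
  "kernels_check S4g S4w S4r [A4l]" "kernels_check A4g A4w A4r []"
  "kernels_check D4g D4w D4r [C4l, V4l, D4k]" "kernels_check C4g C4w C4r [C4k]"
  "kernels_check V4g V4w V4r [[pid, v12], [pid, v13], [pid, v14]]"
  "kernels_check W4g V4w V4r [[pid, t12], [pid, t34], [pid, v12]]"
  "kernels_check S3g S3w S3r [C3l]" "kernels_check C3g C3w C3r []"
  by code_simp+

text \<open>For a full product with \<open>S3l\<close> the orbits correspond to those of the second
  group on the four points, with six times their size: 24 for a transitive group, 12 and 12 for
  \<open>W4l\<close>, 18 and 6 when one point is fixed.\<close>

lemma product_types:
  "sort (dt (List.product S3l S4l)) = [24]" "sort (dt (List.product S3l A4l)) = [24]"
  "sort (dt (List.product S3l D4l)) = [24]" "sort (dt (List.product S3l C4l)) = [24]"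
  "sort (dt (List.product S3l V4l)) = [24]" "sort (dt (List.product S3l W4l)) = [12, 12]"
  "sort (dt (List.product S3l S3l)) = [6, 18]" "sort (dt (List.product S3l C3l)) = [6, 18]"
  "sort (dt (List.product C3l S4l)) = [24]" "sort (dt (List.product C3l A4l)) = [12, 12]"
  "sort (dt (List.product C3l D4l)) = [24]" "sort (dt (List.product C3l C4l)) = [12, 12]"
  "sort (dt (List.product C3l V4l)) = [12, 12]" "sort (dt (List.product C3l W4l)) = [12, 12]"
  "sort (dt (List.product C3l S3l)) = [6, 18]" "sort (dt (List.product C3l C3l)) = [3, 3, 9, 9]"
  by code_simp+

lemma fibre_types:
  "sort (dt (sign_fibre S4l A4l)) = [12, 12]"
  "sort (dt (sign_fibre D4l C4l)) = [12, 12]" "sort (dt (sign_fibre D4l V4l)) = [12, 12]"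
  "sort (dt (sign_fibre D4l D4k)) = [24]" "sort (dt (sign_fibre C4l C4k)) = [12, 12]"
  "sort (dt (sign_fibre V4l [pid, v12])) = [12, 12]" "sort (dt (sign_fibre V4l [pid, v13])) = [12, 12]"
  "sort (dt (sign_fibre V4l [pid, v14])) = [12, 12]" "sort (dt (sign_fibre W4l [pid, t12])) = [6, 6, 12]"
  "sort (dt (sign_fibre W4l [pid, t34])) = [6, 6, 12]" "sort (dt (sign_fibre W4l [pid, v12])) = [6, 6, 6, 6]"
  "sort (dt (sign_fibre S3l C3l)) = [3, 3, 9, 9]"
  by code_simp+

section \<open>Isomorphisms with the named groups\<close>

definition cmp2 :: "pm \<times> pm \<Rightarrow> pm \<times> pm \<Rightarrow> pm \<times> pm" where
  "cmp2 = (\<lambda>(a, b) (c, d). (cmp a c, cmp b d))"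

abbreviation "perms_of L \<equiv> (Sym 4)\<lparr>carrier := perm4 ` set L\<rparr>"
abbreviation "pairs_of hl \<equiv> (Sym 4 \<times>\<times> Sym 4)\<lparr>carrier := perm2 ` set hl\<rparr>"

text \<open>Maps are easiest to give from the named group into permutations, while the isomorphisms
  are wanted in the opposite direction.\<close>

lemma iso_reverse:
  fixes T :: "('x, 'y) monoid_scheme" and \<Gamma> :: "('g, 'h) monoid_scheme"
  assumes closed: "\<And>x y. x \<in> carrier T \<Longrightarrow> y \<in> carrier T \<Longrightarrow> x \<otimes>\<^bsub>T\<^esub> y \<in> carrier T"
    and hom: "\<And>x y. x \<in> carrier T \<Longrightarrow> y \<in> carrier T \<Longrightarrow> f (x \<otimes>\<^bsub>T\<^esub> y) = f x \<otimes>\<^bsub>\<Gamma>\<^esub> f y"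
    and inj: "inj_on f (carrier T)" and img: "f ` carrier T = S"
  shows "\<Gamma>\<lparr>carrier := S\<rparr> \<cong> T"
proof (rule is_isoI[of "inv_into (carrier T) f"], unfold iso_def mem_Collect_eq, intro conjI)
  have h: "inv_into (carrier T) f (f x) = x" if "x \<in> carrier T" for x
    using inj that by (rule inv_into_f_f)
  show "inv_into (carrier T) f \<in> hom (\<Gamma>\<lparr>carrier := S\<rparr>) T"
  proof (rule homI)
    fix x assume "x \<in> carrier (\<Gamma>\<lparr>carrier := S\<rparr>)"
    then show "inv_into (carrier T) f x \<in> carrier T" using h img by auto
  next
    fix x y assume "x \<in> carrier (\<Gamma>\<lparr>carrier := S\<rparr>)" "y \<in> carrier (\<Gamma>\<lparr>carrier := S\<rparr>)"
    then obtain u v where uv: "u \<in> carrier T" "v \<in> carrier T" "x = f u" "y = f v" using img by auto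
    have eq: "x \<otimes>\<^bsub>\<Gamma>\<lparr>carrier := S\<rparr>\<^esub> y = f (u \<otimes>\<^bsub>T\<^esub> v)"
      using uv hom by simp
    show "inv_into (carrier T) f (x \<otimes>\<^bsub>\<Gamma>\<lparr>carrier := S\<rparr>\<^esub> y) =
        inv_into (carrier T) f x \<otimes>\<^bsub>T\<^esub> inv_into (carrier T) f y"
      unfolding eq h[OF closed[OF uv(1,2)]] using uv h by simp
  qed
  have "bij_betw f (carrier T) S" using inj img by (simp add: bij_betw_def)
  then show "bij_betw (inv_into (carrier T) f) (carrier (\<Gamma>\<lparr>carrier := S\<rparr>)) (carrier T)"
    by (simp add: bij_betw_inv_into)
qed

text \<open>Separates coding from evaluation: \<open>\<psi>\<close> embeds codes into the ambient
  group, and the remaining hypotheses are checks on finite lists of codes.\<close>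

lemma iso_of_list:
  fixes T :: "('x, 'y) monoid_scheme" and \<Gamma> :: "('g, 'h) monoid_scheme" and \<psi> :: "'p \<Rightarrow> 'g"
  assumes \<psi>: "\<And>x y. \<psi> x = \<psi> y \<longleftrightarrow> x = y" "\<And>x y. \<psi> (m x y) = \<psi> x \<otimes>\<^bsub>\<Gamma>\<^esub> \<psi> y"
    and T: "carrier T = set xs" "\<And>x y. x \<in> set xs \<Longrightarrow> y \<in> set xs \<Longrightarrow> x \<otimes>\<^bsub>T\<^esub> y = mT x y"
    and check: "list_all (\<lambda>x. list_all (\<lambda>y. mT x y \<in> set xs \<and> f (mT x y) = m (f x) (f y)) xs) xs"
      "distinct (map f xs)" "list_all (\<lambda>x. f x \<in> set hl) xs" "list_all (\<lambda>y. y \<in> set (map f xs)) hl"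
  shows "\<Gamma>\<lparr>carrier := \<psi> ` set hl\<rparr> \<cong> T"
proof -
  have hl: "set hl = f ` set xs" using check(3,4) by (auto simp: list_all_iff)
  have inj: "inj_on f (set xs)" using check(2) by (simp add: distinct_map)
  have chk: "mT x y \<in> set xs" "f (mT x y) = m (f x) (f y)" if "x \<in> set xs" "y \<in> set xs" for x y
    using check(1) that by (auto simp: list_all_iff)
  show ?thesis
  proof (rule iso_reverse[where f = "\<lambda>x. \<psi> (f x)"])
    show "inj_on (\<lambda>x. \<psi> (f x)) (carrier T)"
      using inj \<psi>(1) T(1) by (auto simp: inj_on_def)
    show "(\<lambda>x. \<psi> (f x)) ` carrier T = \<psi> ` set hl"
      by (simp add: T(1) hl image_image)
  qed (simp_all add: T chk \<psi>(2)[symmetric])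
qed

lemma perm2_mult: "perm2 (cmp2 x y) = perm2 x \<otimes>\<^bsub>Sym 4 \<times>\<times> Sym 4\<^esub> perm2 y"
  by (cases x; cases y) (simp add: cmp2_def perm2_def perm_cmp sym_group_def DirProd_def)

lemma perm4_mult: "perm4 (cmp x y) = perm4 x \<otimes>\<^bsub>Sym 4\<^esub> perm4 y"
  by (simp add: perm_cmp sym_group_def)

lemmas iso_single = iso_of_list[where \<psi> = perm4 and m = cmp and \<Gamma> = "Sym 4", OF perm_inj perm4_mult]
lemmas iso_pair = iso_of_list[where \<psi> = perm2 and m = cmp2 and \<Gamma> = "Sym 4 \<times>\<times> Sym 4", OF perm2_inj perm2_mult]

text \<open>Exponents are integers because the cyclic groups have integer carriers; only nonnegative
  ones occur.\<close>

definition ppow :: "pm \<Rightarrow> int \<Rightarrow> pm" where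
  "ppow p n = (cmp p ^^ nat n) pid"

definition "mCyc n = (\<lambda>x y. (x + y) mod n :: int)"

lemma Cyc_list:
  assumes "0 < n"
  shows "carrier (Cyc n) = set [0..int n - 1]"
    and "x \<otimes>\<^bsub>Cyc n\<^esub> y = mCyc (int n) x y"
  using assms by (auto simp: carrier_integer_mod_group mCyc_def)

definition "mDih n = (\<lambda>(x, g) (y, h :: int). ((x + (if g = 0 then y else - y)) mod n, (g + h) mod 2 :: int))"

lemma Dih_list:
  assumes "0 < n"
  shows "carrier (Dih n) = set (List.product [0..int n - 1] [0..1])"
    and "x \<in> set (List.product [0..int n - 1] [0..1]) \<Longrightarrow> y \<in> set (List.product [0..int n - 1] [0..1]) \<Longrightarrow>
      x \<otimes>\<^bsub>Dih n\<^esub> y = mDih (int n) x y"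
  using assms
  by (auto simp: Dih_def semidirect_def carrier_integer_mod_group mDih_def mod_simps split: if_splits)

lemma Klein_list:
  "carrier Klein = set (List.product [0..1] [0..1])"
  "x \<otimes>\<^bsub>Klein\<^esub> y = (\<lambda>(a, b) (c, d). (mCyc 2 a c, mCyc 2 b d)) x y"
  by (auto simp: Klein_def DirProd_def carrier_integer_mod_group mCyc_def split: prod.splits)

lemma iso_C3: "perms_of C3l \<cong> Cyc 3"
  by (rule iso_single[where mT = "mCyc 3" and xs = "[0..2]" and f = "ppow cyc3"])
    (use Cyc_list[of 3] in simp, use Cyc_list[of 3] in simp, code_simp+)

lemma iso_C4: "perms_of C4l \<cong> Cyc 4"
  by (rule iso_single[where mT = "mCyc 4" and xs = "[0..3]" and f = "ppow cyc4"])
    (use Cyc_list[of 4] in simp, use Cyc_list[of 4] in simp, code_simp+)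

lemma iso_D4: "perms_of D4l \<cong> Dih 4"
  by (rule iso_single[where mT = "mDih 4" and xs = "List.product [0..3] [0..1]"
        and f = "\<lambda>(x, g). cmp (ppow cyc4 x) (ppow t13 g)"])
    (use Dih_list[of 4] in simp, use Dih_list[of 4] in simp, code_simp+)

lemma iso_V4: "perms_of V4l \<cong> Klein"
  by (rule iso_single[OF Klein_list, where f = "\<lambda>(x, y). cmp (ppow v12 x) (ppow v13 y)"]) code_simp+

lemma iso_W4: "perms_of W4l \<cong> Klein"
  by (rule iso_single[OF Klein_list, where f = "\<lambda>(x, y). cmp (ppow t12 x) (ppow t34 y)"]) code_simp+

text \<open>The Chinese remainder theorem for 3 and 4.\<close>

lemma iso_C12: "pairs_of (List.product C3l C4l) \<cong> Cyc 12"
  by (rule iso_pair[where mT = "mCyc 12" and xs = "[0..11]" and f = "\<lambda>x. (ppow cyc3 x, ppow cyc4 x)"])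
    (use Cyc_list[of 12] in simp, use Cyc_list[of 12] in simp, code_simp+)

text \<open>\<open>(cyc3, cyc4)\<close> is a rotation of order 12, inverted by the reflection
  \<open>(t12, t13)\<close>.\<close>

lemma iso_D12: "pairs_of (sign_fibre D4l C4l) \<cong> Dih 12"
  by (rule iso_pair[where mT = "mDih 12" and xs = "List.product [0..11] [0..1]"
        and f = "\<lambda>(x, g). (cmp (ppow cyc3 x) (ppow t12 g), cmp (ppow cyc4 x) (ppow t13 g))"])
    (use Dih_list[of 12] in simp, use Dih_list[of 12] in simp, code_simp+)

text \<open>The rotation \<open>(cyc3, v)\<close> has order six, where \<open>v\<close> generates
  the kernel; the reflection is \<open>(t12, w)\<close> with \<open>w\<close> outside the
  kernel.\<close>

definition D6_map :: "pm \<Rightarrow> pm \<Rightarrow> int \<times> int \<Rightarrow> pm \<times> pm" where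
  "D6_map v w = (\<lambda>(x, g). (cmp (ppow cyc3 x) (ppow t12 g), cmp (ppow v x) (ppow w g)))"

abbreviation "l6 \<equiv> List.product [0..5] [0..1 :: int]"

definition D6_check :: "pm list \<Rightarrow> pm \<Rightarrow> pm \<Rightarrow> bool" where
  "D6_check G v w \<longleftrightarrow>
     list_all (\<lambda>x. list_all (\<lambda>y. mDih 6 x y \<in> set l6 \<and>
       D6_map v w (mDih 6 x y) = cmp2 (D6_map v w x) (D6_map v w y)) l6) l6 \<and>
     distinct (map (D6_map v w) l6) \<and> list_all (\<lambda>x. D6_map v w x \<in> set (sign_fibre G [pid, v])) l6 \<and>
     list_all (\<lambda>y. y \<in> set (map (D6_map v w) l6)) (sign_fibre G [pid, v])"

lemma D6_checks:
  "D6_check V4l v12 v13" "D6_check V4l v13 v12" "D6_check V4l v14 v12"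
  "D6_check W4l t12 t34" "D6_check W4l t34 t12" "D6_check W4l v12 t12"
  by code_simp+

lemma iso_D6:
  assumes "D6_check G v w"
  shows "pairs_of (sign_fibre G [pid, v]) \<cong> Dih 6"
proof (rule iso_pair[where mT = "mDih 6" and xs = l6 and f = "D6_map v w"])
  show "carrier (Dih 6) = set l6" using Dih_list(1)[of 6] by simp
  show "x \<otimes>\<^bsub>Dih 6\<^esub> y = mDih 6 x y" if "x \<in> set l6" "y \<in> set l6" for x y
    using Dih_list(2)[of 6] that by simp
qed (use assms in \<open>simp_all only: D6_check_def\<close>)

definition "m24 = (\<lambda>((x, y, z), g) ((x', y', z'), g').
  if g = 0 then ((mCyc 3 x x', mCyc 2 y y', mCyc 2 z z'), mCyc 2 g g')
  else ((mCyc 3 x (- x'), mCyc 2 y z', mCyc 2 z y'), mCyc 2 g g'))"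

abbreviation "l24 \<equiv> List.product (List.product [0..2] (List.product [0..1] [0..1])) [0..1 :: int]"

lemma SmallGroup_24_8_list:
  "carrier SmallGroup_24_8 = set l24"
  "x \<in> set l24 \<Longrightarrow> y \<in> set l24 \<Longrightarrow> x \<otimes>\<^bsub>SmallGroup_24_8\<^esub> y = m24 x y"
  by (auto simp: SmallGroup_24_8_def semidirect_def Klein_def DirProd_def carrier_integer_mod_group
      m24_def mCyc_def mod_simps split: if_splits)

text \<open>Conjugation by \<open>t13\<close> interchanges \<open>v12\<close> and
  \<open>v14\<close>, which realises the exchange of the two factors. In the next lemma
  \<open>v12\<close> likewise interchanges \<open>t13\<close> and \<open>t24\<close>.\<close>

lemma iso_24_8_V:
  "pairs_of (sign_fibre D4l V4l) \<cong> SmallGroup_24_8"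
  by (rule iso_pair[where mT = m24 and xs = l24 and f = "\<lambda>((x, y, z), g).
      (cmp (ppow cyc3 x) (ppow t12 g), cmp (cmp (ppow v12 y) (ppow v14 z)) (ppow t13 g))"])
    (rule SmallGroup_24_8_list(1), erule (1) SmallGroup_24_8_list(2), code_simp+)

lemma iso_24_8_D:
  "pairs_of (sign_fibre D4l D4k) \<cong> SmallGroup_24_8"
  by (rule iso_pair[where mT = m24 and xs = l24 and f = "\<lambda>((x, y, z), g).
      (cmp (ppow cyc3 x) (ppow t12 g), cmp (cmp (ppow t13 y) (ppow t24 z)) (ppow v12 g))"])
    (rule SmallGroup_24_8_list(1), erule (1) SmallGroup_24_8_list(2), code_simp+)

definition "m12 = (\<lambda>(x, g) (x', g'). (mCyc 3 x (if even g then x' else - x'), mCyc 4 g g'))"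

abbreviation "l12 \<equiv> List.product [0..2] [0..3 :: int]"

lemma SmallGroup_12_1_list:
  "carrier SmallGroup_12_1 = set l12"
  "x \<in> set l12 \<Longrightarrow> y \<in> set l12 \<Longrightarrow> x \<otimes>\<^bsub>SmallGroup_12_1\<^esub> y = m12 x y"
  by (auto simp: SmallGroup_12_1_def semidirect_def carrier_integer_mod_group
      m12_def mCyc_def mod_simps split: if_splits)

text \<open>The generator \<open>(t12, cyc4)\<close> of order four inverts \<open>cyc3\<close>
  through its first component.\<close>

lemma iso_12_1:
  "pairs_of (sign_fibre C4l C4k) \<cong> SmallGroup_12_1"
  by (rule iso_pair[where mT = m12 and xs = l12 and f = "\<lambda>(x, g).
      (cmp (ppow cyc3 x) (ppow t12 g), ppow cyc4 g)"])
    (rule SmallGroup_12_1_list(1), erule (1) SmallGroup_12_1_list(2), code_simp+)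

definition "m18 = (\<lambda>((x, y), g) ((x', y'), g').
  if g = 0 then ((mCyc 3 x x', mCyc 3 y y'), mCyc 2 g g')
  else ((mCyc 3 x (- x'), mCyc 3 y (- y')), mCyc 2 g g'))"

abbreviation "l18 \<equiv> List.product (List.product [0..2] [0..2]) [0..1 :: int]"

lemma SmallGroup_18_4_list:
  "carrier SmallGroup_18_4 = set l18"
  "x \<in> set l18 \<Longrightarrow> y \<in> set l18 \<Longrightarrow> x \<otimes>\<^bsub>SmallGroup_18_4\<^esub> y = m18 x y"
  by (auto simp: SmallGroup_18_4_def semidirect_def DirProd_def carrier_integer_mod_group
      m18_def mCyc_def mod_simps split: if_splits)

lemma iso_18_4:
  "pairs_of (sign_fibre S3l C3l) \<cong> SmallGroup_18_4"
  by (rule iso_pair[where mT = m18 and xs = l18 and f = "\<lambda>((x, y), g).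
      (cmp (ppow cyc3 x) (ppow t12 g), cmp (ppow cyc3 y) (ppow t12 g))"])
    (rule SmallGroup_18_4_list(1), erule (1) SmallGroup_18_4_list(2), code_simp+)

lemma Sym4_image: "perm4 ` set S4l = carrier (Sym 4)"
  unfolding classify_checks(14) perm_image by (simp add: sym_group_def)

lemma Alt4_image: "perm4 ` set A4l = carrier (Alt 4)"
proof -
  have "carrier (Alt 4) = {p \<in> perm4 ` set all_pm. evenperm p}"
    unfolding perm_image by (auto simp: alt_group_def)
  also have "\<dots> = perm4 ` set A4l"
    using evenperm_perm4 even_products(3) by auto
  finally show ?thesis by simp
qed

lemma Sym3_image: "perm4 ` set S3l = {p. p permutes {1..3}}"
proof (rule card_subset_eq)
  show "finite {p. p permutes {1..3::nat}}" by (rule finite_permutations) simp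
  have *: "\<forall>p\<in>set S3l. p \<in> set all_pm \<and> ap p P4 = P4" "length (remdups S3l) = 6" by code_simp+
  show "perm4 ` set S3l \<subseteq> {p. p permutes {1..3}}"
  proof (intro image_subsetI CollectI)
    fix p assume p: "p \<in> set S3l"
    have "perm4 p permutes {1..4}" using * p by (intro perm_permutes) simp
    moreover have "perm4 p i = i" if "i \<in> {1..4} - {1..3}" for i
    proof -
      have "i = num P4" using that by auto
      then show ?thesis using * p by (simp only: perm_num)
    qed
    ultimately show "perm4 p permutes {1..3}" by (rule permutes_superset)
  qed
  have "card (perm4 ` set S3l) = card (set S3l)"
    by (rule card_image) (simp add: inj_on_def perm_inj)
  also have "\<dots> = 6" using *(2) by (metis length_remdups_card_conv)
  also have "\<dots> = card {p. p permutes {1..3::nat}}"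
    by (simp add: card_permutations[of _ 3] fact_numeral)
  finally show "card (perm4 ` set S3l) = card {p. p permutes {1..3::nat}}" .
qed

lemma iso_S4: "perms_of S4l \<cong> Sym 4"
  unfolding Sym4_image by (simp add: iso_refl)

lemma iso_A4: "perms_of A4l \<cong> Alt 4"
  unfolding Alt4_image by (simp add: alt_group_def sym_group_def iso_refl)

lemma iso_S3: "perms_of S3l \<cong> Sym 3"
  unfolding Sym3_image by (simp add: sym_group_def iso_refl)

text \<open>Dihedral coordinates on S3: a rotation and a sign.\<close>

definition D3_map :: "int \<times> int \<Rightarrow> pm" where
  "D3_map = (\<lambda>(x, g). cmp (ppow cyc3 x) (ppow t12 g))"

abbreviation "l3 \<equiv> List.product [0..2] [0..1 :: int]"

lemma D3_checks:
  "\<forall>x\<in>set l3. \<forall>y\<in>set l3. D3_map (mDih 3 x y) = cmp (D3_map x) (D3_map y)"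
  "\<forall>x\<in>set l3. \<forall>y\<in>set l3. D3_map x = D3_map y \<longrightarrow> x = y"
  "\<forall>x\<in>set l3. D3_map x \<in> set S3l \<and> (D3_map x \<in> set A4l \<longleftrightarrow> snd x = 0)"
  "\<forall>p\<in>set S3l. \<exists>x\<in>set l3. p = D3_map x"
  by code_simp+

lemma S3_all: "p \<in> set S3l \<Longrightarrow> p \<in> set all_pm"
proof -
  have "\<forall>p\<in>set S3l. p \<in> set all_pm" by code_simp
  then show "p \<in> set S3l \<Longrightarrow> p \<in> set all_pm" by blast
qed

lemma sign_fibre_S4:
  "perm2 ` set (sign_fibre S4l A4l) =
     {(g, h) \<in> perm4 ` set S3l \<times> carrier (Sym 4). evenperm g \<longleftrightarrow> evenperm h}"
proof -
  have "set (sign_fibre S4l A4l) = {(p, q) \<in> set S3l \<times> set all_pm. p \<in> set A4l \<longleftrightarrow> q \<in> set A4l}"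
    by (auto simp: sign_fibre_def classify_checks(14))
  moreover have "carrier (Sym 4) = perm4 ` set all_pm"
    unfolding perm_image by (simp add: sym_group_def)
  ultimately show ?thesis
    using evenperm_perm4 S3_all by (auto simp: perm2_def image_iff)
qed

text \<open>Both components have the same sign, so a pair is a rotation, an even permutation and a
  common sign. The library's \<open>Alt 4\<close> consists of functions, hence the argument is by
  parity, with list checks only for S3.\<close>

lemma iso_72_43:
  "pairs_of (sign_fibre S4l A4l) \<cong> SmallGroup_72_43"
proof -
  let ?T = "SmallGroup_72_43" and ?\<tau> = "Transposition.transpose 1 (2 :: nat)"
  let ?f = "\<lambda>((x, p), h). (perm4 (D3_map (x, h)), if h = 0 then p else p \<circ> ?\<tau>)"
  have tau: "?\<tau> permutes {1..4}" "\<not> evenperm ?\<tau>" "permutation ?\<tau>" "?\<tau> \<circ> ?\<tau> = id"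
    by (auto intro: permutes_swap_id simp: evenperm_swap permutation_swap_id)
  have tau2: "?\<tau> \<circ> (?\<tau> \<circ> p) = p" for p using tau(4) by (simp only: o_assoc id_comp)
  have carrier: "carrier ?T = ({0..<3} \<times> carrier (Alt 4)) \<times> {0..<2}"
    by (simp add: SmallGroup_72_43_def semidirect_def DirProd_def carrier_integer_mod_group)
  have perm: "permutation p" if "p permutes {1..4::nat}" for p
    by (rule permutes_imp_permutation[OF _ that]) simp
  have conj: "?\<tau> \<circ> p \<circ> ?\<tau> \<in> carrier (Alt 4)" if "p \<in> carrier (Alt 4)" for p
  proof -
    have p: "p permutes {1..4}" "evenperm p" using that by (auto simp: alt_group_carrier)
    have "?\<tau> \<circ> p \<circ> ?\<tau> permutes {1..4}" using p(1) tau(1) by (intro permutes_compose)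
    moreover have "evenperm (?\<tau> \<circ> p \<circ> ?\<tau>)"
      using p perm[OF p(1)] tau by (simp add: evenperm_comp permutation_compose)
    ultimately show ?thesis by (simp add: alt_group_carrier)
  qed
  have mult: "((x, p), h) \<otimes>\<^bsub>?T\<^esub> ((x', p'), h') =
      ((fst (mDih 3 (x, h) (x', h')), p \<circ> (if h = 0 then p' else ?\<tau> \<circ> p' \<circ> ?\<tau>)), (h + h') mod 2)"
    if "x \<in> {0..<3}" "x' \<in> {0..<3}" for x p h x' p' h'
    using that by (simp add: SmallGroup_72_43_def semidirect_def DirProd_def carrier_integer_mod_group
        mDih_def alt_group_mult mod_simps)
  have mem: "(x, h) \<in> set l3" if "x \<in> {0..<3}" "h \<in> {0..<2}" for x h
    using that by auto
  have comp: "p \<circ> q \<in> carrier (Alt 4)" if "p \<in> carrier (Alt 4)" "q \<in> carrier (Alt 4)" for p q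
    using that perm by (auto simp: alt_group_carrier permutes_compose evenperm_comp)
  show ?thesis
  proof (rule iso_reverse[where f = ?f])
    fix u v assume "u \<in> carrier ?T" "v \<in> carrier ?T"
    then obtain x p h x' p' h' where uv: "u = ((x, p), h)" "v = ((x', p'), h')"
      and m: "x \<in> {0..<3}" "p \<in> carrier (Alt 4)" "h \<in> {0..<2}"
        "x' \<in> {0..<3}" "p' \<in> carrier (Alt 4)" "h' \<in> {0..<2}"
      unfolding carrier by blast
    show "u \<otimes>\<^bsub>?T\<^esub> v \<in> carrier ?T"
      unfolding uv mult[OF m(1,4)] carrier using m conj comp by (auto simp: mDih_def)
    have D: "D3_map (fst (mDih 3 (x, h) (x', h')), (h + h') mod 2) = cmp (D3_map (x, h)) (D3_map (x', h'))"
      using D3_checks(1) mem[OF m(1,3)] mem[OF m(4,6)] by (auto simp: mDih_def)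
    have h: "h = 0 \<or> h = 1" "h' = 0 \<or> h' = 1" using m by auto
    \<comment> \<open>Writing the second component as \<open>p\<close> times a power of
      \<open>?\<tau>\<close>, moving that power past \<open>p'\<close> produces the conjugation in
      the semidirect product.\<close>
    have "(if (h + h') mod 2 = 0 then p \<circ> (if h = 0 then p' else ?\<tau> \<circ> p' \<circ> ?\<tau>)
        else p \<circ> (if h = 0 then p' else ?\<tau> \<circ> p' \<circ> ?\<tau>) \<circ> ?\<tau>) =
      (if h = 0 then p else p \<circ> ?\<tau>) \<circ> (if h' = 0 then p' else p' \<circ> ?\<tau>)"
      using h by (elim disjE) (simp_all add: comp_assoc tau(4))
    then show "?f (u \<otimes>\<^bsub>?T\<^esub> v) = ?f u \<otimes>\<^bsub>Sym 4 \<times>\<times> Sym 4\<^esub> ?f v"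
      unfolding uv mult[OF m(1,4)] by (simp add: D perm_cmp sym_group_def DirProd_def)
  next
    show "inj_on ?f (carrier ?T)"
    proof (rule inj_onI)
      fix u v assume "u \<in> carrier ?T" "v \<in> carrier ?T" and eq: "?f u = ?f v"
      then obtain x p h x' p' h' where uv: "u = ((x, p), h)" "v = ((x', p'), h')"
        and m: "x \<in> {0..<3}" "h \<in> {0..<2}" "x' \<in> {0..<3}" "h' \<in> {0..<2}"
        unfolding carrier by blast
      have "D3_map (x, h) = D3_map (x', h')"
        using eq unfolding uv by (simp add: perm_inj)
      then have "(x, h) = (x', h')"
        using bspec[OF bspec[OF D3_checks(2) mem[OF m(1,2)]] mem[OF m(3,4)]] by blast
      moreover have "p = p'" if "p \<circ> ?\<tau> = p' \<circ> ?\<tau>"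
        using arg_cong[OF that, of "\<lambda>q. q \<circ> ?\<tau>"] by (simp add: comp_assoc tau(4))
      ultimately show "u = v" using eq unfolding uv by (simp split: if_splits)
    qed
  next
    show "?f ` carrier ?T = perm2 ` set (sign_fibre S4l A4l)"
    proof (intro subset_antisym subsetI)
      fix z assume "z \<in> ?f ` carrier ?T"
      then obtain x p h where z: "z = ?f ((x, p), h)" and m: "x \<in> {0..<3}" "p \<in> carrier (Alt 4)" "h \<in> {0..<2}"
        unfolding carrier by blast
      have D: "D3_map (x, h) \<in> set S3l" "D3_map (x, h) \<in> set A4l \<longleftrightarrow> h = 0"
        using bspec[OF D3_checks(3) mem[OF m(1,3)]] by simp_all
      have "evenperm (perm4 (D3_map (x, h))) \<longleftrightarrow> h = 0"
        using evenperm_perm4[OF S3_all[OF D(1)]] D(2) by simp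
      moreover have "p permutes {1..4}" "evenperm p" using m(2) by (auto simp: alt_group_carrier)
      ultimately show "z \<in> perm2 ` set (sign_fibre S4l A4l)"
        unfolding sign_fibre_S4 z using D(1) tau perm
        by (auto simp: sym_group_carrier permutes_compose evenperm_comp)
    next
      fix z assume "z \<in> perm2 ` set (sign_fibre S4l A4l)"
      then obtain g k where z: "z = (perm4 g, k)" "g \<in> set S3l" "k permutes {1..4}"
          "evenperm (perm4 g) \<longleftrightarrow> evenperm k"
        unfolding sign_fibre_S4 by (auto simp: sym_group_carrier)
      obtain x h where xh: "(x, h) \<in> set l3" "g = D3_map (x, h)"
        using bspec[OF D3_checks(4) z(2)] by auto
      have ev: "evenperm k \<longleftrightarrow> h = 0"
        using bspec[OF D3_checks(3) xh(1)] evenperm_perm4[OF S3_all[OF z(2)]] z(4) xh(2) by simp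
      define p where "p = (if h = 0 then k else k \<circ> ?\<tau>)"
      have "p \<in> carrier (Alt 4)"
        using ev z(3) tau perm by (auto simp: p_def alt_group_carrier permutes_compose evenperm_comp)
      moreover have "?f ((x, p), h) = z"
        using z(1) xh(2) by (simp add: p_def comp_assoc tau(4))
      moreover have "x \<in> {0..<3}" "h \<in> {0..<2}" using xh(1) by auto
      ultimately show "z \<in> ?f ` carrier ?T" unfolding carrier by (metis (lifting) SigmaI image_eqI)
    qed
  qed
qed

section \<open>The rows of the table\<close>

context root_pair
begin

lemma Gal_iso_fst: "Gal S1.N \<cong> (Sym 4)\<lparr>carrier := fst ` J\<rparr>"
  unfolding fst_J
proof (rule inj_hom_iso_image)
  have perm: "lab e1 \<sigma> permutes {1..4}" if "\<sigma> \<in> carrier (Gal S1.N)" for \<sigma>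
    using lab_permutes[OF e1 S1_img[OF that]] S1.Gal_bij[OF that] S1.S_subset
    by (auto simp: bij_betw_def intro: inj_on_subset)
  show "lab e1 \<in> hom (Gal S1.N) (Sym 4)"
  proof (rule homI)
    show "lab e1 \<sigma> \<in> carrier (Sym 4)" if "\<sigma> \<in> carrier (Gal S1.N)" for \<sigma>
      using perm[OF that] by (simp add: sym_group_carrier)
    show "lab e1 (\<sigma> \<otimes>\<^bsub>Gal S1.N\<^esub> \<tau>) = lab e1 \<sigma> \<otimes>\<^bsub>Sym 4\<^esub> lab e1 \<tau>"
      if "\<sigma> \<in> carrier (Gal S1.N)" "\<tau> \<in> carrier (Gal S1.N)" for \<sigma> \<tau>
      using lab_comp[OF e1 S1_img[OF that(1)] S1_img[OF that(2)]] S1.Gal_mult_apply[OF that] S1.S_subset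
      by (auto simp: sym_group_mult)
  qed
  show "inj_on (lab e1) (carrier (Gal S1.N))"
    by (rule inj_onI, rule S1.Gal_eqI) (auto intro: lab_eqD[OF e1 S1_img S1_img])
qed

lemma Gal_iso_snd: "Gal S2.N \<cong> (Sym 4)\<lparr>carrier := snd ` J\<rparr>"
  using root_pair.Gal_iso_fst[OF flip] by (simp add: flip_J image_image)

end

section \<open>Numberings that bring a Galois group into standard form\<close>

lemma bij_relabel:
  assumes "bij_betw e {1..4} S" "s \<in> set all_pm"
  shows "bij_betw (e \<circ> perm4 s) {1..4} S"
  using bij_betw_trans[OF permutes_imp_bij[OF perm_permutes[OF assms(2)]] assms(1)] .

text \<open>Renumbering the roots by \<open>s\<close> conjugates all labels by \<open>s\<close>, so
  conjugate subgroups describe the same group.\<close>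

lemma lab_relabel:
  assumes e: "bij_betw e {1..4} S" and s: "s \<in> set all_pm" and \<sigma>: "\<sigma> ` S \<subseteq> S" and u: "lab e \<sigma> = perm4 u"
    and cu: "cj s u \<in> set all_pm"
  shows "lab (e \<circ> perm4 s) \<sigma> = perm4 (cj s u)"
proof
  fix i
  note e' = bij_relabel[OF e s]
  show "lab (e \<circ> perm4 s) \<sigma> i = perm4 (cj s u) i"
  proof (cases "i \<in> {1..4}")
    case True
    have si: "perm4 s i \<in> {1..4}" using permutes_in_image[OF perm_permutes[OF s]] True by blast
    have "cmp s (cj s u) = cmp (cmp s (pinv s)) (cmp u s)" by (simp only: cj_def cmp_assoc)
    then have "cmp s (cj s u) = cmp u s" using s by (simp only: pinv_simps cmp_pid)
    then have c: "perm4 s (perm4 (cj s u) i) = perm4 u (perm4 s i)" by (metis comp_apply perm_cmp)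
    have "(e \<circ> perm4 s) (lab (e \<circ> perm4 s) \<sigma> i) = \<sigma> (e (perm4 s i))"
      using lab_apply[OF e' \<sigma> True] by simp
    also have "\<dots> = e (perm4 u (perm4 s i))" using lab_apply[OF e \<sigma> si] u by simp
    also have "\<dots> = (e \<circ> perm4 s) (perm4 (cj s u) i)" using c by simp
    finally show ?thesis
      using lab_apply_in[OF e' \<sigma> True] permutes_in_image[OF perm_permutes[OF cu]] True
      by (intro e_inj[OF e']) auto
  next
    case False
    then have "lab f \<sigma> i = i" for f by (simp only: lab_def if_False)
    then show ?thesis using perm_outside[OF False] by simp
  qed
qed

lemma length_lists:
  "length (remdups S4l) = 24" "length (remdups A4l) = 12" "length (remdups D4l) = 8"
  "length (remdups C4l) = 4" "length (remdups V4l) = 4" "length (remdups W4l) = 4"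
  "length (remdups S3l) = 6" "length (remdups C3l) = 3"
  by code_simp+

lemma card_perm4: "card (perm4 ` set L) = length (remdups L)"
proof -
  have "card (perm4 ` set L) = card (set L)"
    by (rule card_image) (simp add: inj_on_def perm_inj)
  then show ?thesis by (simp add: length_remdups_card_conv)
qed

definition "standard_lists = [S4l, A4l, D4l, C4l, V4l, W4l, S3l, C3l]"

lemma standard_labelling:
  fixes a :: "'m::field \<times> 'm"
  assumes disc: "quartic_disc a \<noteq> 0" and ord: "Coset.order (G_single a) \<ge> 3"
  shows "\<exists>e :: nat \<Rightarrow> 'm alg_closure. \<exists>L\<in>set standard_lists. bij_betw e {1..4} (closure_roots (quartic a)) \<and>
    lab e ` carrier (G_single a) = perm4 ` set L"
proof -
  let ?S = "closure_roots (quartic a)"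
  obtain e :: "nat \<Rightarrow> 'm alg_closure" where e: "bij_betw e {1..4} ?S"
    using ex_bij_betw_nat_finite_1[OF root_set.finite_S[OF quartic_root_set[OF disc]]]
    by (auto simp: card_quartic_roots[OF disc])
  \<comment> \<open>Pairing the root set with itself gives access to the results on pairs;
    \<open>J\<close> is then the diagonal.\<close>
  interpret root_pair ?S ?S e e
    using quartic_root_set[OF disc] e by (simp add: root_pair_def root_pair_axioms_def)
  have Gs: "G_single a = Gal S1.N" by (rule G_single_Gal)
  obtain H where H: "J = perm2 ` H" "pm_subgroup H" using pm_subgroup_of_image[OF J_subgroup] .
  interpret H: pm_subgroup H by (rule H(2))
  define U where "U = fst ` H"
  have lab_U: "lab e ` carrier (G_single a) = perm4 ` U"
    using fst_J by (simp add: Gs H(1) U_def image_image perm2_def)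
  have U: "closed_pm U"
    unfolding closed_pm_def
  proof (intro conjI ballI)
    show "U \<subseteq> set all_pm" using H.sub by (auto simp: U_def)
    show "pid \<in> U" using imageI[OF H.one, of fst] by (simp add: U_def)
    fix p q assume "p \<in> U" "q \<in> U"
    then obtain p' q' where "(p, p') \<in> H" "(q, q') \<in> H" by (auto simp: U_def)
    from imageI[OF H.mult[OF this], of fst] show "cmp p q \<in> U" by (simp add: U_def)
  qed
  have "card (perm4 ` U) = Coset.order (G_single a)"
    using iso_same_card[OF Gal_iso_fst] lab_U fst_J by (simp add: Coset.order_def Gs)
  moreover have "card (perm4 ` U) = card U"
    by (rule card_image) (simp add: inj_on_def perm_inj)
  ultimately have "card U \<ge> 3" using ord by simp
  then obtain s L where s: "s \<in> set all_pm" "L \<in> set standard_lists" "cj s ` U = set L"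
    using classify_subgroups[OF U] by (auto simp: standard_lists_def)
  have "lab (e \<circ> perm4 s) ` carrier (G_single a) = perm4 ` cj s ` U"
  proof -
    have step: "lab (e \<circ> perm4 s) \<sigma> = perm4 (cj s u)" if "\<sigma> \<in> carrier (G_single a)" "u \<in> U" "lab e \<sigma> = perm4 u" for \<sigma> u
    proof (rule lab_relabel[OF e s(1) _ that(3)])
      show "\<sigma> ` ?S \<subseteq> ?S" using S1_img that(1) by (simp add: Gs)
      have "u \<in> set all_pm" using U that(2) by (auto simp: closed_pm_def)
      then show "cj s u \<in> set all_pm"
        unfolding cj_def using s(1) by (intro cmp_closed pinv_simps(1))
    qed
    show ?thesis
    proof (intro subset_antisym subsetI)
      fix p assume "p \<in> lab (e \<circ> perm4 s) ` carrier (G_single a)"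
      then obtain \<sigma> where \<sigma>: "\<sigma> \<in> carrier (G_single a)" "p = lab (e \<circ> perm4 s) \<sigma>" by blast
      then have "lab e \<sigma> \<in> perm4 ` U" using lab_U by blast
      then show "p \<in> perm4 ` cj s ` U" using step \<sigma> by auto
    next
      fix p assume "p \<in> perm4 ` cj s ` U"
      then obtain u where u: "u \<in> U" "p = perm4 (cj s u)" by blast
      then have "perm4 u \<in> lab e ` carrier (G_single a)" using lab_U by blast
      then obtain \<sigma> where "\<sigma> \<in> carrier (G_single a)" "lab e \<sigma> = perm4 u" by auto
      then show "p \<in> lab (e \<circ> perm4 s) ` carrier (G_single a)" using step u by (metis imageI)
    qed
  qed
  then show ?thesis using s(2,3) bij_relabel[OF e s(1)] by auto
qed

locale standard_pair = quartic_pair a a' e1 e2 + pm_subgroup H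
  for a a' :: "'m::field \<times> 'm" and e1 e2 and H +
  fixes L1 L2 :: "pm list"
  assumes J_H: "J = perm2 ` H"
    and F: "fst ` H = set L1" and S: "snd ` H = set L2"
begin

lemma G_single_1: "G_single a \<cong> perms_of L1"
proof -
  have "fst ` J = perm4 ` set L1" unfolding J_H F[symmetric] by (simp add: image_image perm2_def)
  then show ?thesis using Gal_iso_fst by (simp add: G_single_Gal)
qed

lemma G_single_2: "G_single a' \<cong> perms_of L2"
proof -
  have "snd ` J = perm4 ` set L2" unfolding J_H S[symmetric] by (simp add: image_image perm2_def)
  then show ?thesis using Gal_iso_snd by (simp add: G_single_Gal)
qed

lemma G_pair_iso: "G_pair a a' \<cong> (Sym 4 \<times>\<times> Sym 4)\<lparr>carrier := perm2 ` H\<rparr>"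
  using G_iso_J by (simp add: G_pair_G J_H)

lemma fst_J_H: "fst ` J = perm4 ` set L1" and snd_J_H: "snd ` J = perm4 ` set L2"
  unfolding J_H F[symmetric] S[symmetric] by (simp_all add: image_image perm2_def)

lemma L_fields: "L_field a = S1.N" "L_field a' = S2.N"
  by (simp_all add: L_field_gen)

lemma decomposition:
  assumes "H = set hl" "sort (dt hl) = ds"
  shows "decomposition_type a a' = mset ds"
  using decomposition_type_orbit_type orbit_type_dt[OF pm_subgroup_axioms J_H assms(1)] assms(2)
  by (metis mset_sort)

lemma row_full:
  assumes H: "H = set (List.product L1 L2)" and ds: "sort (dt (List.product L1 L2)) = ds"
    and iso: "pairs_of (List.product L1 L2) \<cong> T"
  shows "row a a' T (L_field a \<inter> L_field a' = base_field) (mset ds)"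
proof -
  have "J = fst ` J \<times> snd ` J"
    unfolding fst_J_H snd_J_H unfolding J_H H perm2_def by auto
  then show ?thesis
    using iso_trans[OF G_pair_iso] iso meet_trivial decomposition[OF H ds]
    by (simp add: row_def L_fields H)
qed

lemma row_fibre:
  assumes two: "(2 :: 'm) \<noteq> 0" and L1: "L1 = S3l"
    and H: "H = set (sign_fibre L2 K)" and ds: "sort (dt (sign_fibre L2 K)) = ds"
    and iso: "pairs_of (sign_fibre L2 K) \<cong> T"
  shows "row a a' T (meet_degree a a' 2) (mset ds)"
proof -
  have even: "evenperm (perm4 p) \<longleftrightarrow> p \<in> set A4l" if "p \<in> set S3l" for p
    using evenperm_perm4[OF S3_all[OF that]] .
  have "ring.dimension ring_of_type_algebra 2 base_field (S1.N \<inter> S2.N)"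
  proof (rule meet_quadratic[OF two])
    show "fst ` J \<subseteq> {p. p permutes {1..3}}" unfolding fst_J_H L1 Sym3_image by simp
    show "\<exists>g\<in>fst ` J. \<not> evenperm g"
      unfolding fst_J_H L1 using even fibre_checks(10,11) by blast
    show "J = {(g, h) \<in> fst ` J \<times> snd ` J. evenperm g \<longleftrightarrow> h \<in> perm4 ` set K}"
      unfolding fst_J_H snd_J_H L1 unfolding J_H H sign_fibre_def perm2_def
      using even by (auto simp: image_iff perm_inj)
  qed
  then show ?thesis
    using iso_trans[OF G_pair_iso] iso decomposition[OF H ds]
    by (simp add: row_def meet_degree_def L_fields H)
qed

text \<open>With trivial kernel the second projection is injective on \<open>J\<close>, so the joint
  group is that of the second quartic.\<close>

lemma G_pair_iso_2:
  assumes "\<And>p. (p, pid) \<in> H \<Longrightarrow> p = pid" "set L1 \<subseteq> set S3l"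
  shows "G_pair a a' \<cong> perms_of L2"
proof -
  have "snd \<in> hom ((Sym 4 \<times>\<times> Sym 4)\<lparr>carrier := J\<rparr>) (Sym 4)"
    using J_subgroup[THEN subgroup.subset] by (auto simp: hom_def DirProd_def)
  moreover have "inj_on snd J"
  proof (rule inj_onI)
    fix x y assume "x \<in> J" "y \<in> J" "snd x = snd y"
    then obtain p q p' where x: "x = perm2 (p, q)" "y = perm2 (p', q)" "(p, q) \<in> H" "(p', q) \<in> H"
      unfolding J_H by (auto simp: perm2_def perm_inj)
    have "p = p'" by (rule functional[OF _ assms(1) x(3,4)]) (use F assms(2) in simp_all)
    then show "x = y" using x(1,2) by simp
  qed
  ultimately have "(Sym 4 \<times>\<times> Sym 4)\<lparr>carrier := J\<rparr> \<cong> (Sym 4)\<lparr>carrier := snd ` J\<rparr>"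
    using inj_hom_iso_image[of snd "(Sym 4 \<times>\<times> Sym 4)\<lparr>carrier := J\<rparr>" "Sym 4"] by simp
  then show ?thesis
    using iso_trans[OF G_iso_J] by (simp add: G_pair_G snd_J_H)
qed

lemma subset_1:
  assumes "\<And>p. (p, pid) \<in> H \<Longrightarrow> p = pid"
  shows "L_field a \<subseteq> L_field a'"
  unfolding L_fields
proof (rule N1_subset_N2)
  fix g assume "(g, id) \<in> J"
  then obtain p q where pq: "(p, q) \<in> H" "g = perm4 p" "perm4 q = perm4 pid"
    unfolding J_H by (auto simp: perm2_def perm_pid)
  then have "p = pid" using assms by (simp only: perm_inj)
  then show "g = id" using pq(2) by (simp only: perm_pid)
qed

lemma subset_2:
  assumes "\<And>q. (pid, q) \<in> H \<Longrightarrow> q = pid"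
  shows "L_field a' \<subseteq> L_field a"
  unfolding L_fields
proof (rule N2_subset_N1)
  fix h assume "(id, h) \<in> J"
  then obtain p q where pq: "(p, q) \<in> H" "h = perm4 q" "perm4 p = perm4 pid"
    unfolding J_H by (auto simp: perm2_def perm_pid)
  then have "q = pid" using assms by (simp only: perm_inj)
  then show "h = id" using pq(2) by (simp only: perm_pid)
qed

lemma not_equal:
  assumes "(pid, q) \<in> H" "q \<noteq> pid"
  shows "L_field a \<noteq> L_field a'"
proof
  assume "L_field a = L_field a'"
  moreover have "(id, perm4 q) \<in> J" unfolding J_H using assms(1) by (force simp: perm2_def perm_pid)
  ultimately have "perm4 q = perm4 pid" using N1_eq_N2D by (simp add: L_fields perm_pid)
  then show False using assms(2) by (simp add: perm_inj)
qed

lemma graph_check_row: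
  assumes chk: "graph_check L1 gs ws rels ds nontriv" and us: "us \<in> set (images L1 gs rels)"
    and H: "H = set (word_graph us gs ws)" and L1: "set L1 \<subseteq> set S3l"
    and iso: "perms_of L2 \<cong> T"
  shows "if nontriv then row a a' T (L_field a \<subset> L_field a') (mset ds)
    else row a a' T (L_field a = L_field a') (mset ds)"
proof -
  let ?gl = "word_graph us gs ws"
  \<comment> \<open>The first projection of \<open>H\<close> is onto, which excludes the first
    alternative of the check.\<close>
  have "list_all (\<lambda>p. p \<in> set (map fst ?gl)) L1"
    using F by (simp add: list_all_iff flip: H)
  then have c: "sort (dt ?gl) = ds" "list_all (\<lambda>x. snd x = pid \<longrightarrow> fst x = pid) ?gl"
      "if nontriv then list_ex (\<lambda>x. fst x = pid \<and> snd x \<noteq> pid) ?gl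
       else list_all (\<lambda>x. fst x = pid \<longrightarrow> snd x = pid) ?gl"
    using chk us unfolding graph_check_def Let_def list_all_iff[of _ "images L1 gs rels"] by blast+
  have k1: "p = pid" if "(p, pid) \<in> H" for p
    using c(2) that by (auto simp: list_all_iff H)
  have pair: "G_pair a a' \<cong> T" by (rule iso_trans[OF G_pair_iso_2[OF k1 L1] iso])
  note dec = decomposition[OF H c(1)]
  show ?thesis
  proof (cases nontriv)
    case True
    then obtain q where "(pid, q) \<in> H" "q \<noteq> pid" using c(3) by (auto simp: list_ex_iff H)
    then show ?thesis using True not_equal subset_1[OF k1] pair dec by (auto simp: row_def)
  next
    case False
    then have "q = pid" if "(pid, q) \<in> H" for q using c(3) that by (auto simp: list_all_iff H)
    then show ?thesis using False subset_1[OF k1] subset_2 pair dec by (auto simp: row_def)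
  qed
qed

lemma no_map_contradiction:
  assumes "no_map L1 gs ws rels" "us \<in> set (images L1 gs rels)" "H = set (word_graph us gs ws)"
  shows False
proof -
  have "list_all (\<lambda>p. p \<in> set (map fst (word_graph us gs ws))) L1"
    using F by (simp add: list_all_iff flip: assms(3))
  then show False using assms(1,2) by (auto simp: no_map_def list_all_iff)
qed

lemma S3_trichotomy:
  assumes "L1 = S3l" "L2 = elts gs ws" "presented gs ws rels" "kernels_check gs ws rels Ks"
  shows "H = set (List.product S3l L2) \<or> list_ex (\<lambda>K. H = set (sign_fibre L2 K)) Ks \<or>
    (\<exists>us\<in>set (images S3l gs rels). H = set (word_graph us gs ws))"
proof -
  have "\<exists>K'\<in>set Ks. H = set (sign_fibre L2 K')"
    if us: "us \<in> set (images [pid, t12] gs rels)" "H = set (sign_fibre L2 (kernel_list (word_graph us gs ws)))"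
      "\<not> set L2 \<subseteq> set (kernel_list (word_graph us gs ws))" for us
  proof -
    let ?K = "kernel_list (word_graph us gs ws)"
    \<comment> \<open>The kernel is proper, so the trivial character is ruled out.\<close>
    have "list_ex (\<lambda>K'. list_all (\<lambda>q. q \<in> set ?K) K' \<and> list_all (\<lambda>q. q \<in> set K') ?K) Ks"
      using assms(4) us(1,3) unfolding kernels_check_def Let_def list_all_iff[of _ "images [pid, t12] gs rels"]
      by (auto simp: assms(2) list_all_iff)
    then obtain K' where "K' \<in> set Ks" "set K' = set ?K" by (auto simp: list_ex_iff list_all_iff)
    then show ?thesis using us(2) by (auto simp: sign_fibre_def)
  qed
  then show ?thesis
    using S3_cases[OF F[unfolded assms(1)] S[unfolded assms(2)] assms(3)] unfolding Let_def assms(2)[symmetric] list_ex_iff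
    by blast
qed

lemma C3_dichotomy:
  assumes "L1 = C3l" "L2 = elts gs ws" "presented gs ws rels"
  shows "H = set (List.product C3l L2) \<or> (\<exists>us\<in>set (images C3l gs rels). H = set (word_graph us gs ws))"
  using C3_cases[OF F[unfolded assms(1)] S[unfolded assms(2)] assms(3)] assms(2) by simp

end

lemma product_iso:
  assumes "perms_of L1 \<cong> A" "perms_of L2 \<cong> B"
  shows "pairs_of (List.product L1 L2) \<cong> A \<times>\<times> B"
proof -
  obtain f g where fg: "f \<in> iso (perms_of L1) A" "g \<in> iso (perms_of L2) B"
    using assms by (auto simp: is_iso_def)
  have "perm2 ` set (List.product L1 L2) = perm4 ` set L1 \<times> perm4 ` set L2"
    by (auto simp: perm2_def)
  then have eq: "pairs_of (List.product L1 L2) =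
      perms_of L1 \<times>\<times> perms_of L2"
    by (simp add: DirProd_def)
  have "map_prod f g \<in> iso (perms_of L1 \<times>\<times> perms_of L2) (A \<times>\<times> B)"
    using fg by (auto simp: iso_def hom_def DirProd_def bij_betw_def map_prod_inj_on map_prod_surj_on Pi_iff)
  then show ?thesis unfolding eq by (rule is_isoI)
qed


text \<open>Computed orbit sizes are ascending, those of the table descending.\<close>

lemma mset_orders:
  "mset [24] = {#24::nat#}" "mset [12, 12] = {#12, 12::nat#}" "mset [6, 18] = {#18, 6::nat#}"
  "mset [4, 8, 12] = {#12, 8, 4::nat#}" "mset [6, 6, 12] = {#12, 6, 6::nat#}"
  "mset [6, 6, 6, 6] = {#6, 6, 6, 6::nat#}" "mset [3, 3, 9, 9] = {#9, 9, 3, 3::nat#}"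
  "mset [1, 2, 3, 3, 3, 6, 6] = {#6, 6, 3, 3, 3, 2, 1::nat#}"
  "mset [4, 4, 4, 12] = {#12, 4, 4, 4::nat#}"
  "mset [1, 1, 1, 3, 3, 3, 3, 3, 3, 3] = {#3, 3, 3, 3, 3, 3, 3, 1, 1, 1::nat#}"
  by (simp_all add: add_mset_commute)

lemma C3_subset_S3: "set C3l \<subseteq> set S3l"
  using fibre_checks(7) by blast

text \<open>In \<open>'k\<close> the number 2 is a unit, and a ring homomorphism preserves
  units.\<close>

lemma two_neq_zero_transfer:
  fixes \<iota> :: "'k::field \<Rightarrow> 'm::field"
  assumes "CHAR('k) \<noteq> 2" "\<iota> \<in> ring_hom ring_of_type_algebra ring_of_type_algebra"
  shows "(2 :: 'm) \<noteq> 0"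
proof
  assume zero: "(2 :: 'm) = 0"
  have hom: "\<iota> (x * y) = \<iota> x * \<iota> y" "\<iota> (x + y) = \<iota> x + \<iota> y" "\<iota> 1 = 1" for x y
    using ring_hom_mult[OF assms(2), of x y] ring_hom_add[OF assms(2), of x y] ring_hom_one[OF assms(2)]
    by simp_all
  have "\<iota> 2 = 0" using hom(2)[of 1 1] hom(3) zero by simp
  moreover have "CHAR('k) \<noteq> 1" by simp
  then have "\<not> CHAR('k) dvd 2" using assms(1) two_is_prime_nat unfolding prime_nat_iff by blast
  then have "(2 :: 'k) \<noteq> 0" using of_nat_eq_0_iff_char_dvd[of 2, where 'a = 'k] by simp
  then have "\<iota> 2 * \<iota> (inverse 2) = 1" using hom(1)[of 2 "inverse 2"] hom(3) by simp
  ultimately show False by simp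
qed

lemmas row_simps = mset_orders if_True if_False simp_thms

theorem theorem6p1:
  fixes \<iota> :: "'k::field \<Rightarrow> 'm::field"
    and a a' :: "'m \<times> 'm"
  assumes "CHAR('k) \<noteq> 2"
    and "\<iota> \<in> ring_hom ring_of_type_algebra ring_of_type_algebra"
    and "infinite (UNIV :: 'm set)"
    and "quartic_disc a * quartic_disc a' \<noteq> 0"
    and "G_single a \<cong> Sym 3 \<or> G_single a \<cong> Cyc 3"
    and "Coset.order (G_single a') \<ge> 3"
  shows
    "(G_single a \<cong> Sym 3 \<and> G_single a' \<cong> Sym 4 \<and>
      (row a a' (Sym 3 \<times>\<times> Sym 4) (L_field a \<inter> L_field a' = base_field) {#24#} \<or>
       row a a' (SmallGroup_72_43) (meet_degree a a' 2) {#12, 12#} \<or>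
       row a a' (Sym 4) (L_field a \<subset> L_field a') {#12, 8, 4#})) \<or>
     (G_single a \<cong> Sym 3 \<and> G_single a' \<cong> Alt 4 \<and>
      (row a a' (Sym 3 \<times>\<times> Alt 4) (L_field a \<inter> L_field a' = base_field) {#24#})) \<or>
     (G_single a \<cong> Sym 3 \<and> G_single a' \<cong> Dih 4 \<and>
      (row a a' (Sym 3 \<times>\<times> Dih 4) (L_field a \<inter> L_field a' = base_field) {#24#} \<or>
       row a a' (Dih 12) (meet_degree a a' 2) {#12, 12#} \<or>
       row a a' (SmallGroup_24_8) (meet_degree a a' 2) {#24#} \<or>
       row a a' (SmallGroup_24_8) (meet_degree a a' 2) {#12, 12#})) \<or>
     (G_single a \<cong> Sym 3 \<and> G_single a' \<cong> Cyc 4 \<and>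
      (row a a' (Sym 3 \<times>\<times> Cyc 4) (L_field a \<inter> L_field a' = base_field) {#24#} \<or>
       row a a' (SmallGroup_12_1) (meet_degree a a' 2) {#12, 12#})) \<or>
     (G_single a \<cong> Sym 3 \<and> G_single a' \<cong> Klein \<and>
      (row a a' (Sym 3 \<times>\<times> Klein) (L_field a \<inter> L_field a' = base_field) {#24#} \<or>
       row a a' (Sym 3 \<times>\<times> Klein) (L_field a \<inter> L_field a' = base_field) {#12, 12#} \<or>
       row a a' (Dih 6) (meet_degree a a' 2) {#12, 12#} \<or>
       row a a' (Dih 6) (meet_degree a a' 2) {#12, 6, 6#} \<or>
       row a a' (Dih 6) (meet_degree a a' 2) {#6, 6, 6, 6#})) \<or>
     (G_single a \<cong> Sym 3 \<and> G_single a' \<cong> Sym 3 \<and>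
      (row a a' (Sym 3 \<times>\<times> Sym 3) (L_field a \<inter> L_field a' = base_field) {#18, 6#} \<or>
       row a a' (SmallGroup_18_4) (meet_degree a a' 2) {#9, 9, 3, 3#} \<or>
       row a a' (Sym 3) (L_field a = L_field a') {#6, 6, 3, 3, 3, 2, 1#})) \<or>
     (G_single a \<cong> Sym 3 \<and> G_single a' \<cong> Cyc 3 \<and>
      (row a a' (Sym 3 \<times>\<times> Cyc 3) (L_field a \<inter> L_field a' = base_field) {#18, 6#})) \<or>
     (G_single a \<cong> Cyc 3 \<and> G_single a' \<cong> Sym 4 \<and>
      (row a a' (Cyc 3 \<times>\<times> Sym 4) (L_field a \<inter> L_field a' = base_field) {#24#})) \<or>
     (G_single a \<cong> Cyc 3 \<and> G_single a' \<cong> Alt 4 \<and>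
      (row a a' (Cyc 3 \<times>\<times> Alt 4) (L_field a \<inter> L_field a' = base_field) {#12, 12#} \<or>
       row a a' (Alt 4) (L_field a \<subset> L_field a') {#12, 4, 4, 4#})) \<or>
     (G_single a \<cong> Cyc 3 \<and> G_single a' \<cong> Dih 4 \<and>
      (row a a' (Cyc 3 \<times>\<times> Dih 4) (L_field a \<inter> L_field a' = base_field) {#24#})) \<or>
     (G_single a \<cong> Cyc 3 \<and> G_single a' \<cong> Cyc 4 \<and>
      (row a a' (Cyc 12) (L_field a \<inter> L_field a' = base_field) {#12, 12#})) \<or>
     (G_single a \<cong> Cyc 3 \<and> G_single a' \<cong> Klein \<and>
      (row a a' (Cyc 3 \<times>\<times> Klein) (L_field a \<inter> L_field a' = base_field) {#12, 12#})) \<or>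
     (G_single a \<cong> Cyc 3 \<and> G_single a' \<cong> Sym 3 \<and>
      (row a a' (Cyc 3 \<times>\<times> Sym 3) (L_field a \<inter> L_field a' = base_field) {#18, 6#})) \<or>
     (G_single a \<cong> Cyc 3 \<and> G_single a' \<cong> Cyc 3 \<and>
      (row a a' (Cyc 3 \<times>\<times> Cyc 3) (L_field a \<inter> L_field a' = base_field) {#9, 9, 3, 3#} \<or>
       row a a' (Cyc 3) (L_field a = L_field a') {#3, 3, 3, 3, 3, 3, 3, 1, 1, 1#}))"
proof -
  have two: "(2 :: 'm) \<noteq> 0" by (rule two_neq_zero_transfer[OF assms(1,2)])
  have disc: "quartic_disc a \<noteq> 0" "quartic_disc a' \<noteq> 0" using assms(4) by auto
  have card_Sym3: "card (carrier (Sym 3)) = 6"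
    using card_perm4[of S3l] length_lists(7) by (simp add: Sym3_image sym_group_def)
  have card_Cyc3: "card (carrier (Cyc 3)) = 3" by (simp add: carrier_integer_mod_group)
  have cases: "Coset.order (G_single a) = 6 \<and> G_single a \<cong> Sym 3 \<or> Coset.order (G_single a) = 3 \<and> G_single a \<cong> Cyc 3"
    using assms(5) iso_same_card card_Sym3 card_Cyc3 unfolding Coset.order_def by metis
  then have "Coset.order (G_single a) \<ge> 3" by auto
  then obtain e1 :: "nat \<Rightarrow> 'm alg_closure" and L1 where e1: "L1 \<in> set standard_lists"
      "bij_betw e1 {1..4} (closure_roots (quartic a))" "lab e1 ` carrier (G_single a) = perm4 ` set L1"
    using standard_labelling[OF disc(1)] by blast
  obtain e2 :: "nat \<Rightarrow> 'm alg_closure" and L2 where e2: "L2 \<in> set standard_lists"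
      "bij_betw e2 {1..4} (closure_roots (quartic a'))" "lab e2 ` carrier (G_single a') = perm4 ` set L2"
    using standard_labelling[OF disc(2) assms(6)] by blast
  interpret P: quartic_pair a a' e1 e2
    using quartic_root_set[OF disc(1)] quartic_root_set[OF disc(2)] e1(2) e2(2)
    by (simp add: quartic_pair_def root_pair_def root_pair_axioms_def)
  obtain H where H: "P.J = perm2 ` H" "pm_subgroup H"
    using pm_subgroup_of_image[OF P.J_subgroup] .
  have "perm4 ` fst ` H = perm4 ` set L1" "perm4 ` snd ` H = perm4 ` set L2"
    using P.fst_J P.snd_J e1(3) e2(3) by (simp_all add: H(1) G_single_Gal image_image perm2_def)
  then have FS: "fst ` H = set L1" "snd ` H = set L2"
    by (simp_all add: inj_image_eq_iff inj_on_def perm_inj)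
  interpret S: standard_pair a a' e1 e2 H L1 L2
    using P.quartic_pair_axioms H FS by (simp add: standard_pair_def standard_pair_axioms_def)
  have "Coset.order (G_single a) = length (remdups L1)"
    using iso_same_card[OF S.G_single_1] card_perm4[of L1] by (simp add: Coset.order_def)
  \<comment> \<open>Among the orders 24, 12, 8, 4, 4, 4, 6, 3 of the standard groups, 6 and 3 occur
    once each, so the order identifies the list.\<close>
  then have L1: "L1 = S3l \<and> G_single a \<cong> Sym 3 \<or> L1 = C3l \<and> G_single a \<cong> Cyc 3"
    using cases e1(1) length_lists by (auto simp: standard_lists_def)
  have L2_cases: "L2 = S4l \<or> L2 = A4l \<or> L2 = D4l \<or> L2 = C4l \<or> L2 = V4l \<or> L2 = W4l \<or> L2 = S3l \<or> L2 = C3l"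
    using e2(1) by (auto simp: standard_lists_def)
  note S = S.standard_pair_axioms
  from L1 show ?thesis
  proof (elim disjE conjE)
    assume L: "L1 = S3l" and L3: "G_single a \<cong> Sym 3"
    from L2_cases show ?thesis
    proof (elim disjE)
      assume L2: "L2 = S4l"
      interpret S: standard_pair a a' e1 e2 H S3l S4l using S L L2 by simp
      have a': "G_single a' \<cong> Sym 4" by (rule iso_trans[OF S.G_single_2 iso_S4])
      \<comment> \<open>Unfolding the list of kernels leaves one case per kernel, after the full
        product and before the graph.\<close>
      from S.S3_trichotomy[OF refl S4l_def presented(1) kernels_checks(1), unfolded list_ex_Cons_iff list_ex_Nil_iff simp_thms]
      show ?thesis
      proof (elim disjE bexE, goal_cases)
        case 1
        from S.row_full[OF 1 product_types(1) product_iso[OF iso_S3 iso_S4]] show ?case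
          by (simp only: row_simps L3 a')
      next
        case 2
        from S.row_fibre[OF two refl 2 fibre_types(1) iso_72_43] show ?case
          by (simp only: row_simps L3 a')
      next
        case (3 us)
        from S.graph_check_row[OF graph_checks(1) 3 subset_refl iso_S4] show ?case
          by (simp only: row_simps L3 a')
      qed
    next
      assume L2: "L2 = A4l"
      interpret S: standard_pair a a' e1 e2 H S3l A4l using S L L2 by simp
      have a': "G_single a' \<cong> Alt 4" by (rule iso_trans[OF S.G_single_2 iso_A4])
      from S.S3_trichotomy[OF refl A4l_def presented(2) kernels_checks(2), unfolded list_ex_Cons_iff list_ex_Nil_iff simp_thms]
      show ?thesis
      proof (elim disjE bexE, goal_cases)
        case 1
        from S.row_full[OF 1 product_types(2) product_iso[OF iso_S3 iso_A4]] show ?case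
          by (simp only: row_simps L3 a')
      next
        case (2 us)
        from S.no_map_contradiction[OF no_map_checks(1) 2] show ?case ..
      qed
    next
      assume L2: "L2 = D4l"
      interpret S: standard_pair a a' e1 e2 H S3l D4l using S L L2 by simp
      have a': "G_single a' \<cong> Dih 4" by (rule iso_trans[OF S.G_single_2 iso_D4])
      from S.S3_trichotomy[OF refl D4l_def presented(3) kernels_checks(3), unfolded list_ex_Cons_iff list_ex_Nil_iff simp_thms]
      show ?thesis
      proof (elim disjE bexE, goal_cases)
        case 1
        from S.row_full[OF 1 product_types(3) product_iso[OF iso_S3 iso_D4]] show ?case
          by (simp only: row_simps L3 a')
      next
        case 2
        from S.row_fibre[OF two refl 2 fibre_types(2) iso_D12] show ?case
          by (simp only: row_simps L3 a')
      next
        case 3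
        from S.row_fibre[OF two refl 3 fibre_types(3) iso_24_8_V] show ?case
          by (simp only: row_simps L3 a')
      next
        case 4
        from S.row_fibre[OF two refl 4 fibre_types(4) iso_24_8_D] show ?case
          by (simp only: row_simps L3 a')
      next
        case (5 us)
        from S.no_map_contradiction[OF no_map_checks(2) 5] show ?case ..
      qed
    next
      assume L2: "L2 = C4l"
      interpret S: standard_pair a a' e1 e2 H S3l C4l using S L L2 by simp
      have a': "G_single a' \<cong> Cyc 4" by (rule iso_trans[OF S.G_single_2 iso_C4])
      from S.S3_trichotomy[OF refl C4l_def presented(4) kernels_checks(4), unfolded list_ex_Cons_iff list_ex_Nil_iff simp_thms]
      show ?thesis
      proof (elim disjE bexE, goal_cases)
        case 1
        from S.row_full[OF 1 product_types(4) product_iso[OF iso_S3 iso_C4]] show ?case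
          by (simp only: row_simps L3 a')
      next
        case 2
        from S.row_fibre[OF two refl 2 fibre_types(5) iso_12_1] show ?case
          by (simp only: row_simps L3 a')
      next
        case (3 us)
        from S.no_map_contradiction[OF no_map_checks(3) 3] show ?case ..
      qed
    next
      assume L2: "L2 = V4l"
      interpret S: standard_pair a a' e1 e2 H S3l V4l using S L L2 by simp
      have a': "G_single a' \<cong> Klein" by (rule iso_trans[OF S.G_single_2 iso_V4])
      from S.S3_trichotomy[OF refl V4l_def presented(5) kernels_checks(5), unfolded list_ex_Cons_iff list_ex_Nil_iff simp_thms]
      show ?thesis
      proof (elim disjE bexE, goal_cases)
        case 1
        from S.row_full[OF 1 product_types(5) product_iso[OF iso_S3 iso_V4]] show ?case
          by (simp only: row_simps L3 a')
      next
        case 2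
        from S.row_fibre[OF two refl 2 fibre_types(6) iso_D6[OF D6_checks(1)]] show ?case
          by (simp only: row_simps L3 a')
      next
        case 3
        from S.row_fibre[OF two refl 3 fibre_types(7) iso_D6[OF D6_checks(2)]] show ?case
          by (simp only: row_simps L3 a')
      next
        case 4
        from S.row_fibre[OF two refl 4 fibre_types(8) iso_D6[OF D6_checks(3)]] show ?case
          by (simp only: row_simps L3 a')
      next
        case (5 us)
        from S.no_map_contradiction[OF no_map_checks(4) 5] show ?case ..
      qed
    next
      \<comment> \<open>The same abstract group as in the preceding case, but intransitive on the
        roots, which accounts for the rows with finer orbits.\<close>
      assume L2: "L2 = W4l"
      interpret S: standard_pair a a' e1 e2 H S3l W4l using S L L2 by simp
      have a': "G_single a' \<cong> Klein" by (rule iso_trans[OF S.G_single_2 iso_W4])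
      from S.S3_trichotomy[OF refl W4l_def presented(6) kernels_checks(6), unfolded list_ex_Cons_iff list_ex_Nil_iff simp_thms]
      show ?thesis
      proof (elim disjE bexE, goal_cases)
        case 1
        from S.row_full[OF 1 product_types(6) product_iso[OF iso_S3 iso_W4]] show ?case
          by (simp only: row_simps L3 a')
      next
        case 2
        from S.row_fibre[OF two refl 2 fibre_types(9) iso_D6[OF D6_checks(4)]] show ?case
          by (simp only: row_simps L3 a')
      next
        case 3
        from S.row_fibre[OF two refl 3 fibre_types(10) iso_D6[OF D6_checks(5)]] show ?case
          by (simp only: row_simps L3 a')
      next
        case 4
        from S.row_fibre[OF two refl 4 fibre_types(11) iso_D6[OF D6_checks(6)]] show ?case
          by (simp only: row_simps L3 a')
      next
        case (5 us)
        from S.no_map_contradiction[OF no_map_checks(5) 5] show ?case ..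
      qed
    next
      assume L2: "L2 = S3l"
      interpret S: standard_pair a a' e1 e2 H S3l S3l using S L L2 by simp
      have a': "G_single a' \<cong> Sym 3" by (rule iso_trans[OF S.G_single_2 iso_S3])
      from S.S3_trichotomy[OF refl S3l_def presented(7) kernels_checks(7), unfolded list_ex_Cons_iff list_ex_Nil_iff simp_thms]
      show ?thesis
      proof (elim disjE bexE, goal_cases)
        case 1
        from S.row_full[OF 1 product_types(7) product_iso[OF iso_S3 iso_S3]] show ?case
          by (simp only: row_simps L3 a')
      next
        case 2
        from S.row_fibre[OF two refl 2 fibre_types(12) iso_18_4] show ?case
          by (simp only: row_simps L3 a')
      next
        case (3 us)
        from S.graph_check_row[OF graph_checks(2) 3 subset_refl iso_S3] show ?case
          by (simp only: row_simps L3 a')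
      qed
    next
      assume L2: "L2 = C3l"
      interpret S: standard_pair a a' e1 e2 H S3l C3l using S L L2 by simp
      have a': "G_single a' \<cong> Cyc 3" by (rule iso_trans[OF S.G_single_2 iso_C3])
      from S.S3_trichotomy[OF refl C3l_def presented(8) kernels_checks(8), unfolded list_ex_Cons_iff list_ex_Nil_iff simp_thms]
      show ?thesis
      proof (elim disjE bexE, goal_cases)
        case 1
        from S.row_full[OF 1 product_types(8) product_iso[OF iso_S3 iso_C3]] show ?case
          by (simp only: row_simps L3 a')
      next
        case (2 us)
        from S.no_map_contradiction[OF no_map_checks(6) 2] show ?case ..
      qed
    qed
  next
    assume L: "L1 = C3l" and L3: "G_single a \<cong> Cyc 3"
    from L2_cases show ?thesis
    proof (elim disjE)
      assume L2: "L2 = S4l"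
      interpret S: standard_pair a a' e1 e2 H C3l S4l using S L L2 by simp
      have a': "G_single a' \<cong> Sym 4" by (rule iso_trans[OF S.G_single_2 iso_S4])
      from S.C3_dichotomy[OF refl S4l_def presented(1)]
      show ?thesis
      proof (elim disjE bexE, goal_cases)
        case 1
        from S.row_full[OF 1 product_types(9) product_iso[OF iso_C3 iso_S4]] show ?case
          by (simp only: row_simps L3 a')
      next
        case (2 us)
        from S.no_map_contradiction[OF no_map_checks(7) 2] show ?case ..
      qed
    next
      assume L2: "L2 = A4l"
      interpret S: standard_pair a a' e1 e2 H C3l A4l using S L L2 by simp
      have a': "G_single a' \<cong> Alt 4" by (rule iso_trans[OF S.G_single_2 iso_A4])
      from S.C3_dichotomy[OF refl A4l_def presented(2)]
      show ?thesis
      proof (elim disjE bexE, goal_cases)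
        case 1
        from S.row_full[OF 1 product_types(10) product_iso[OF iso_C3 iso_A4]] show ?case
          by (simp only: row_simps L3 a')
      next
        case (2 us)
        from S.graph_check_row[OF graph_checks(3) 2 C3_subset_S3 iso_A4] show ?case
          by (simp only: row_simps L3 a')
      qed
    next
      assume L2: "L2 = D4l"
      interpret S: standard_pair a a' e1 e2 H C3l D4l using S L L2 by simp
      have a': "G_single a' \<cong> Dih 4" by (rule iso_trans[OF S.G_single_2 iso_D4])
      from S.C3_dichotomy[OF refl D4l_def presented(3)]
      show ?thesis
      proof (elim disjE bexE, goal_cases)
        case 1
        from S.row_full[OF 1 product_types(11) product_iso[OF iso_C3 iso_D4]] show ?case
          by (simp only: row_simps L3 a')
      next
        case (2 us)
        from S.no_map_contradiction[OF no_map_checks(8) 2] show ?case ..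
      qed
    next
      assume L2: "L2 = C4l"
      interpret S: standard_pair a a' e1 e2 H C3l C4l using S L L2 by simp
      have a': "G_single a' \<cong> Cyc 4" by (rule iso_trans[OF S.G_single_2 iso_C4])
      from S.C3_dichotomy[OF refl C4l_def presented(4)]
      show ?thesis
      proof (elim disjE bexE, goal_cases)
        case 1
        \<comment> \<open>The product of C3 and C4 is entered in the table as the cyclic group of
          order 12.\<close>
        from S.row_full[OF 1 product_types(12) iso_C12] show ?case
          by (simp only: row_simps L3 a')
      next
        case (2 us)
        from S.no_map_contradiction[OF no_map_checks(9) 2] show ?case ..
      qed
    next
      assume L2: "L2 = V4l"
      interpret S: standard_pair a a' e1 e2 H C3l V4l using S L L2 by simp
      have a': "G_single a' \<cong> Klein" by (rule iso_trans[OF S.G_single_2 iso_V4])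
      from S.C3_dichotomy[OF refl V4l_def presented(5)]
      show ?thesis
      proof (elim disjE bexE, goal_cases)
        case 1
        from S.row_full[OF 1 product_types(13) product_iso[OF iso_C3 iso_V4]] show ?case
          by (simp only: row_simps L3 a')
      next
        case (2 us)
        from S.no_map_contradiction[OF no_map_checks(10) 2] show ?case ..
      qed
    next
      assume L2: "L2 = W4l"
      interpret S: standard_pair a a' e1 e2 H C3l W4l using S L L2 by simp
      have a': "G_single a' \<cong> Klein" by (rule iso_trans[OF S.G_single_2 iso_W4])
      from S.C3_dichotomy[OF refl W4l_def presented(6)]
      show ?thesis
      proof (elim disjE bexE, goal_cases)
        case 1
        from S.row_full[OF 1 product_types(14) product_iso[OF iso_C3 iso_W4]] show ?case
          by (simp only: row_simps L3 a')
      next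
        case (2 us)
        from S.no_map_contradiction[OF no_map_checks(11) 2] show ?case ..
      qed
    next
      assume L2: "L2 = S3l"
      interpret S: standard_pair a a' e1 e2 H C3l S3l using S L L2 by simp
      have a': "G_single a' \<cong> Sym 3" by (rule iso_trans[OF S.G_single_2 iso_S3])
      from S.C3_dichotomy[OF refl S3l_def presented(7)]
      show ?thesis
      proof (elim disjE bexE, goal_cases)
        case 1
        from S.row_full[OF 1 product_types(15) product_iso[OF iso_C3 iso_S3]] show ?case
          by (simp only: row_simps L3 a')
      next
        case (2 us)
        from S.no_map_contradiction[OF no_map_checks(12) 2] show ?case ..
      qed
    next
      assume L2: "L2 = C3l"
      interpret S: standard_pair a a' e1 e2 H C3l C3l using S L L2 by simp
      have a': "G_single a' \<cong> Cyc 3" by (rule iso_trans[OF S.G_single_2 iso_C3])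
      from S.C3_dichotomy[OF refl C3l_def presented(8)]
      show ?thesis
      proof (elim disjE bexE, goal_cases)
        case 1
        from S.row_full[OF 1 product_types(16) product_iso[OF iso_C3 iso_C3]] show ?case
          by (simp only: row_simps L3 a')
      next
        case (2 us)
        from S.graph_check_row[OF graph_checks(4) 2 C3_subset_S3 iso_C3] show ?case
          by (simp only: row_simps L3 a')
      qed
    qed
  qed
qed

end
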